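(* Let $X$ be any of the finite classical groups $GU(2m,q^2)$, $GU(2m+1,q^2)$, $Sp(2m,q)$, $O^+(2m,q)$, $O^-(2m+2,q)$, $O(2m+1,q)$, with field of definition $\mathbb{F}$, natural module $V=\mathbb{F}^n$, defining form $h\in\mathbb{F}[V]$ and associated $p$-subgroup $\mathfrak{G}\le X$ as specified in the context. Then the invariant field $\mathbb{F}(V)^{\mathfrak{G}}=\mathrm{Quot}(\mathbb{F}[V]^{\mathfrak{G}})$ is purely transcendental over $\mathbb{F}$, and it is generated over $\mathbb{F}$ by $\mathfrak{G}$-orbit products of the variables $x_1,\dots,x_n$ and Steenrod images of the form $h$.
   Context: Let $q$ be a power of a prime $p$ and $m\ge 1$. The field $\mathbb{F}$ is $\mathbb{F}_{q^2}$ for the unitary groups and $\mathbb{F}_q$ otherwise; $r=|\mathbb{F}|$. $V=\mathbb{F}^n$ (column vectors), $x_1,\dots,x_n$ is the dual basis of the standard basis, $\mathbb{F}[V]=\mathbb{F}[x_1,\dots,x_n]$, and a group $G\le GL_n(\mathbb{F})$ acts by $(g\cdot f)(v)=f(g^{-1}v)$. The $G$-orbit product of $x_i$ is $N(x_i)=\prod_{y\in G\cdot x_i}y$ (product over the orbit). For a matrix $A$ put $\bar A=[a_{ij}^q]$ (so $\bar A=A$ over $\mathbb{F}_q$). $U(n,\mathbb{F})$ is the group of lower triangular $n\times n$ matrices with ones on the diagonal. $J_k$ is the $k\times k$ matrix with ones on the antidiagonal and zeros elsewhere (blocks of size $0$ are omitted). Steenrod operations: for $f\in\mathbb{F}[V]$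 the elements $\mathcal{P}^i(f)$ are defined by $\sum_{i\ge0}\mathcal{P}^i(f)\zeta^i=\mathcal{P}(\zeta)(f)$, where $\mathcal{P}(\zeta):\mathbb{F}[V]\to\mathbb{F}[V][[\zeta]]$ is the $\mathbb{F}$-algebra homomorphism with $x_j\mapsto x_j+x_j^{r}\zeta$. The Steenrod algebra $\mathcal{A}$ is the $\mathbb{F}$-subalgebra of $\mathrm{End}_{\mathbb{F}}(\mathbb{F}[V])$ generated by all $\mathcal{P}^i$, $i\ge 0$ ($\mathcal{P}^0=\mathrm{id}$). A Steenrod image of $h$ is an element $\theta(h)$ with $\theta\in\mathcal{A}$. Block notation: for $k,l\ge 0$ write $N\in U(2k+l,\mathbb{F})$ as $N=\begin{pmatrix}A&0&0\\ B&F&0\\ C&D&E\end{pmatrix}$ with $A,E\in U(k,\mathbb{F})$, $F\in U(l,\mathbb{F})$. For $\epsilon=\pm1$ and $X_2$ an $l\times l$ matrix with $X_2=\epsilon\bar X_2^T$ put $$\mathfrak{G}^{\epsilon}_{J_k,X_2}=\{N\in U(2k+l,\mathbb{F}) : N^TY\bar N=Y\},\qquad Y=\begin{pmatrix}0&0&J_k\\ 0&X_2&0\\ \epsilon J_k&0&0\end{pmatrix}.$$ For $N$ in this group put $S=A^TJ_k\bar C$ (entries $s_{ij}$), and let $b_{ij}$ be the entries of $B$. The groups $X$ (each the stabilizer of $h$, equivalently of the indicated form), the forms $h$ and the subgroups $\mathfrak{G}$: (1) $X=GU(2m,q^2)=\{M\in GL_{2m}(\mathbb{F}_{q^2}):M^TJ_{2m}\bar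 M=J_{2m}\}$, $n=2m$, $h=\sum_{i=1}^m(x_{2m-i+1}^qx_i+x_{2m-i+1}x_i^q)$, $\mathfrak{G}=\mathfrak{G}^{+}_{J_{m-1},J_2}$. (2) $X=GU(2m+1,q^2)=\{M\in GL_{2m+1}(\mathbb{F}_{q^2}):M^TJ_{2m+1}\bar M=J_{2m+1}\}$, $n=2m+1$, $h=\sum_{i=1}^m(x_{2m+2-i}^qx_i+x_{2m+2-i}x_i^q)+x_{m+1}^{q+1}$, $\mathfrak{G}=\mathfrak{G}^{+}_{J_m,[1]}$. (3) $X=Sp(2m,q)$, the group of $M\in GL_{2m}(\mathbb{F}_q)$ with $M^TYM=Y$ where $Y=\begin{pmatrix}0&0&J_{m-1}\\ 0&X_2&0\\ -J_{m-1}&0&0\end{pmatrix}$ and $X_2=\begin{pmatrix}0&1\\ -1&0\end{pmatrix}$; $n=2m$, $h=\sum_{i=1}^m(x_{2m-i+1}^qx_i-x_{2m-i+1}x_i^q)$, $\mathfrak{G}=\mathfrak{G}^{-}_{J_{m-1},X_2}$. In the orthogonal cases $X$ is the group of all invertible matrices over $\mathbb{F}_q$ preserving the quadratic form $h$: (4) $X=O^+(2m,q)$, $n=2m$, $h=\sum_{i=1}^mx_{2m-i+1}x_i$. If $q$ is odd, $\mathfrak{G}=\mathfrak{G}^{+}_{J_{m-1},J_2}$. If $q$ is even, $\mathfrak{G}=G_1$ is the group of all $N\in\mathfrak{G}^{+}_{J_{m-1},J_2}$ with $F=I_2$ and $s_{ii}=b_{1i}b_{2i}$ for $1\le i\le m-1$.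 (5) $X=O^-(2m+2,q)$, $n=2m+2$, $h=\sum_{i=1}^mx_{2m+3-i}x_i+x_{m+1}^2+x_{m+1}x_{m+2}+ax_{m+2}^2$, where $a\in\mathbb{F}_q$ is such that $T^2+T+a$ is irreducible in $\mathbb{F}_q[T]$. If $q$ is odd, $\mathfrak{G}=\mathfrak{G}^{+}_{J_m,X_2}$ with $X_2=\begin{pmatrix}2&1\\ 1&2a\end{pmatrix}$. If $q$ is even, $\mathfrak{G}=G_1$ is the group of all $N\in\mathfrak{G}^{+}_{J_m,J_2}$ with $F=I_2$ and $s_{ii}=b_{1i}^2+b_{1i}b_{2i}+ab_{2i}^2$ for $1\le i\le m$. (6) $X=O(2m+1,q)$, $n=2m+1$, $h=\sum_{i=1}^mx_{2m+2-i}x_i+x_{m+1}^2$. If $q$ is odd, $\mathfrak{G}=\mathfrak{G}^{+}_{J_m,[2]}$. If $q$ is even, $\mathfrak{G}$ is the group of all $N\in\mathfrak{G}^{+}_{J_m,[0]}$ with $s_{ii}=b_{1i}^2$ for $1\le i\le m$. (In all cases except (4),(5) with $q$ even, $\mathfrak{G}$ is a Sylow $p$-subgroup of $X$; in those two cases it is a maximal subgroup of a Sylow $2$-subgroup.) *)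

theory Defs
  imports
    "Jordan_Normal_Form.Gauss_Jordan_Elimination"
    "HOL-Library.Poly_Mapping"
    "HOL-Library.Cardinality"
    "HOL-Computational_Algebra.Computational_Algebra"
    "HOL-Number_Theory.Prime_Powers"
    "HOL-Algebra.Generated_Fields"
    "HOL-Algebra.Algebraic_Closure_Type"
begin

section \<open>Polynomial rings and rational function fields\<close>

text \<open>
  \<open>('v, 'a) mvpoly\<close> is the ring of polynomials over \<open>'a\<close> in commuting variables indexed by \<open>'v\<close>.
  The ring \<open>F[V]\<close> for \<open>V = F^n\<close> is the subring of polynomials of type \<open>(nat, 'a) mvpoly\<close>
  involving only the variables with index \<open>< n\<close>. As matrix indices start at \<open>0\<close>, so do the
  indices of the variables: \<open>mvar i\<close> is the coordinate function usually written \<open>x_(i+1)\<close>.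
\<close>

type_synonym ('v, 'a) mvpoly = "('v \<Rightarrow>\<^sub>0 nat) \<Rightarrow>\<^sub>0 'a"

definition mconst :: "'a::comm_semiring_1 \<Rightarrow> ('v, 'a) mvpoly" where
  "mconst c = Poly_Mapping.single 0 c"

definition mvar :: "'v \<Rightarrow> ('v, 'a::comm_semiring_1) mvpoly" where
  "mvar i = Poly_Mapping.single (Poly_Mapping.single i 1) 1"

definition polys_in :: "'v set \<Rightarrow> ('v, 'a::comm_semiring_1) mvpoly set" where
  "polys_in I = {f. \<forall>m\<in>Poly_Mapping.keys f. Poly_Mapping.keys m \<subseteq> I}"

text \<open>Evaluation at \<open>\<sigma>\<close>, with coefficients mapped along the ring homomorphism \<open>\<phi>\<close>.\<close>

definition meval :: "('a::comm_semiring_1 \<Rightarrow> 'b::comm_semiring_1) \<Rightarrow> ('v \<Rightarrow> 'b) \<Rightarrow> ('v, 'a) mvpoly \<Rightarrow> 'b" where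
  "meval \<phi> \<sigma> f = (\<Sum>m\<in>Poly_Mapping.keys f.
     \<phi> (Poly_Mapping.lookup f m) * (\<Prod>i\<in>Poly_Mapping.keys m. \<sigma> i ^ Poly_Mapping.lookup m i))"

abbreviation poly_ring :: "nat \<Rightarrow> (nat, 'a::comm_semiring_1) mvpoly set" where
  "poly_ring n \<equiv> polys_in {..<n}"

definition quot_field :: "'r::idom set \<Rightarrow> 'r fract set" where
  "quot_field A = {Fract a b | a b. a \<in> A \<and> b \<in> A \<and> b \<noteq> 0}"

type_synonym 'a ratfun = "(nat, 'a) mvpoly fract"

definition fconst :: "'a::idom \<Rightarrow> 'a ratfun" where
  "fconst c = to_fract (mconst c)"

definition field_adjoin :: "'a::field ratfun set \<Rightarrow> 'a ratfun set" where
  "field_adjoin S = generate_field ring_of_type_algebra (range fconst \<union> S)"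

text \<open>In \<open>algebraically_independent B\<close> the elements of \<open>B\<close> serve as their own variable names.\<close>

definition algebraically_independent :: "'a::field ratfun set \<Rightarrow> bool" where
  "algebraically_independent B \<longleftrightarrow>
     (\<forall>f :: ('a ratfun, 'a) mvpoly. f \<in> polys_in B \<longrightarrow> meval fconst (\<lambda>b. b) f = 0 \<longrightarrow> f = 0)"

definition purely_transcendental :: "'a::field ratfun set \<Rightarrow> bool" where
  "purely_transcendental K \<longleftrightarrow> (\<exists>B. algebraically_independent B \<and> K = field_adjoin B)"


section \<open>Linear group actions and invariants\<close>

definition GL :: "nat \<Rightarrow> 'a::field mat set" where
  "GL n = {M \<in> carrier_mat n n. invertible_mat M}"

text \<open>
  The action \<open>(g \<cdot> f)(v) = f(g\<^sup>-\<^sup>1 v)\<close>: the variable with index \<open>j\<close> is replaced by the \<open>j\<close>-th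
  coordinate of \<open>g\<^sup>-\<^sup>1 v\<close>. Only meant for \<open>g \<in> GL n\<close> and \<open>f \<in> poly_ring n\<close>.
\<close>

definition act :: "'a::field mat \<Rightarrow> (nat, 'a) mvpoly \<Rightarrow> (nat, 'a) mvpoly" where
  "act g = meval mconst (\<lambda>j. \<Sum>k<dim_row g. mconst (the (mat_inverse g) $$ (j, k)) * mvar k)"

definition invariant_ring :: "nat \<Rightarrow> 'a::field mat set \<Rightarrow> (nat, 'a) mvpoly set" where
  "invariant_ring n G = {f \<in> poly_ring n. \<forall>g\<in>G. act g f = f}"

text \<open>
  \<open>F(V)\<^sup>G\<close>, the fixed points of the induced action \<open>g \<cdot> (a / b) = (g \<cdot> a) / (g \<cdot> b)\<close> on \<open>F(V)\<close>;
  since \<open>act g\<close> is an injective ring homomorphism on \<open>F[V]\<close>, the condition does not depend on the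
  chosen representation of the fraction.
\<close>

definition invariant_field :: "nat \<Rightarrow> 'a::field mat set \<Rightarrow> 'a ratfun set" where
  "invariant_field n G =
     {Fract a b | a b. a \<in> poly_ring n \<and> b \<in> poly_ring n \<and> b \<noteq> 0 \<and>
                       (\<forall>g\<in>G. Fract (act g a) (act g b) = Fract a b)}"

definition orbit_product :: "'a::field mat set \<Rightarrow> nat \<Rightarrow> (nat, 'a) mvpoly" where
  "orbit_product G i = (\<Prod>y\<in>(\<lambda>g. act g (mvar i)) ` G. y)"


section \<open>Steenrod operations\<close>

definition steenrod_series :: "(nat, 'a::finite_field) mvpoly \<Rightarrow> (nat, 'a) mvpoly fps" where
  "steenrod_series =
     meval (\<lambda>c. fps_const (mconst c))
           (\<lambda>j. fps_const (mvar j) + fps_const (mvar j ^ CARD('a)) * fps_X)"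

definition steenrod_op :: "nat \<Rightarrow> (nat, 'a::finite_field) mvpoly \<Rightarrow> (nat, 'a) mvpoly" where
  "steenrod_op i f = fps_nth (steenrod_series f) i"

text \<open>
  The operators are defined on polynomials in all variables at once; they preserve each
  \<open>poly_ring n\<close>. The identity is \<open>steenrod_op 0\<close>.
\<close>

inductive_set steenrod_algebra :: "((nat, 'a::finite_field) mvpoly \<Rightarrow> (nat, 'a) mvpoly) set" where
  op: "steenrod_op i \<in> steenrod_algebra"
| add: "\<theta> \<in> steenrod_algebra \<Longrightarrow> \<eta> \<in> steenrod_algebra \<Longrightarrow> (\<lambda>f. \<theta> f + \<eta> f) \<in> steenrod_algebra"
| scale: "\<theta> \<in> steenrod_algebra \<Longrightarrow> (\<lambda>f. mconst c * \<theta> f) \<in> steenrod_algebra"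
| comp: "\<theta> \<in> steenrod_algebra \<Longrightarrow> \<eta> \<in> steenrod_algebra \<Longrightarrow> \<theta> \<circ> \<eta> \<in> steenrod_algebra"

definition steenrod_images :: "(nat, 'a::finite_field) mvpoly \<Rightarrow> (nat, 'a) mvpoly set" where
  "steenrod_images h = {\<theta> h | \<theta>. \<theta> \<in> steenrod_algebra}"


section \<open>Classical groups, their forms and the associated \<open>p\<close>-subgroups\<close>

text \<open>Over the field with \<open>q\<close> elements, \<open>bar q\<close> is the identity.\<close>

definition bar :: "nat \<Rightarrow> 'a::field mat \<Rightarrow> 'a mat" where
  "bar q A = map_mat (\<lambda>x. x ^ q) A"

definition Jmat :: "nat \<Rightarrow> 'a::field mat" where
  "Jmat k = mat k k (\<lambda>(i, j). if i + j + 1 = k then 1 else 0)"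

definition unitriangular :: "nat \<Rightarrow> 'a::field mat set" where
  "unitriangular n = {N \<in> carrier_mat n n. \<forall>i<n. N $$ (i, i) = 1 \<and> (\<forall>j<n. i < j \<longrightarrow> N $$ (i, j) = 0)}"

definition block :: "nat \<Rightarrow> nat \<Rightarrow> nat \<Rightarrow> nat \<Rightarrow> 'a mat \<Rightarrow> 'a mat" where
  "block r nr c nc N = mat nr nc (\<lambda>(i, j). N $$ (r + i, c + j))"

text \<open>The blocks of a lower block triangular matrix \<open>N = (A 0 0; B F 0; C D E)\<close> of type \<open>(k, l, k)\<close>.\<close>

definition block_A :: "nat \<Rightarrow> 'a mat \<Rightarrow> 'a mat" where
  "block_A k N = block 0 k 0 k N"

definition block_B :: "nat \<Rightarrow> nat \<Rightarrow> 'a mat \<Rightarrow> 'a mat" where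
  "block_B k l N = block k l 0 k N"

definition block_F :: "nat \<Rightarrow> nat \<Rightarrow> 'a mat \<Rightarrow> 'a mat" where
  "block_F k l N = block k l k l N"

definition block_C :: "nat \<Rightarrow> nat \<Rightarrow> 'a mat \<Rightarrow> 'a mat" where
  "block_C k l N = block (k + l) k 0 k N"

text \<open>The matrix \<open>Y = (0 0 J_k; 0 X2 0; \<epsilon> J_k 0 0)\<close>.\<close>

definition form_mat :: "nat \<Rightarrow> nat \<Rightarrow> 'a::field \<Rightarrow> 'a mat \<Rightarrow> 'a mat" where
  "form_mat k l \<epsilon> X2 = mat (2 * k + l) (2 * k + l) (\<lambda>(i, j).
     if i < k \<and> k + l \<le> j then Jmat k $$ (i, j - (k + l))
     else if k \<le> i \<and> i < k + l \<and> k \<le> j \<and> j < k + l then X2 $$ (i - k, j - k)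
     else if k + l \<le> i \<and> j < k then \<epsilon> * Jmat k $$ (i - (k + l), j)
     else 0)"

definition form_group :: "nat \<Rightarrow> nat \<Rightarrow> nat \<Rightarrow> 'a::field \<Rightarrow> 'a mat \<Rightarrow> 'a mat set" where
  "form_group q k l \<epsilon> X2 =
     {N \<in> unitriangular (2 * k + l).
        transpose_mat N * form_mat k l \<epsilon> X2 * bar q N = form_mat k l \<epsilon> X2}"

definition S_mat :: "nat \<Rightarrow> nat \<Rightarrow> nat \<Rightarrow> 'a::field mat \<Rightarrow> 'a mat" where
  "S_mat q k l N = transpose_mat (block_A k N) * Jmat k * bar q (block_C k l N)"

definition GU :: "nat \<Rightarrow> nat \<Rightarrow> 'a::field mat set" where
  "GU q n = {M \<in> GL n. transpose_mat M * Jmat n * bar q M = Jmat n}"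

definition Sp_X2 :: "'a::field mat" where
  "Sp_X2 = mat_of_rows_list 2 [[0, 1], [-1, 0]]"

definition Sp :: "nat \<Rightarrow> 'a::field mat set" where
  "Sp m = {M \<in> GL (2 * m). transpose_mat M * form_mat (m - 1) 2 (-1) Sp_X2 * M
                           = form_mat (m - 1) 2 (-1) Sp_X2}"

definition orthogonal_group :: "nat \<Rightarrow> (nat, 'a::field) mvpoly \<Rightarrow> 'a mat set" where
  "orthogonal_group n h = {M \<in> GL n. act M h = h}"

definition h_GU_even :: "nat \<Rightarrow> nat \<Rightarrow> (nat, 'a::field) mvpoly" where
  "h_GU_even q m =
     (\<Sum>i<m. mvar (2*m - 1 - i) ^ q * mvar i + mvar (2*m - 1 - i) * mvar i ^ q)"

definition h_GU_odd :: "nat \<Rightarrow> nat \<Rightarrow> (nat, 'a::field) mvpoly" where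
  "h_GU_odd q m =
     (\<Sum>i<m. mvar (2*m - i) ^ q * mvar i + mvar (2*m - i) * mvar i ^ q) + mvar m ^ (q + 1)"

definition h_Sp :: "nat \<Rightarrow> nat \<Rightarrow> (nat, 'a::field) mvpoly" where
  "h_Sp q m =
     (\<Sum>i<m. mvar (2*m - 1 - i) ^ q * mvar i - mvar (2*m - 1 - i) * mvar i ^ q)"

definition h_O_plus :: "nat \<Rightarrow> (nat, 'a::field) mvpoly" where
  "h_O_plus m = (\<Sum>i<m. mvar (2*m - 1 - i) * mvar i)"

definition h_O_minus :: "'a \<Rightarrow> nat \<Rightarrow> (nat, 'a::field) mvpoly" where
  "h_O_minus a m =
     (\<Sum>i<m. mvar (2*m + 1 - i) * mvar i)
       + mvar m ^ 2 + mvar m * mvar (m + 1) + mconst a * mvar (m + 1) ^ 2"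

definition h_O_odd :: "nat \<Rightarrow> (nat, 'a::field) mvpoly" where
  "h_O_odd m = (\<Sum>i<m. mvar (2*m - i) * mvar i) + mvar m ^ 2"

text \<open>
  \<open>classical_group q m Cl n h G\<close>: \<open>Cl\<close> is one of the finite classical groups with parameters
  \<open>q\<close> and \<open>m\<close>, acting on \<open>F^n\<close>, with defining form \<open>h\<close> and associated \<open>p\<close>-subgroup \<open>G\<close>. The field
  of definition is the type \<open>'a\<close>. The parameter \<open>m\<close> is meant to be positive.
\<close>

inductive classical_group ::
  "nat \<Rightarrow> nat \<Rightarrow> 'a::finite_field mat set \<Rightarrow> nat \<Rightarrow> (nat, 'a) mvpoly \<Rightarrow> 'a mat set \<Rightarrow> bool"
where
  GU_even:
    "CARD('a) = q ^ 2 \<Longrightarrow>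
     classical_group q m (GU q (2*m) :: 'a mat set) (2*m) (h_GU_even q m)
       (form_group q (m - 1) 2 1 (Jmat 2))"
| GU_odd:
    "CARD('a) = q ^ 2 \<Longrightarrow>
     classical_group q m (GU q (2*m + 1) :: 'a mat set) (2*m + 1) (h_GU_odd q m)
       (form_group q m 1 1 (mat_of_rows_list 1 [[1]]))"
| Sp:
    "CARD('a) = q \<Longrightarrow>
     classical_group q m (Sp m :: 'a mat set) (2*m) (h_Sp q m)
       (form_group q (m - 1) 2 (-1) Sp_X2)"
| O_plus_odd_char:
    "CARD('a) = q \<Longrightarrow> odd q \<Longrightarrow>
     classical_group q m (orthogonal_group (2*m) (h_O_plus m) :: 'a mat set) (2*m) (h_O_plus m)
       (form_group q (m - 1) 2 1 (Jmat 2))"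
| O_plus_even_char:
    "CARD('a) = q \<Longrightarrow> even q \<Longrightarrow>
     classical_group q m (orthogonal_group (2*m) (h_O_plus m) :: 'a mat set) (2*m) (h_O_plus m)
       {N \<in> form_group q (m - 1) 2 1 (Jmat 2).
          block_F (m - 1) 2 N = 1\<^sub>m 2 \<and>
          (\<forall>i<m - 1. S_mat q (m - 1) 2 N $$ (i, i)
             = block_B (m - 1) 2 N $$ (0, i) * block_B (m - 1) 2 N $$ (1, i))}"
| O_minus_odd_char:
    "CARD('a) = q \<Longrightarrow> odd q \<Longrightarrow> Factorial_Ring.irreducible [:a, 1, 1:] \<Longrightarrow>
     classical_group q m (orthogonal_group (2*m + 2) (h_O_minus a m) :: 'a mat set)
       (2*m + 2) (h_O_minus a m)
       (form_group q m 2 1 (mat_of_rows_list 2 [[2, 1], [1, 2 * a]]))"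
| O_minus_even_char:
    "CARD('a) = q \<Longrightarrow> even q \<Longrightarrow> Factorial_Ring.irreducible [:a, 1, 1:] \<Longrightarrow>
     classical_group q m (orthogonal_group (2*m + 2) (h_O_minus a m) :: 'a mat set)
       (2*m + 2) (h_O_minus a m)
       {N \<in> form_group q m 2 1 (Jmat 2).
          block_F m 2 N = 1\<^sub>m 2 \<and>
          (\<forall>i<m. S_mat q m 2 N $$ (i, i)
             = block_B m 2 N $$ (0, i) ^ 2
               + block_B m 2 N $$ (0, i) * block_B m 2 N $$ (1, i)
               + a * block_B m 2 N $$ (1, i) ^ 2)}"
| O_odd_odd_char:
    "CARD('a) = q \<Longrightarrow> odd q \<Longrightarrow>
     classical_group q m (orthogonal_group (2*m + 1) (h_O_odd m) :: 'a mat set)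
       (2*m + 1) (h_O_odd m)
       (form_group q m 1 1 (mat_of_rows_list 1 [[2]]))"
| O_odd_even_char:
    "CARD('a) = q \<Longrightarrow> even q \<Longrightarrow>
     classical_group q m (orthogonal_group (2*m + 1) (h_O_odd m) :: 'a mat set)
       (2*m + 1) (h_O_odd m)
       {N \<in> form_group q m 1 1 (mat_of_rows_list 1 [[0]]).
          \<forall>i<m. S_mat q m 1 N $$ (i, i) = block_B m 1 N $$ (0, i) ^ 2}"

end

theory Submission
  imports Defs "Jordan_Normal_Form.Determinant" "HOL-Number_Theory.Residues"
begin

section \<open>Polynomials\<close>

text \<open>Write r = |F| and n = 2k + l with l <= 2, and name the variables x_i =
  \<open>mvar i\<close> and y_i = \<open>mvar (n - 1 - i)\<close> for i < k, and z_t =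
  \<open>mvar (k + t)\<close> for t < l. Every form h has the shape
  \<open>bilin n k \<delta> \<epsilon>\<close> + \<mu>(z), the sum of all x_i y_i^\<delta> +
  \<epsilon> y_i x_i^\<delta> plus a form in the middle variables. Here \<delta> = q and \<epsilon>
  = 1 or -1 in the unitary and symplectic cases, and \<delta> = 1, \<epsilon> = 0 in the orthogonal
  ones. In every case the group G is \<open>isom n k l h\<close>, the lower unitriangular isometries
  of h whose middle block is the identity.

  The generators are the orbit products of the x_i and z_t together with k Steenrod images h_0, ...,
  h_(k-1) of h, where h_s contains the sum of the x_i y_i^(Q_s) with Q_s = \<delta> r^s; the
  operation of index Q_s turns the exponent Q_s into Q_s r (\<open>steenrod_sequence\<close>). For
  suitable weights on the variables, the leading monomials of these n polynomials are
  multiplicatively independent, hence the polynomials are algebraically independent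
  (\<open>has_lead_bilin\<close>, \<open>algebraically_independent_leading\<close>).

  Let K be the field they generate and A the ring of invariant polynomials lying in K. If F[V] is
  spanned over Frac A by at most |G| elements, then Dedekind's independence of characters makes the
  matrix of conjugates of a spanning set invertible, and this forces every invariant polynomial into
  Frac A (\<open>invariant_in_fraction_field\<close>). Such a spanning set consists of monomials
  with bounded exponents. An orbit product is monic in its own variable with coefficients in earlier
  variables, so the exponents of x_i and z_t can be kept below the orbit sizes. For the y_i, the h_s
  are read as linear equations in powers of the y_i with coefficients x_i; a Gaussian elimination
  twisted by Frobenius makes them triangular (\<open>eliminate\<close>). The coefficients become
  values of the additive polynomials \<open>addpoly\<close>, and the pivot at y_j is exactly the
  orbit product of x_j (\<open>orbit_product_eq_addpoly\<close>). So the exponent of y_j can be kept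
  below Q_j (\<open>reduce_monomials\<close>, \<open>spanning_set\<close>).

  The number of surviving monomials is at most the product of the r^i (i < k), of r^(kl), and of the
  Q_j (j < k). The group is at least that large (\<open>card_isom\<close>): the three factors count
  the diagonal blocks, the translations of the middle variables, and the skew-Hermitian, symmetric
  or alternating matrices in the lower left corner.

  It remains to identify the matrix groups with \<open>isom\<close>. For exponent q >= 2 the
  polynomial determines the matrix of the form (\<open>form_group_sesquilinear\<close>). A quadratic
  form amounts to its polarisation and its values on basis vectors; the latter are automatic in odd
  characteristic and are what the conditions on s_ii, and on F in the plus case, express in
  characteristic 2 (\<open>isom_quadratic_iff\<close>).\<close>

lemma mconst_0 [simp]: "mconst 0 = 0"
  and mconst_1 [simp]: "mconst 1 = 1"
  by (simp_all add: mconst_def)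

lemma mconst_hom: "comm_semiring_hom mconst"
  by unfold_locales (simp_all add: mconst_def single_add mult_single)

lemma mconst_ring_hom: "comm_ring_hom (mconst :: 'a::comm_ring_1 \<Rightarrow> ('v, 'a) mvpoly)"
  by (intro comm_ring_hom.intro ring_hom.intro)
     (use mconst_hom in \<open>auto simp: comm_semiring_hom_def\<close>)

interpretation mconst: comm_semiring_hom "mconst :: 'a::comm_semiring_1 \<Rightarrow> ('v, 'a) mvpoly"
  by (rule mconst_hom)

interpretation mconst_ring: comm_ring_hom "mconst :: 'a::comm_ring_1 \<Rightarrow> ('v, 'a) mvpoly"
  by (rule mconst_ring_hom)

lemma mconst_eq_iff [simp]: "mconst a = mconst b \<longleftrightarrow> a = b"
  by (simp add: mconst_def) (metis lookup_single_eq)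

lemma mconst_eq_0_iff [simp]: "mconst a = 0 \<longleftrightarrow> a = 0"
  using mconst_eq_iff[of a 0] by (simp del: mconst_eq_iff)

lemma single_eq_mconst_mult: "Poly_Mapping.single m c = mconst c * Poly_Mapping.single m 1"
  by (simp add: mconst_def mult_single)

lemma mvar_power: "mvar i ^ e = Poly_Mapping.single (Poly_Mapping.single i e) 1"
  by (induction e) (simp_all add: mvar_def mult_single flip: single_add)

lemma prod_mvar_power:
  "finite I \<Longrightarrow> (\<Prod>i\<in>I. mvar i ^ e i)
     = Poly_Mapping.single (\<Sum>i\<in>I. Poly_Mapping.single i (e i)) 1"
  by (induction I rule: finite_induct) (simp_all add: mvar_power mult_single)

lemma poly_mapping_expand: "f = (\<Sum>m\<in>Poly_Mapping.keys f. Poly_Mapping.single m (Poly_Mapping.lookup f m))"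
proof (rule poly_mapping_eqI)
  fix k
  show "Poly_Mapping.lookup f k = Poly_Mapping.lookup
    (\<Sum>m\<in>Poly_Mapping.keys f. Poly_Mapping.single m (Poly_Mapping.lookup f m)) k"
    by (simp add: lookup_sum lookup_single when_def sum.delta' in_keys_iff)
qed

lemma monomial_expand:
  "Poly_Mapping.single m 1 = (\<Prod>i\<in>Poly_Mapping.keys m. mvar i ^ Poly_Mapping.lookup m i)"
  by (simp add: prod_mvar_power flip: poly_mapping_expand)

lemma mvpoly_expand:
  "f = (\<Sum>m\<in>Poly_Mapping.keys f. mconst (Poly_Mapping.lookup f m)
          * (\<Prod>i\<in>Poly_Mapping.keys m. mvar i ^ Poly_Mapping.lookup m i))"
  unfolding monomial_expand[symmetric] single_eq_mconst_mult[symmetric] by (rule poly_mapping_expand)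

section \<open>The universal property of polynomial rings\<close>

subsection \<open>Evaluation homomorphisms\<close>

lemma monomial_value_add:
  fixes \<sigma> :: "'v \<Rightarrow> 'b::comm_semiring_1" and m m' :: "'v \<Rightarrow>\<^sub>0 nat"
  shows "(\<Prod>i\<in>Poly_Mapping.keys (m + m'). \<sigma> i ^ Poly_Mapping.lookup (m + m') i)
    = (\<Prod>i\<in>Poly_Mapping.keys m. \<sigma> i ^ Poly_Mapping.lookup m i)
      * (\<Prod>i\<in>Poly_Mapping.keys m'. \<sigma> i ^ Poly_Mapping.lookup m' i)"
proof -
  let ?K = "Poly_Mapping.keys m \<union> Poly_Mapping.keys m'"
  have "(\<Prod>i\<in>Poly_Mapping.keys x. \<sigma> i ^ Poly_Mapping.lookup x i)
      = (\<Prod>i\<in>?K. \<sigma> i ^ Poly_Mapping.lookup x i)" if "Poly_Mapping.keys x \<subseteq> ?K" for x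
    using that by (intro prod.mono_neutral_left) (auto simp: in_keys_iff)
  from this[of m] this[of m'] this[of "m + m'"] show ?thesis
    using Poly_Mapping.keys_add[of m m'] by (simp add: lookup_add power_add prod.distrib)
qed

context
  fixes \<phi> :: "'a::comm_semiring_1 \<Rightarrow> 'b::comm_semiring_1"
  assumes \<phi>: "comm_semiring_hom \<phi>"
begin

interpretation \<phi>: comm_semiring_hom \<phi> by (rule \<phi>)

lemma meval_superset:
  assumes "finite S" "Poly_Mapping.keys f \<subseteq> S"
  shows "meval \<phi> \<sigma> f = (\<Sum>m\<in>S. \<phi> (Poly_Mapping.lookup f m)
           * (\<Prod>i\<in>Poly_Mapping.keys m. \<sigma> i ^ Poly_Mapping.lookup m i))"
  unfolding meval_def using assms by (intro sum.mono_neutral_left) (auto simp: in_keys_iff)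

lemma meval_add: "meval \<phi> \<sigma> (f + g) = meval \<phi> \<sigma> f + meval \<phi> \<sigma> g"
proof -
  let ?S = "Poly_Mapping.keys f \<union> Poly_Mapping.keys g"
  show ?thesis
    unfolding meval_superset[of ?S "f + g", OF _ Poly_Mapping.keys_add, simplified]
      meval_superset[of ?S f, simplified] meval_superset[of ?S g, simplified]
    by (simp add: lookup_add \<phi>.hom_add distrib_right sum.distrib)
qed

lemma meval_0: "meval \<phi> \<sigma> 0 = 0"
  by (simp add: meval_def)

lemma meval_sum: "meval \<phi> \<sigma> (\<Sum>i\<in>I. f i) = (\<Sum>i\<in>I. meval \<phi> \<sigma> (f i))"
  by (induction I rule: infinite_finite_induct) (simp_all add: meval_0 meval_add)

lemma meval_single: "meval \<phi> \<sigma> (Poly_Mapping.single m c)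
    = \<phi> c * (\<Prod>i\<in>Poly_Mapping.keys m. \<sigma> i ^ Poly_Mapping.lookup m i)"
  by (simp add: meval_def)

lemma meval_mult: "meval \<phi> \<sigma> (f * g) = meval \<phi> \<sigma> f * meval \<phi> \<sigma> g"
proof -
  have "meval \<phi> \<sigma> (f * g) = meval \<phi> \<sigma>
     ((\<Sum>m\<in>Poly_Mapping.keys f. Poly_Mapping.single m (Poly_Mapping.lookup f m))
       * (\<Sum>m\<in>Poly_Mapping.keys g. Poly_Mapping.single m (Poly_Mapping.lookup g m)))"
    by (simp flip: poly_mapping_expand)
  also have "\<dots> = meval \<phi> \<sigma> f * meval \<phi> \<sigma> g"
    by (simp add: sum_product mult_single meval_sum meval_single monomial_value_add \<phi>.hom_mult mult_ac)
       (simp add: meval_def sum_product mult_ac)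
  finally show ?thesis .
qed

lemma meval_hom: "comm_semiring_hom (meval \<phi> \<sigma>)"
proof unfold_locales
  show "meval \<phi> \<sigma> 1 = 1"
    using meval_single[of \<sigma> 0 1] by simp
qed (rule meval_0 meval_add meval_mult)+

lemma meval_mconst: "meval \<phi> \<sigma> (mconst c) = \<phi> c"
  by (simp add: mconst_def meval_single)

lemma meval_mvar: "meval \<phi> \<sigma> (mvar i) = \<sigma> i"
  by (simp add: mvar_def meval_single)

end

section \<open>Polynomials in a set of variables: closure, induction, and homomorphisms determined
  by the variables\<close>

subsection \<open>Subrings of polynomials in some of the variables\<close>

lemma polys_in_0 [simp]: "0 \<in> polys_in I"
  and polys_in_mconst [simp]: "mconst c \<in> polys_in I"
  and polys_in_1 [simp]: "1 \<in> polys_in I"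
  and polys_in_mvar [simp]: "i \<in> I \<Longrightarrow> mvar i \<in> polys_in I"
  by (auto simp: polys_in_def mconst_def mvar_def)

lemma polys_in_add [intro]: "f \<in> polys_in I \<Longrightarrow> g \<in> polys_in I \<Longrightarrow> f + g \<in> polys_in I"
  using Poly_Mapping.keys_add[of f g] unfolding polys_in_def by blast

lemma polys_in_uminus [intro]:
  fixes f :: "('v, 'a::comm_ring_1) mvpoly"
  shows "f \<in> polys_in I \<Longrightarrow> - f \<in> polys_in I"
  unfolding polys_in_def by (simp add: in_keys_iff)

lemma polys_in_diff [intro]:
  fixes f :: "('v, 'a::comm_ring_1) mvpoly"
  shows "f \<in> polys_in I \<Longrightarrow> g \<in> polys_in I \<Longrightarrow> f - g \<in> polys_in I"
  using polys_in_add[of f I "- g"] polys_in_uminus[of g I] by simp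

lemma polys_in_mult [intro]: "f \<in> polys_in I \<Longrightarrow> g \<in> polys_in I \<Longrightarrow> f * g \<in> polys_in I"
proof -
  assume fg: "f \<in> polys_in I" "g \<in> polys_in I"
  have "Poly_Mapping.keys m \<subseteq> I" if m: "m \<in> Poly_Mapping.keys (f * g)" for m
  proof -
    obtain a b where "m = a + b" "a \<in> Poly_Mapping.keys f" "b \<in> Poly_Mapping.keys g"
      using m Poly_Mapping.keys_mult[of f g] by blast
    with fg Poly_Mapping.keys_add[of a b] show ?thesis
      unfolding polys_in_def by blast
  qed
  then show ?thesis
    unfolding polys_in_def by blast
qed

lemma polys_in_power [intro]: "f \<in> polys_in I \<Longrightarrow> f ^ e \<in> polys_in I"
  by (induction e) auto

lemma polys_in_sum [intro]: "(\<And>a. a \<in> S \<Longrightarrow> f a \<in> polys_in I) \<Longrightarrow> (\<Sum>a\<in>S. f a) \<in> polys_in I"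
  by (induction S rule: infinite_finite_induct) auto

lemma polys_in_prod [intro]: "(\<And>a. a \<in> S \<Longrightarrow> f a \<in> polys_in I) \<Longrightarrow> (\<Prod>a\<in>S. f a) \<in> polys_in I"
  by (induction S rule: infinite_finite_induct) auto

lemma polys_in_mono: "I \<subseteq> J \<Longrightarrow> polys_in I \<subseteq> polys_in J"
  by (auto simp: polys_in_def)

lemma polys_in_induct [consumes 1, case_names mconst mvar add mult]:
  assumes "f \<in> polys_in I"
    and const: "\<And>c. P (mconst c)" and var: "\<And>i. i \<in> I \<Longrightarrow> P (mvar i)"
    and add: "\<And>f g. f \<in> polys_in I \<Longrightarrow> g \<in> polys_in I \<Longrightarrow> P f \<Longrightarrow> P g \<Longrightarrow> P (f + g)"
    and mult: "\<And>f g. f \<in> polys_in I \<Longrightarrow> g \<in> polys_in I \<Longrightarrow> P f \<Longrightarrow> P g \<Longrightarrow> P (f * g)"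
  shows "P f"
proof -
  let ?P = "\<lambda>f. f \<in> polys_in I \<and> P f"
  have pow: "?P (mvar i ^ e)" if "i \<in> I" for i e
    using that const[of 1] by (induction e) (auto intro: mult var)
  have mon: "?P (\<Prod>i\<in>K. mvar i ^ e i)" if "K \<subseteq> I" "finite K" for K e
    using that(2,1)
  proof (induction K rule: finite_induct)
    case (insert i K)
    then show ?case using pow[of i "e i"] by (auto intro!: mult)
  qed (use const[of 1] in auto)
  have "?P (\<Sum>m\<in>M. mconst (Poly_Mapping.lookup f m)
          * (\<Prod>i\<in>Poly_Mapping.keys m. mvar i ^ Poly_Mapping.lookup m i))"
    if "M \<subseteq> Poly_Mapping.keys f" "finite M" for M
    using that(2,1)
  proof (induction M rule: finite_induct)
    case (insert m M)
    have "?P (mconst (Poly_Mapping.lookup f m)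
          * (\<Prod>i\<in>Poly_Mapping.keys m. mvar i ^ Poly_Mapping.lookup m i))"
    proof -
      have "Poly_Mapping.keys m \<subseteq> I"
        using insert.prems assms(1) by (auto simp: polys_in_def)
      from mon[OF this, of "Poly_Mapping.lookup m"] show ?thesis
        by (auto intro!: mult const)
    qed
    with insert show ?case by (auto intro: add)
  qed (use const[of 0] in auto)
  from this[of "Poly_Mapping.keys f"] show ?thesis
    by (simp flip: mvpoly_expand)
qed

lemma mvpoly_induct [case_names mconst mvar add mult]:
  fixes f :: "('v, 'a::comm_semiring_1) mvpoly"
  assumes "\<And>c. P (mconst c)" "\<And>i. P (mvar i)"
    "\<And>f g. P f \<Longrightarrow> P g \<Longrightarrow> P (f + g)" "\<And>f g. P f \<Longrightarrow> P g \<Longrightarrow> P (f * g)"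
  shows "P f"
  using polys_in_induct[of f UNIV P] assms by (auto simp: polys_in_def)

lemma polys_in_hom_eqI:
  fixes \<Phi> \<Psi> :: "('v, 'a::comm_semiring_1) mvpoly \<Rightarrow> 'b::comm_semiring_1"
  assumes "comm_semiring_hom \<Phi>" "comm_semiring_hom \<Psi>"
    and "\<And>c. \<Phi> (mconst c) = \<Psi> (mconst c)" and "\<And>i. i \<in> I \<Longrightarrow> \<Phi> (mvar i) = \<Psi> (mvar i)"
    and "f \<in> polys_in I"
  shows "\<Phi> f = \<Psi> f"
proof -
  interpret \<Phi>: comm_semiring_hom \<Phi> by fact
  interpret \<Psi>: comm_semiring_hom \<Psi> by fact
  show ?thesis using assms(5)
    by (induction rule: polys_in_induct) (simp_all add: assms \<Phi>.hom_add \<Psi>.hom_add \<Phi>.hom_mult \<Psi>.hom_mult)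
qed

lemma hom_comp: "comm_semiring_hom \<Phi> \<Longrightarrow> comm_semiring_hom \<Psi> \<Longrightarrow> comm_semiring_hom (\<lambda>x. \<Phi> (\<Psi> x))"
proof -
  assume "comm_semiring_hom \<Phi>" "comm_semiring_hom \<Psi>"
  then interpret \<Phi>: comm_semiring_hom \<Phi> + \<Psi>: comm_semiring_hom \<Psi> .
  show ?thesis
    by unfold_locales (simp_all add: \<Phi>.hom_add \<Psi>.hom_add \<Phi>.hom_mult \<Psi>.hom_mult)
qed

lemma meval_in_polys_in:
  assumes "f \<in> polys_in I" "\<And>i. i \<in> I \<Longrightarrow> \<sigma> i \<in> polys_in J"
  shows "meval mconst \<sigma> f \<in> polys_in J"
  using assms(1)
  by (induction rule: polys_in_induct)
     (auto simp: meval_mconst meval_mvar meval_add meval_mult mconst_hom assms(2))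

lemma CHAR_mvpoly [simp]: "CHAR(('v, 'a::comm_ring_1) mvpoly) = CHAR('a)"
proof (rule CHAR_eqI)
  show "of_nat CHAR('a) = (0 :: ('v, 'a) mvpoly)"
    by (simp flip: mconst.hom_of_nat)
  fix x assume "of_nat x = (0 :: ('v, 'a) mvpoly)"
  then have "mconst (of_nat x :: 'a) = (0 :: ('v, 'a) mvpoly)"
    by (simp add: mconst.hom_of_nat)
  then show "CHAR('a) dvd x"
    by (simp add: of_nat_eq_0_iff_char_dvd)
qed

section \<open>A rank bound by the group order places invariants in a fraction field\<close>

section \<open>Descent along a finite group\<close>

text \<open>Dedekind's independence of characters.\<close>

lemma independence_of_characters:
  fixes \<chi> :: "'g \<Rightarrow> 'r::comm_semiring_1 \<Rightarrow> 's::idom"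
  assumes "finite I"
    and P: "1 \<in> P" "\<And>x y. x \<in> P \<Longrightarrow> y \<in> P \<Longrightarrow> x * y \<in> P"
    and one: "\<And>i. i \<in> I \<Longrightarrow> \<chi> i 1 = 1"
    and mult: "\<And>i x y. i \<in> I \<Longrightarrow> x \<in> P \<Longrightarrow> y \<in> P \<Longrightarrow> \<chi> i (x * y) = \<chi> i x * \<chi> i y"
    and distinct: "\<And>i j. i \<in> I \<Longrightarrow> j \<in> I \<Longrightarrow> i \<noteq> j \<Longrightarrow> \<exists>x\<in>P. \<chi> i x \<noteq> \<chi> j x"
    and zero: "\<And>x. x \<in> P \<Longrightarrow> (\<Sum>i\<in>I. a i * \<chi> i x) = 0"
  shows "\<forall>i\<in>I. a i = 0"
  using assms(1) one mult distinct zero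
proof (induction I arbitrary: a rule: finite_induct)
  case (insert j I)
  have "a i = 0" if i: "i \<in> I" for i
  proof -
    obtain z where z: "z \<in> P" "\<chi> i z \<noteq> \<chi> j z"
      using insert.prems(3)[of i j] insert.hyps i by auto
    \<comment> \<open>The relation at \<open>z * x\<close> minus \<open>\<chi> j z\<close> times the
      relation at \<open>x\<close> no longer involves the character \<open>j\<close>.\<close>
    have "(\<Sum>i\<in>I. (a i * (\<chi> i z - \<chi> j z)) * \<chi> i x) = 0" if x: "x \<in> P" for x
    proof -
      have "(\<Sum>i\<in>I. (a i * (\<chi> i z - \<chi> j z)) * \<chi> i x)
          = (\<Sum>i\<in>I. a i * \<chi> i (z * x)) - \<chi> j z * (\<Sum>i\<in>I. a i * \<chi> i x)"
        using insert.prems(2) x z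
        by (simp add: sum_distrib_left algebra_simps flip: sum_subtractf)
      also have "(\<Sum>i\<in>I. a i * \<chi> i (z * x)) = - (a j * \<chi> j (z * x))"
        using insert.prems(4)[OF P(2)[OF z(1) x]] insert.hyps by (simp add: eq_neg_iff_add_eq_0 add.commute)
      also have "(\<Sum>i\<in>I. a i * \<chi> i x) = - (a j * \<chi> j x)"
        using insert.prems(4)[OF x] insert.hyps by (simp add: eq_neg_iff_add_eq_0 add.commute)
      finally show ?thesis
        using insert.prems(2)[of j z x] x z by simp
    qed
    with insert.IH[of "\<lambda>i. a i * (\<chi> i z - \<chi> j z)"] insert.prems i z show ?thesis
      by auto
  qed
  moreover from this have "a j = 0"
    using insert.prems(4)[OF P(1)] insert.prems(1) insert.hyps by simp
  ultimately show ?case by auto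
qed simp

definition is_subring :: "'r::comm_ring_1 set \<Rightarrow> bool" where
  "is_subring A \<longleftrightarrow> 1 \<in> A \<and> (\<forall>x\<in>A. \<forall>y\<in>A. x - y \<in> A \<and> x * y \<in> A)"

context
  fixes A :: "'r::comm_ring_1 set"
  assumes A: "is_subring A"
begin

lemma subring_1: "1 \<in> A"
  and subring_diff: "x \<in> A \<Longrightarrow> y \<in> A \<Longrightarrow> x - y \<in> A"
  and subring_mult: "x \<in> A \<Longrightarrow> y \<in> A \<Longrightarrow> x * y \<in> A"
  using A by (auto simp: is_subring_def)

lemma subring_0: "0 \<in> A"
  using subring_diff[of 1 1] subring_1 by simp

lemma subring_uminus: "x \<in> A \<Longrightarrow> - x \<in> A"
  using subring_diff[of 0 x] subring_0 by simp

lemma subring_add: "x \<in> A \<Longrightarrow> y \<in> A \<Longrightarrow> x + y \<in> A"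
  using subring_diff[of x "- y"] subring_uminus by simp

lemma subring_power: "x \<in> A \<Longrightarrow> x ^ e \<in> A"
  by (induction e) (simp_all add: subring_1 subring_mult)

lemma subring_sum: "(\<And>i. i \<in> I \<Longrightarrow> f i \<in> A) \<Longrightarrow> (\<Sum>i\<in>I. f i) \<in> A"
  by (induction I rule: infinite_finite_induct) (simp_all add: subring_0 subring_add)

lemma subring_prod: "(\<And>i. i \<in> I \<Longrightarrow> f i \<in> A) \<Longrightarrow> (\<Prod>i\<in>I. f i) \<in> A"
  by (induction I rule: infinite_finite_induct) (simp_all add: subring_1 subring_mult)

end

lemma polys_in_subring: "is_subring (polys_in I :: ('v, 'a::comm_ring_1) mvpoly set)"
  by (auto simp: is_subring_def)

text \<open>The elements of the vector space spanned by \<open>W\<close> over the fraction field of \<open>A\<close>.\<close>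

definition frac_span :: "'r::idom set \<Rightarrow> 'r set \<Rightarrow> 'r set" where
  "frac_span A W = {f. \<exists>b\<in>A. b \<noteq> 0 \<and> (\<exists>c. (\<forall>w\<in>W. c w \<in> A) \<and> b * f = (\<Sum>w\<in>W. c w * w))}"

text \<open>Artin's argument without field extensions: a spanning set with at most |G| elements has
  an invertible matrix of conjugates. Both \<open>f\<close> and 1 are fixed by G, so applying all g
  to their expansions gives two linear systems with this matrix and constant right-hand sides; hence
  their coordinate vectors are proportional, and the ratio \<open>f\<close> lies in the fraction
  field of \<open>A\<close>.\<close>

lemma invariant_in_fraction_field:
  fixes P A :: "'r::idom set" and \<chi> :: "'g \<Rightarrow> 'r \<Rightarrow> 'r"
  assumes G: "finite G" and P: "is_subring P" and A: "is_subring A" "A \<subseteq> P"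
    and one: "\<And>g. g \<in> G \<Longrightarrow> \<chi> g 1 = 1"
    and add: "\<And>g x y. g \<in> G \<Longrightarrow> x \<in> P \<Longrightarrow> y \<in> P \<Longrightarrow> \<chi> g (x + y) = \<chi> g x + \<chi> g y"
    and mult: "\<And>g x y. g \<in> G \<Longrightarrow> x \<in> P \<Longrightarrow> y \<in> P \<Longrightarrow> \<chi> g (x * y) = \<chi> g x * \<chi> g y"
    and distinct: "\<And>g g'. g \<in> G \<Longrightarrow> g' \<in> G \<Longrightarrow> g \<noteq> g' \<Longrightarrow> \<exists>x\<in>P. \<chi> g x \<noteq> \<chi> g' x"
    and fixed: "\<And>g a. g \<in> G \<Longrightarrow> a \<in> A \<Longrightarrow> \<chi> g a = a"
    and W: "finite W" "W \<subseteq> P" "card W \<le> card G" and span: "P \<subseteq> frac_span A W"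
    and f: "f \<in> P" "\<And>g. g \<in> G \<Longrightarrow> \<chi> g f = f"
  shows "\<exists>a\<in>A. \<exists>b\<in>A. b \<noteq> 0 \<and> b * f = a"
proof -
  define N M where "N = card G" and "M = card W"
  obtain eg where eg: "bij_betw eg {..<N} G"
    using ex_bij_betw_nat_finite[OF G] by (auto simp: N_def atLeast0LessThan)
  obtain ew where ew: "bij_betw ew {..<M} W"
    using ex_bij_betw_nat_finite[OF W(1)] by (auto simp: M_def atLeast0LessThan)
  have MN: "M \<le> N"
    using W by (simp add: M_def N_def)
  have eg_in: "eg i \<in> G" if "i < N" for i
    using eg that by (auto simp: bij_betw_def)
  have ew_in: "ew i \<in> W" if "i < M" for i
    using ew that by (auto simp: bij_betw_def)
  have zero: "\<chi> g 0 = 0" if "g \<in> G" for g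
  proof -
    have "\<chi> g 0 + \<chi> g 0 = \<chi> g 0 + 0"
      using add[OF that subring_0[OF P] subring_0[OF P]] by simp
    then show ?thesis
      by (rule add_left_imp_eq)
  qed
  have sum: "\<chi> g (\<Sum>i\<in>I. c i * w i) = (\<Sum>i\<in>I. c i * \<chi> g (w i))"
    if g: "g \<in> G" and "\<And>i. i \<in> I \<Longrightarrow> c i \<in> A" "\<And>i. i \<in> I \<Longrightarrow> w i \<in> P"
    for g and I :: "nat set" and c w
    using that(2,3)
  proof (induction I rule: infinite_finite_induct)
    case (insert i I)
    have *: "c i \<in> P" "c i \<in> A" "w i \<in> P"
      using insert.prems A by auto
    have "\<chi> g (c i * w i + (\<Sum>i\<in>I. c i * w i)) = \<chi> g (c i * w i) + \<chi> g (\<Sum>i\<in>I. c i * w i)"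
    proof (rule add[OF g])
      show "c i * w i \<in> P"
        using * by (simp add: subring_mult[OF P])
      show "(\<Sum>i\<in>I. c i * w i) \<in> P"
      proof (rule subring_sum[OF P])
        fix j assume "j \<in> I"
        with insert.prems[of j] A(2) show "c j * w j \<in> P"
          by (intro subring_mult[OF P]) auto
      qed
    qed
    with insert * show ?case
      by (simp add: mult[OF g] fixed[OF g])
  qed (simp_all add: zero[OF g])
  have expand: "\<exists>b\<in>A. b \<noteq> 0 \<and> (\<exists>c. (\<forall>j<M. c j \<in> A) \<and> b * x = (\<Sum>j<M. c j * ew j))"
    if x: "x \<in> P" for x
  proof -
    obtain b c where b: "b \<in> A" "b \<noteq> 0" "\<And>w. w \<in> W \<Longrightarrow> c w \<in> A" "b * x = (\<Sum>w\<in>W. c w * w)"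
      using span x unfolding frac_span_def by blast
    have "(\<Sum>w\<in>W. c w * w) = (\<Sum>j<M. c (ew j) * ew j)"
      using sum.reindex_bij_betw[OF ew, of "\<lambda>w. c w * w"] by simp
    with b ew_in show ?thesis
      by (intro bexI[of _ b] conjI exI[of _ "\<lambda>j. c (ew j)"]) auto
  qed
  have apply_expand: "b * \<chi> g x = (\<Sum>j<M. c j * \<chi> g (ew j))"
    if "b \<in> A" "\<And>j. j < M \<Longrightarrow> c j \<in> A" "b * x = (\<Sum>j<M. c j * ew j)" "x \<in> P" "g \<in> G" for b c x g
  proof -
    have "b * \<chi> g x = \<chi> g (b * x)"
      using that mult[of g b x] fixed[of g b] A(2) by auto
    also have "\<dots> = (\<Sum>j<M. c j * \<chi> g (ew j))"
      unfolding that(3) using that W(2) ew_in by (intro sum) auto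
    finally show ?thesis .
  qed
  \<comment> \<open>Zero columns pad the matrix of conjugates to a square one, since only
    \<open>M \<le> N\<close> is known; nonvanishing of the determinant shows afterwards that there
    were none.\<close>
  define T where "T = mat N N (\<lambda>(i, j). if j < M then \<chi> (eg i) (ew j) else 0)"
  have T: "T \<in> carrier_mat N N"
    by (simp add: T_def)
  have det: "det T \<noteq> 0"
  proof
    assume "det T = 0"
    then have "det (transpose_mat T) = 0"
      using det_transpose[OF T] by simp
    then obtain v where v: "v \<in> carrier_vec N" "v \<noteq> 0\<^sub>v N" "transpose_mat T *\<^sub>v v = 0\<^sub>v N"
      using det_0_iff_vec_prod_zero[of "transpose_mat T" N] T by auto
    have v0: "(\<Sum>i<N. vec_index v i * \<chi> (eg i) (ew j)) = 0" if "j < M" for j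
    proof -
      have "vec_index (transpose_mat T *\<^sub>v v) j = 0"
        using v MN that by simp
      then show ?thesis
        using v(1) MN that
        by (simp add: T_def scalar_prod_def atLeast0LessThan mult.commute cong: if_cong)
    qed
    \<comment> \<open>A left null vector of \<open>T\<close> is a linear relation between the
      characters on \<open>W\<close>. Since \<open>A\<close> is fixed and \<open>W\<close> spans up
      to denominators, the relation holds on all of \<open>P\<close>, against Dedekind.\<close>
    have "\<forall>i\<in>{..<N}. vec_index v i = 0"
    proof (rule independence_of_characters[where \<chi> = "\<lambda>i. \<chi> (eg i)" and P = P])
      fix x assume x: "x \<in> P"
      obtain b c where b: "b \<in> A" "b \<noteq> 0" "\<forall>j<M. c j \<in> A" "b * x = (\<Sum>j<M. c j * ew j)"
        using expand[OF x] by blast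
      have "b * (\<Sum>i<N. vec_index v i * \<chi> (eg i) x) = (\<Sum>i<N. vec_index v i * (\<Sum>j<M. c j * \<chi> (eg i) (ew j)))"
        unfolding sum_distrib_left
      proof (rule sum.cong)
        fix i assume "i \<in> {..<N}"
        then have "b * \<chi> (eg i) x = (\<Sum>j<M. c j * \<chi> (eg i) (ew j))"
          using b x eg_in by (intro apply_expand) auto
        then have "vec_index v i * (b * \<chi> (eg i) x) = (\<Sum>j<M. vec_index v i * (c j * \<chi> (eg i) (ew j)))"
          by (simp add: sum_distrib_left)
        then show "b * (vec_index v i * \<chi> (eg i) x) = (\<Sum>j<M. vec_index v i * (c j * \<chi> (eg i) (ew j)))"
          by (simp add: mult.left_commute)
      qed simp
      also have "\<dots> = (\<Sum>j<M. c j * (\<Sum>i<N. vec_index v i * \<chi> (eg i) (ew j)))"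
        unfolding sum_distrib_left by (subst sum.swap) (simp add: mult_ac)
      also have "\<dots> = 0"
        by (simp add: v0)
      finally show "(\<Sum>i<N. vec_index v i * \<chi> (eg i) x) = 0"
        using b by simp
    next
      fix i j assume "i \<in> {..<N}" "j \<in> {..<N}" "i \<noteq> j"
      then show "\<exists>x\<in>P. \<chi> (eg i) x \<noteq> \<chi> (eg j) x"
        using eg eg_in by (intro distinct) (auto simp: bij_betw_def inj_on_def)
    qed (use one mult eg_in subring_1[OF P] subring_mult[OF P] in auto)
    then have "v = 0\<^sub>v N"
      using v(1) by (intro eq_vecI) auto
    with v show False by simp
  qed
  obtain b c where b: "b \<in> A" "b \<noteq> 0" "\<forall>j<M. c j \<in> A" "b * f = (\<Sum>j<M. c j * ew j)"
    using expand[OF f(1)] by blast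
  obtain b1 e where b1: "b1 \<in> A" "b1 \<noteq> 0" "\<forall>j<M. e j \<in> A" "b1 * 1 = (\<Sum>j<M. e j * ew j)"
    using expand[OF subring_1[OF P]] by blast
  \<comment> \<open>Every row of \<open>T\<close> sends the vector \<open>c\<close> to
    \<open>b * f\<close> and \<open>e\<close> to \<open>b1\<close>, so this combination is in the
    kernel. Any index with \<open>e j \<noteq> 0\<close> then exhibits \<open>f\<close> as a
    quotient.\<close>
  define u where "u = vec N (\<lambda>j. if j < M then b1 * c j - b * f * e j else 0)"
  have "T *\<^sub>v u = 0\<^sub>v N"
  proof (rule eq_vecI)
    fix i assume "i < dim_vec (0\<^sub>v N)"
    then have i: "i < N" by simp
    have "vec_index (T *\<^sub>v u) i = (\<Sum>j<N. if j < M then \<chi> (eg i) (ew j) * (b1 * c j - b * f * e j) else 0)"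
      using i by (simp add: T_def u_def scalar_prod_def atLeast0LessThan if_distrib cong: if_cong)
    also have "\<dots> = (\<Sum>j<M. \<chi> (eg i) (ew j) * (b1 * c j - b * f * e j))"
      using MN by (intro sum.mono_neutral_cong_right) auto
    also have "\<dots> = b1 * (\<Sum>j<M. c j * \<chi> (eg i) (ew j)) - b * f * (\<Sum>j<M. e j * \<chi> (eg i) (ew j))"
      by (simp add: sum_distrib_left algebra_simps flip: sum_subtractf)
    also have "(\<Sum>j<M. c j * \<chi> (eg i) (ew j)) = b * f"
      using apply_expand[of b c f "eg i"] b f eg_in[OF i] by simp
    also have "(\<Sum>j<M. e j * \<chi> (eg i) (ew j)) = b1"
      using apply_expand[of b1 e 1 "eg i"] b1 one eg_in[OF i] subring_1[OF P] by simp
    finally show "vec_index (T *\<^sub>v u) i = vec_index (0\<^sub>v N) i"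
      using i by simp
  qed (simp add: T_def)
  then have "u = 0\<^sub>v N"
    using det_0_iff_vec_prod_zero[OF T] det by (metis u_def vec_carrier)
  have u: "b1 * c j = b * f * e j" if "j < M" for j
  proof -
    have "vec_index u j = 0"
      using \<open>u = 0\<^sub>v N\<close> that MN by simp
    then show ?thesis
      using that MN by (simp add: u_def)
  qed
  have "\<exists>j<M. e j \<noteq> 0"
  proof (rule ccontr)
    assume "\<not> ?thesis"
    then have "(\<Sum>j<M. e j * ew j) = 0"
      by (intro sum.neutral) auto
    with b1 show False by simp
  qed
  then obtain j where j: "j < M" "e j \<noteq> 0" by blast
  have "(b * e j) * f = b1 * c j"
    using u[OF j(1)] by (simp add: mult_ac)
  moreover have "b * e j \<in> A" "b1 * c j \<in> A" "b * e j \<noteq> 0"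
    using b b1 j by (simp_all add: subring_mult[OF A(1)])
  ultimately show ?thesis by blast
qed

section \<open>Spans over a fraction field, and rewriting monomials to bounded exponents\<close>

section \<open>Reduction of monomials\<close>

context
  fixes A :: "'r::idom set" and W :: "'r set"
  assumes A: "is_subring A" and W: "finite W"
begin

lemma frac_spanI:
  assumes "b \<in> A" "b \<noteq> 0" "\<And>w. w \<in> W \<Longrightarrow> c w \<in> A" "b * f = (\<Sum>w\<in>W. c w * w)"
  shows "f \<in> frac_span A W"
  using assms unfolding frac_span_def by blast

lemma frac_span_0: "0 \<in> frac_span A W"
  by (rule frac_spanI[of 1 "\<lambda>_. 0"]) (simp_all add: subring_1[OF A] subring_0[OF A])

lemma frac_span_base: "w \<in> W \<Longrightarrow> w \<in> frac_span A W"
  by (rule frac_spanI[of 1 "\<lambda>v. if v = w then 1 else 0"])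
     (simp_all add: subring_1[OF A] subring_0[OF A] W if_distrib[of "\<lambda>x. x * _"] cong: if_cong)

lemma frac_span_scale:
  assumes "a \<in> A" "f \<in> frac_span A W"
  shows "a * f \<in> frac_span A W"
proof -
  obtain b c where b: "b \<in> A" "b \<noteq> 0" "\<forall>w\<in>W. c w \<in> A" "b * f = (\<Sum>w\<in>W. c w * w)"
    using assms(2) unfolding frac_span_def by blast
  have "b * (a * f) = (\<Sum>w\<in>W. (a * c w) * w)"
    using b(4) by (simp add: sum_distrib_left mult.assoc mult.left_commute[of b])
  with b assms(1) show ?thesis
    unfolding frac_span_def
    by (intro CollectI bexI[of _ b] conjI exI[of _ "\<lambda>w. a * c w"]) (auto simp: subring_mult[OF A])
qed

lemma frac_span_add:
  assumes "f \<in> frac_span A W" "g \<in> frac_span A W"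
  shows "f + g \<in> frac_span A W"
proof -
  obtain b c where b: "b \<in> A" "b \<noteq> 0" "\<forall>w\<in>W. c w \<in> A" "b * f = (\<Sum>w\<in>W. c w * w)"
    using assms(1) unfolding frac_span_def by blast
  obtain b' c' where b': "b' \<in> A" "b' \<noteq> 0" "\<forall>w\<in>W. c' w \<in> A" "b' * g = (\<Sum>w\<in>W. c' w * w)"
    using assms(2) unfolding frac_span_def by blast
  have "b * b' * (f + g) = b' * (b * f) + b * (b' * g)"
    by (simp add: algebra_simps)
  also have "\<dots> = (\<Sum>w\<in>W. (b' * c w + b * c' w) * w)"
    unfolding b(4) b'(4) by (simp add: sum_distrib_left sum.distrib distrib_right mult.assoc)
  finally have "b * b' * (f + g) = (\<Sum>w\<in>W. (b' * c w + b * c' w) * w)" .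
  then show ?thesis
    by (rule frac_spanI[rotated 3]) (use b b' in \<open>auto intro: subring_mult[OF A] subring_add[OF A]\<close>)
qed

lemma frac_span_uminus: "f \<in> frac_span A W \<Longrightarrow> - f \<in> frac_span A W"
  using frac_span_scale[of "- 1" f] subring_uminus[OF A subring_1[OF A]] by simp

lemma frac_span_diff: "f \<in> frac_span A W \<Longrightarrow> g \<in> frac_span A W \<Longrightarrow> f - g \<in> frac_span A W"
  using frac_span_add[of f "- g"] frac_span_uminus by simp

lemma frac_span_sum: "(\<And>i. i \<in> I \<Longrightarrow> f i \<in> frac_span A W) \<Longrightarrow> (\<Sum>i\<in>I. f i) \<in> frac_span A W"
  by (induction I rule: infinite_finite_induct) (simp_all add: frac_span_0 frac_span_add)

lemma frac_span_cancel:
  assumes "a \<in> A" "a \<noteq> 0" "a * f \<in> frac_span A W"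
  shows "f \<in> frac_span A W"
proof -
  obtain b c where b: "b \<in> A" "b \<noteq> 0" "\<forall>w\<in>W. c w \<in> A" "b * (a * f) = (\<Sum>w\<in>W. c w * w)"
    using assms(3) unfolding frac_span_def by blast
  show ?thesis
    by (rule frac_spanI[of "b * a" c]) (use b assms in \<open>auto simp: mult.assoc intro: subring_mult[OF A]\<close>)
qed

text \<open>Transitivity of spanning. The factor \<open>v\<close> is carried along so that a
  coefficient can be expanded in \<open>U\<close> while its monomial stays untouched.\<close>

lemma frac_span_trans:
  assumes "f \<in> frac_span A U" "\<And>u. u \<in> U \<Longrightarrow> u * v \<in> frac_span A W"
  shows "f * v \<in> frac_span A W"
proof -
  obtain b c where b: "b \<in> A" "b \<noteq> 0" "\<forall>u\<in>U. c u \<in> A" "b * f = (\<Sum>u\<in>U. c u * u)"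
    using assms(1) unfolding frac_span_def by blast
  have "b * (f * v) = (\<Sum>u\<in>U. c u * (u * v))"
    using b(4) by (simp add: sum_distrib_right flip: mult.assoc)
  also have "\<dots> \<in> frac_span A W"
    by (intro frac_span_sum frac_span_scale assms(2)) (use b in auto)
  finally show ?thesis
    by (rule frac_span_cancel[OF b(1,2)])
qed

end

abbreviation monomial :: "nat \<Rightarrow> (nat \<Rightarrow> 'r) \<Rightarrow> (nat \<Rightarrow> nat) \<Rightarrow> 'r::comm_monoid_mult" where
  "monomial k y m \<equiv> \<Prod>i<k. y i ^ m i"

lemma monomial_add: "monomial k y (\<lambda>i. m i + m' i) = monomial k y m * monomial k y m'"
  by (simp add: power_add prod.distrib)

lemma monomial_upd_add:
  assumes "j < k"
  shows "monomial k y (m(j := m j + e)) = monomial k y m * y j ^ e"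
proof -
  have "monomial k y (m(j := m j + e)) = (\<Prod>i<k. y i ^ m i * (if i = j then y j ^ e else 1))"
    by (intro prod.cong) (auto simp: power_add)
  then show ?thesis
    using assms by (simp add: prod.distrib)
qed

lemma sum_upd_add:
  fixes m w :: "nat \<Rightarrow> nat"
  assumes "j < k"
  shows "(\<Sum>i<k. w i * (m(j := m j + e)) i) = (\<Sum>i<k. w i * m i) + w j * e"
proof -
  have "(\<Sum>i<k. w i * (m(j := m j + e)) i) = (\<Sum>i<k. w i * m i + (if i = j then w j * e else 0))"
    by (intro sum.cong) (auto simp: algebra_simps)
  then show ?thesis
    using assms by (simp add: sum.distrib)
qed

text \<open>The \<open>S\<close>-linear combinations of monomials in the \<open>y i\<close> of degree less than \<open>D\<close>.\<close>

inductive_set low_degree :: "'r::comm_ring_1 set \<Rightarrow> nat \<Rightarrow> (nat \<Rightarrow> 'r) \<Rightarrow> nat \<Rightarrow> 'r set"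
  for S k y D where
  zero: "0 \<in> low_degree S k y D"
| add: "f \<in> low_degree S k y D \<Longrightarrow> g \<in> low_degree S k y D \<Longrightarrow> f + g \<in> low_degree S k y D"
| monom: "x \<in> S \<Longrightarrow> (\<Sum>i<k. m i) < D \<Longrightarrow> x * monomial k y m \<in> low_degree S k y D"

text \<open>A relation expresses \<open>u * y j ^ Q j\<close> by the same powers of later variables and monomials of
  lower degree, so rewriting with it terminates.\<close>

lemma reduce_monomials:
  fixes A S U :: "'r::idom set" and y :: "nat \<Rightarrow> 'r" and Q :: "nat \<Rightarrow> nat"
  assumes A: "is_subring A" and S: "is_subring S" and U: "finite U" and SU: "S \<subseteq> frac_span A U"
    and Q: "\<And>j. j < k \<Longrightarrow> Q j > 0"
    and rel: "\<And>j. j < k \<Longrightarrow> \<exists>u\<in>A. u \<noteq> 0 \<and> (\<exists>a\<in>A. \<exists>c. \<exists>\<rho>\<in>low_degree S k y (Q j).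
      (\<forall>i<k. c i \<in> S) \<and> u * y j ^ Q j = a + (\<Sum>i\<in>{j<..<k}. c i * y i ^ Q j) + \<rho>)"
    and W: "W = (\<lambda>(u, m). u * monomial k y m) ` (U \<times> (\<Pi>\<^sub>E j\<in>{..<k}. {..<Q j}))"
  shows "x \<in> S \<Longrightarrow> x * monomial k y m \<in> frac_span A W"
proof (induction m arbitrary: x rule: wf_induct_rule[OF wf_measures[of "[\<lambda>m. \<Sum>i<k. m i, \<lambda>m. \<Sum>i<k. (k - i) * m i]"]])
  case (1 m)
  have fin: "finite W"
    unfolding W by (intro finite_imageI finite_cartesian_product U finite_PiE) auto
  show ?case
  proof (cases "\<forall>j<k. m j < Q j")
    case True
    have "u * monomial k y m \<in> W" if "u \<in> U" for u
      unfolding W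
    proof (rule image_eqI)
      \<comment> \<open>The exponents in \<open>W\<close> are extensional functions; values beyond
        \<open>k\<close> do not affect the monomial.\<close>
      show "u * monomial k y m = (\<lambda>(u, m). u * monomial k y m) (u, restrict m {..<k})"
        by simp
    qed (use that True in auto)
    then show ?thesis
      using SU 1(2) by (intro frac_span_trans[OF A fin, of x U]) (auto intro: frac_span_base[OF A fin])
  next
    case False
    then obtain j where j: "j < k" "Q j \<le> m j"
      by force
    obtain u a c \<rho> where rel: "u \<in> A" "u \<noteq> 0" "a \<in> A" "\<rho> \<in> low_degree S k y (Q j)" "\<forall>i<k. c i \<in> S"
      "u * y j ^ Q j = a + (\<Sum>i\<in>{j<..<k}. c i * y i ^ Q j) + \<rho>"
      using rel[OF j(1)] by blast
    define m' where "m' = m(j := m j - Q j)"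
    have m: "m = m'(j := m' j + Q j)"
      using j by (simp add: m'_def)
    have deg: "(\<Sum>i<k. m i) = (\<Sum>i<k. m' i) + Q j"
      and wt: "(\<Sum>i<k. (k - i) * m i) = (\<Sum>i<k. (k - i) * m' i) + (k - j) * Q j"
      using sum_upd_add[OF j(1), of "\<lambda>_. 1" m' "Q j"] sum_upd_add[OF j(1), of "\<lambda>i. k - i" m' "Q j"]
      by (simp_all flip: m)
    have t1: "a * (x * monomial k y m') \<in> frac_span A W"
      by (intro frac_span_scale[OF A fin rel(3)] 1(1)) (use 1(2) deg Q[OF j(1)] in simp_all)
    have "(x * c i) * monomial k y (m'(i := m' i + Q j)) \<in> frac_span A W" if "i \<in> {j<..<k}" for i
    proof (rule 1(1))
      have "(\<Sum>i'<k. (m'(i := m' i + Q j)) i') = (\<Sum>i<k. m' i) + Q j"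
        "(\<Sum>i'<k. (k - i') * (m'(i := m' i + Q j)) i') = (\<Sum>i<k. (k - i) * m' i) + (k - i) * Q j"
        using sum_upd_add[of i k "\<lambda>_. 1" m' "Q j"] sum_upd_add[of i k "\<lambda>i. k - i" m' "Q j"] that
        by simp_all
      \<comment> \<open>Moving \<open>Q j\<close> exponents from variable \<open>j\<close> to a
        later one keeps the total degree, so the second measure, in which earlier variables weigh
        more, has to drop.\<close>
      moreover have "(k - i) * Q j < (k - j) * Q j"
        using that Q[OF j(1)] by auto
      ultimately show "(m'(i := m' i + Q j), m) \<in> measures [\<lambda>m. \<Sum>i<k. m i, \<lambda>m. \<Sum>i<k. (k - i) * m i]"
        using deg wt by simp
      show "x * c i \<in> S"
        using that rel(5) 1(2) by (auto intro: subring_mult[OF S])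
    qed
    then have t2: "(\<Sum>i\<in>{j<..<k}. (x * c i) * monomial k y (m'(i := m' i + Q j))) \<in> frac_span A W"
      by (intro frac_span_sum[OF A fin])
    have t3: "x * monomial k y m' * \<rho> \<in> frac_span A W"
      using rel(4)
    proof induction
      case (monom x' m'')
      have "(x * x') * monomial k y (\<lambda>i. m' i + m'' i) \<in> frac_span A W"
      proof (rule 1(1))
        show "(\<lambda>i. m' i + m'' i, m) \<in> measures [\<lambda>m. \<Sum>i<k. m i, \<lambda>m. \<Sum>i<k. (k - i) * m i]"
          using monom(2) deg by (simp add: sum.distrib)
      qed (use monom(1) 1(2) in \<open>auto intro: subring_mult[OF S]\<close>)
      then show ?case
        by (simp add: monomial_add mult_ac)
    qed (simp_all add: distrib_left frac_span_0[OF A fin] frac_span_add[OF A fin])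
    have eq1: "u * (x * monomial k y m) = x * monomial k y m' * (u * y j ^ Q j)"
      by (subst m, subst monomial_upd_add[OF j(1)]) (simp only: mult_ac)
    have eq2: "x * monomial k y m' * (u * y j ^ Q j) = a * (x * monomial k y m')
      + (\<Sum>i\<in>{j<..<k}. (x * c i) * monomial k y (m'(i := m' i + Q j))) + x * monomial k y m' * \<rho>"
    proof -
      have "(\<Sum>i\<in>{j<..<k}. (x * c i) * monomial k y (m'(i := m' i + Q j)))
          = x * monomial k y m' * (\<Sum>i\<in>{j<..<k}. c i * y i ^ Q j)"
        unfolding sum_distrib_left
        by (intro sum.cong refl) (simp only: monomial_upd_add greaterThanLessThan_iff mult_ac)
      then show ?thesis
        unfolding rel(6) by (simp only: distrib_left mult_ac)
    qed
    have "u * (x * monomial k y m) \<in> frac_span A W"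
      unfolding eq1 eq2 by (intro frac_span_add[OF A fin] t1 t2 t3)
    then show ?thesis
      by (rule frac_span_cancel[OF A fin rel(1,2)])
  qed
qed

lemma low_degree_mult:
  assumes S: "is_subring S" and "x \<in> S" "f \<in> low_degree S k y D"
  shows "x * f \<in> low_degree S k y D"
  using assms(3)
proof induction
  case (monom x' m)
  then show ?case
    using low_degree.monom[of "x * x'" S m k D y] subring_mult[OF S assms(2)] by (simp add: mult.assoc)
qed (auto simp: distrib_left intro: low_degree.intros)

lemma low_degree_uminus:
  assumes S: "is_subring S" and "f \<in> low_degree S k y D"
  shows "- f \<in> low_degree S k y D"
  using low_degree_mult[OF S _ assms(2), of "- 1"] subring_uminus[OF S subring_1[OF S]] by simp

lemma low_degree_diff:
  assumes "is_subring S" "f \<in> low_degree S k y D" "g \<in> low_degree S k y D"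
  shows "f - g \<in> low_degree S k y D"
  using low_degree.add[OF assms(2) low_degree_uminus[OF assms(1,3)]] by simp

lemma low_degree_sum:
  "(\<And>i. i \<in> I \<Longrightarrow> f i \<in> low_degree S k y D) \<Longrightarrow> (\<Sum>i\<in>I. f i) \<in> low_degree S k y D"
  by (induction I rule: infinite_finite_induct) (auto intro: low_degree.intros)

text \<open>The \<open>r\<close>-th power is additive, so it acts term by term and multiplies every
  degree by \<open>r\<close>; no mixed products arise, and the strict bound scales exactly.\<close>

lemma low_degree_power:
  fixes S :: "'r::comm_ring_1 set"
  assumes S: "is_subring S" and "r > 0"
    and frob: "\<And>f g :: 'r. (f + g) ^ r = f ^ r + g ^ r" and "f \<in> low_degree S k y D"
  shows "f ^ r \<in> low_degree S k y (D * r)"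
  using assms(4)
proof induction
  case (monom x m)
  have "(x * monomial k y m) ^ r = x ^ r * monomial k y (\<lambda>i. m i * r)"
    by (simp add: power_mult_distrib power_mult prod_power_distrib)
  moreover have "(\<Sum>i<k. m i * r) < D * r"
    using monom(2) assms(2) by (simp flip: sum_distrib_right)
  ultimately show ?case
    using monom(1) by (auto intro!: low_degree.monom subring_power[OF S])
qed (use assms(2) in \<open>auto simp: frob power_0_left intro: low_degree.intros\<close>)

section \<open>Products over F-subspaces as q-polynomials in the sense of Ore and Dickson\<close>

section \<open>Additive polynomials\<close>

lemma frob_sum:
  fixes f :: "'i \<Rightarrow> 'r::comm_semiring_1"
  assumes "r > 0" "\<And>f g :: 'r. (f + g) ^ r = f ^ r + g ^ r"
  shows "(\<Sum>i\<in>I. f i) ^ r = (\<Sum>i\<in>I. f i ^ r)"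
  using assms(1) by (induction I rule: infinite_finite_induct) (simp_all add: assms(2) power_0_left)

lemma frob_diff:
  fixes x y :: "'r::comm_ring_1"
  assumes "\<And>f g :: 'r. (f + g) ^ r = f ^ r + g ^ r"
  shows "(x - y) ^ r = x ^ r - y ^ r"
  using assms[of "x - y" y] by simp

text \<open>With \<open>r\<close> the order of the field of coefficients, this is the product of \<open>T + v\<close> over the
  span of \<open>x 0, \<dots>, x (j - 1)\<close>; see \<open>prod_span_eq_addpoly\<close>.\<close>

primrec addpoly :: "nat \<Rightarrow> (nat \<Rightarrow> 'r::comm_ring_1) \<Rightarrow> nat \<Rightarrow> 'r \<Rightarrow> 'r" where
  "addpoly r x 0 = (\<lambda>T. T)"
| "addpoly r x (Suc j) = (\<lambda>T. addpoly r x j T ^ r - addpoly r x j (x j) ^ (r - 1) * addpoly r x j T)"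

lemma addpoly_add:
  assumes "\<And>f g :: 'r::comm_ring_1. (f + g) ^ r = f ^ r + g ^ r"
  shows "addpoly r x j (S + T :: 'r) = addpoly r x j S + addpoly r x j T"
  by (induction j arbitrary: S T) (simp_all add: assms algebra_simps)

lemma addpoly_scale: "c ^ r = c \<Longrightarrow> addpoly r x j (c * T) = c * addpoly r x j T"
  by (induction j arbitrary: T) (simp_all add: power_mult_distrib algebra_simps)

text \<open>At the new index the recursion reads t^r - t^(r-1) t, and zeros persist from one stage
  to the next. This vanishing is what makes the elimination triangular.\<close>

lemma addpoly_eq_0:
  assumes "r > 0" "i < j"
  shows "addpoly r x j (x i) = 0"
  using assms(2)
proof (induction j)
  case (Suc j)
  show ?case
  proof (cases "i = j")
    case True
    then show ?thesis
      using assms(1) power_minus_mult[of r "addpoly r x j (x j)"] by simp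
  next
    case False
    with Suc show ?thesis
      using assms(1) by (simp add: power_0_left)
  qed
qed simp

lemma addpoly_in_subring:
  assumes "is_subring S" "\<And>i. i < j \<Longrightarrow> x i \<in> S"
  shows "T \<in> S \<Longrightarrow> addpoly r x j T \<in> S"
  using assms(2)
  by (induction j arbitrary: T)
     (auto intro!: subring_diff[OF assms(1)] subring_mult[OF assms(1)] subring_power[OF assms(1)])

text \<open>As polynomials in S both sides have degree r and leading coefficient 1, and both vanish
  at the r distinct points -a u, because a^r = a for every scalar a.\<close>

lemma prod_scalar_shifts:
  fixes S u :: "('v::linorder, 'a::finite_field) mvpoly"
  assumes "u \<noteq> 0"
  shows "(\<Prod>a\<in>UNIV. S + mconst a * u) = S ^ CARD('a) - u ^ (CARD('a) - 1) * S"
proof -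
  let ?r = "CARD('a)"
  let ?p = "\<Prod>a::'a\<in>UNIV. [:mconst a * u, 1:]"
  let ?q = "Polynomial.monom 1 ?r - Polynomial.monom (u ^ (?r - 1)) 1"
  have r: "?r \<ge> 2"
    using card_mono[of "UNIV :: 'a set" "{0, 1}"] by simp
  have degp: "Polynomial.degree ?p = ?r" "lead_coeff ?p = 1"
    by (simp add: degree_prod_eq_sum_degree) (simp only: lead_coeff_prod, simp)
  have inj: "inj (\<lambda>a. - mconst a * u)"
    using assms by (auto simp: inj_on_def)
  have "?p = ?q"
  proof (rule poly_eqI_degree_lead_coeff[where n = ?r and A = "range (\<lambda>a. - mconst a * u)"])
    show "Polynomial.coeff ?p ?r = Polynomial.coeff ?q ?r"
      using degp r by simp
    show "?r \<le> card (range (\<lambda>a::'a. - mconst a * u))"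
      using card_image[OF inj] by simp
    show "Polynomial.degree ?q \<le> ?r"
      using r by (intro degree_diff_le) (auto intro: order.trans[OF degree_monom_le])
    show "Polynomial.degree ?p \<le> ?r"
      using degp by simp
    fix z assume "z \<in> range (\<lambda>a::'a. - mconst a * u)"
    then obtain b :: 'a where z: "z = - mconst b * u" by blast
    have p0: "poly ?p z = 0"
      unfolding poly_prod z by (intro prod_zero) (auto intro!: bexI[of _ b])
    have "(- mconst b * u) ^ ?r = - mconst b * u ^ ?r"
      unfolding power_mult_distrib
      by (simp add: finite_field_power_card_eq_same flip: mconst_ring.hom_uminus mconst.hom_power)
    moreover have "u ^ (?r - Suc 0) * u = u ^ ?r"
      using r power_minus_mult[of ?r u] by simp
    ultimately have "poly ?q z = 0"
      by (simp add: poly_monom z mult.left_commute)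
    with p0 show "poly ?p z = poly ?q z" by simp
  qed
  then have "poly ?p S = poly ?q S" by simp
  then show ?thesis
    by (simp add: poly_prod poly_monom algebra_simps)
qed

text \<open>Split the span by the coefficient a of the last vector. The previous stage is additive
  and F-linear, so the product becomes that of f(T) + a f(x_j) over all scalars a, which
  \<open>prod_scalar_shifts\<close> evaluates to the recursion step.\<close>

lemma prod_span_eq_addpoly:
  fixes x :: "nat \<Rightarrow> ('v::linorder, 'a::finite_field) mvpoly"
  assumes frob: "\<And>f g :: ('v, 'a) mvpoly. (f + g) ^ CARD('a) = f ^ CARD('a) + g ^ CARD('a)"
    and nz: "\<And>i. i < j \<Longrightarrow> addpoly CARD('a) x i (x i) \<noteq> 0"
  shows "(\<Prod>c\<in>(\<Pi>\<^sub>E i\<in>{..<j}. UNIV). T + (\<Sum>i<j. mconst (c i) * x i)) = addpoly CARD('a) x j T"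
  using nz
proof (induction j arbitrary: T)
  case (Suc j)
  let ?f = "addpoly CARD('a) x j"
  have scale: "?f (mconst a * U) = mconst a * ?f U" for a U
    by (rule addpoly_scale) (simp add: finite_field_power_card_eq_same flip: mconst.hom_power)
  let ?C = "\<Pi>\<^sub>E i\<in>{..<j}. (UNIV :: 'a set)"
  have PiE: "(\<Pi>\<^sub>E i\<in>{..<Suc j}. (UNIV :: 'a set)) = (\<lambda>(a, c). c(j := a)) ` (UNIV \<times> ?C)"
    by (simp only: lessThan_Suc PiE_insert_eq)
  have inj: "inj_on (\<lambda>(a, c). c(j := a)) ((UNIV :: 'a set) \<times> ?C)"
    by (rule inj_combinator) simp
  have "(\<Prod>c\<in>(\<Pi>\<^sub>E i\<in>{..<Suc j}. UNIV). T + (\<Sum>i<Suc j. mconst (c i) * x i))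
      = (\<Prod>(a, c)\<in>UNIV \<times> ?C. T + (\<Sum>i<Suc j. mconst ((c(j := a)) i) * x i))"
    unfolding PiE prod.reindex[OF inj] by (simp only: comp_def case_prod_unfold)
  also have "\<dots> = (\<Prod>a\<in>UNIV. \<Prod>c\<in>?C. T + (\<Sum>i<Suc j. mconst ((c(j := a)) i) * x i))"
    by (rule prod.cartesian_product[symmetric])
  also have "\<dots> = (\<Prod>a\<in>UNIV. \<Prod>c\<in>?C. (T + mconst a * x j) + (\<Sum>i<j. mconst (c i) * x i))"
    by (intro prod.cong refl) (simp add: add_ac)
  also have "\<dots> = (\<Prod>a\<in>UNIV. ?f T + mconst a * ?f (x j))"
    using Suc.prems by (subst Suc.IH) (simp_all add: addpoly_add[OF frob] scale)
  also have "\<dots> = addpoly CARD('a) x (Suc j) T"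
    using Suc.prems by (subst prod_scalar_shifts) auto
  finally show ?case .
qed simp

section \<open>Frobenius-twisted Gaussian elimination on the sequence of forms\<close>

section \<open>Elimination\<close>

text \<open>If e' has coefficients f_j(x_i) at y_i^(Q_(s-1)) and e has the same coefficients at
  y_i^(Q_s), then e'^r - f_j(x_j)^(r-1) e has coefficients f_j(x_i)^r - f_j(x_j)^(r-1) f_j(x_i) =
  f_(j+1)(x_i) at y_i^(Q_s). Each round uses the preceding index \<open>s - 1\<close>, hence
  \<open>j \<le> s\<close>.\<close>

lemma eliminate:
  fixes A S :: "'r::idom set" and x y h :: "nat \<Rightarrow> 'r"
  assumes A: "is_subring A" and S: "is_subring S" and r: "r > 0"
    and frob: "\<And>f g :: 'r. (f + g) ^ r = f ^ r + g ^ r"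
    and x: "\<And>i. i < k \<Longrightarrow> x i \<in> S" and u: "\<And>j. j < k \<Longrightarrow> addpoly r x j (x j) \<in> A"
    and Q: "\<And>s. Q (Suc s) = Q s * r"
    and h: "\<And>s. s < k \<Longrightarrow> h s \<in> A"
      "\<And>s. s < k \<Longrightarrow> h s - (\<Sum>i<k. x i * y i ^ Q s) \<in> low_degree S k y (Q s)"
  shows "j \<le> s \<Longrightarrow> s < k \<Longrightarrow>
    \<exists>e\<in>A. e - (\<Sum>i<k. addpoly r x j (x i) * y i ^ Q s) \<in> low_degree S k y (Q s)"
proof (induction j arbitrary: s)
  case 0
  then show ?case
    using h[of s] by auto
next
  case (Suc j)
  let ?f = "addpoly r x j" and ?L = "low_degree S k y"
  obtain t where s: "s = Suc t"
    using Suc.prems by (cases s) auto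
  obtain e where e: "e \<in> A" "e - (\<Sum>i<k. ?f (x i) * y i ^ Q s) \<in> ?L (Q s)"
    using Suc.IH[of s] Suc.prems by auto
  obtain e' where e': "e' \<in> A" "e' - (\<Sum>i<k. ?f (x i) * y i ^ Q t) \<in> ?L (Q t)"
    using Suc.IH[of t] Suc.prems s by auto
  let ?u = "?f (x j) ^ (r - 1)"
  have uA: "?u \<in> A"
    using u[of j] Suc.prems by (intro subring_power[OF A]) auto
  have uS: "?u \<in> S"
    using x Suc.prems by (intro subring_power[OF S] addpoly_in_subring[OF S]) auto
  have "(e' - (\<Sum>i<k. ?f (x i) * y i ^ Q t)) ^ r \<in> ?L (Q s)"
    unfolding s Q by (rule low_degree_power[OF S r frob e'(2)])
  moreover have "(e' - (\<Sum>i<k. ?f (x i) * y i ^ Q t)) ^ r = e' ^ r - (\<Sum>i<k. ?f (x i) ^ r * y i ^ Q s)"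
    by (simp add: frob_diff[OF frob] frob_sum[OF r frob] power_mult_distrib s Q flip: power_mult)
  ultimately have "e' ^ r - (\<Sum>i<k. ?f (x i) ^ r * y i ^ Q s) \<in> ?L (Q s)"
    by simp
  then have "(e' ^ r - (\<Sum>i<k. ?f (x i) ^ r * y i ^ Q s))
      - ?u * (e - (\<Sum>i<k. ?f (x i) * y i ^ Q s)) \<in> ?L (Q s)"
    by (rule low_degree_diff[OF S _ low_degree_mult[OF S uS e(2)]])
  also have "(e' ^ r - (\<Sum>i<k. ?f (x i) ^ r * y i ^ Q s)) - ?u * (e - (\<Sum>i<k. ?f (x i) * y i ^ Q s))
      = (e' ^ r - ?u * e) - (\<Sum>i<k. addpoly r x (Suc j) (x i) * y i ^ Q s)"
    by (simp add: left_diff_distrib right_diff_distrib sum_subtractf sum_distrib_left mult.assoc)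
  finally show ?case
    using uA e e' by (intro bexI[of _ "e' ^ r - ?u * e"])
      (auto intro: subring_diff[OF A] subring_mult[OF A] subring_power[OF A])
qed

text \<open>Taking \<open>s = j\<close>, the coefficients at i < j vanish by
  \<open>addpoly_eq_0\<close>, and the pivot f_j(x_j) lies in \<open>A\<close>; this is the form of
  relation that \<open>reduce_monomials\<close> consumes.\<close>

lemma elimination_relation:
  fixes A S :: "'r::idom set" and x y h :: "nat \<Rightarrow> 'r"
  assumes A: "is_subring A" and S: "is_subring S" and r: "r > 0"
    and frob: "\<And>f g :: 'r. (f + g) ^ r = f ^ r + g ^ r"
    and x: "\<And>i. i < k \<Longrightarrow> x i \<in> S" and u: "\<And>j. j < k \<Longrightarrow> addpoly r x j (x j) \<in> A"
    and nz: "\<And>j. j < k \<Longrightarrow> addpoly r x j (x j) \<noteq> 0"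
    and Q: "\<And>s. Q (Suc s) = Q s * r"
    and h: "\<And>s. s < k \<Longrightarrow> h s \<in> A"
      "\<And>s. s < k \<Longrightarrow> h s - (\<Sum>i<k. x i * y i ^ Q s) \<in> low_degree S k y (Q s)"
    and j: "j < k"
  shows "\<exists>u\<in>A. u \<noteq> 0 \<and> (\<exists>a\<in>A. \<exists>c. \<exists>\<rho>\<in>low_degree S k y (Q j).
      (\<forall>i<k. c i \<in> S) \<and> u * y j ^ Q j = a + (\<Sum>i\<in>{j<..<k}. c i * y i ^ Q j) + \<rho>)"
proof -
  let ?f = "addpoly r x j"
  obtain e where e: "e \<in> A" "e - (\<Sum>i<k. ?f (x i) * y i ^ Q j) \<in> low_degree S k y (Q j)"
    using eliminate[where x = x and y = y and Q = Q and h = h and j = j and s = j, OF A S r frob x u Q h order_refl j]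
    by blast
  have "(\<Sum>i<k. ?f (x i) * y i ^ Q j) = (\<Sum>i\<in>{j..<k}. ?f (x i) * y i ^ Q j)"
    using r by (intro sum.mono_neutral_right) (auto simp: addpoly_eq_0)
  also have "\<dots> = ?f (x j) * y j ^ Q j + (\<Sum>i\<in>{j<..<k}. ?f (x i) * y i ^ Q j)"
    using j by (simp add: sum.atLeast_Suc_lessThan atLeastSucLessThan_greaterThanLessThan)
  finally have "?f (x j) * y j ^ Q j = e + (\<Sum>i\<in>{j<..<k}. (- ?f (x i)) * y i ^ Q j)
      + - (e - (\<Sum>i<k. ?f (x i) * y i ^ Q j))"
    by (simp add: sum_negf)
  moreover have "- ?f (x i) \<in> S" if "i < k" for i
    using x that j by (intro subring_uminus[OF S] addpoly_in_subring[OF S]) auto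
  ultimately show ?thesis
    by (intro bexI[OF _ u[OF j]] conjI nz[OF j] bexI[OF _ e(1)] exI[of _ "\<lambda>i. - ?f (x i)"]
          bexI[OF _ low_degree_uminus[OF S e(2)]]) auto
qed

section \<open>A spanning set of monomials of size the product of the degrees\<close>

section \<open>Spanning the polynomial ring\<close>

lemma low_degree_mono:
  assumes "D \<le> D'" "f \<in> low_degree S k y D"
  shows "f \<in> low_degree S k y D'"
  using assms(2) by induction (use assms(1) in \<open>auto intro!: low_degree.intros\<close>)

lemma low_degree_1_Suc:
  assumes "f \<in> low_degree S 1 (\<lambda>_. z) D"
  shows "z * f \<in> low_degree S 1 (\<lambda>_. z) (Suc D)"
  using assms
proof induction
  case (monom x m)
  then show ?case
    using low_degree.monom[of x S "\<lambda>i. Suc (m i)" 1 "Suc D" "\<lambda>_. z"] by (simp add: mult_ac)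
qed (auto simp: distrib_left intro: low_degree.intros)

lemma prod_monic:
  assumes S: "is_subring S" and "finite V" "V \<subseteq> S"
  shows "(\<Prod>v\<in>V. z + v) - z ^ card V \<in> low_degree S 1 (\<lambda>_. z) (card V)"
  using assms(2,3)
proof (induction V rule: finite_induct)
  case (insert v V)
  let ?c = "card V" and ?\<rho> = "(\<Prod>v\<in>V. z + v) - z ^ card V"
  have "v * z ^ ?c \<in> low_degree S 1 (\<lambda>_. z) (Suc ?c)"
    using low_degree.monom[of v S "\<lambda>_. ?c" 1 "Suc ?c" "\<lambda>_. z"] insert.prems by simp
  moreover have \<rho>: "?\<rho> \<in> low_degree S 1 (\<lambda>_. z) ?c"
    using insert by blast
  have "v * ?\<rho> \<in> low_degree S 1 (\<lambda>_. z) (Suc ?c)"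
    by (rule low_degree_mono[OF _ low_degree_mult[OF S _ \<rho>]]) (use insert.prems in auto)
  moreover have "z * ?\<rho> \<in> low_degree S 1 (\<lambda>_. z) (Suc ?c)"
    by (rule low_degree_1_Suc[OF \<rho>])
  ultimately have "v * z ^ ?c + (v * ?\<rho> + z * ?\<rho>) \<in> low_degree S 1 (\<lambda>_. z) (Suc ?c)"
    by (intro low_degree.add)
  moreover have "v * z ^ ?c + (v * ?\<rho> + z * ?\<rho>) = (z + v) * (\<Prod>v\<in>V. z + v) - z * z ^ ?c"
    by (simp add: algebra_simps)
  ultimately show ?case
    using insert.hyps by simp
qed (simp add: low_degree.zero)

lemma polys_in_expand:
  assumes "f \<in> polys_in {..<n}"
  shows "f = (\<Sum>m\<in>Poly_Mapping.keys f. mconst (Poly_Mapping.lookup f m) * monomial n mvar (Poly_Mapping.lookup m))"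
proof -
  have "(\<Prod>i\<in>Poly_Mapping.keys m. mvar i ^ Poly_Mapping.lookup m i)
      = (monomial n mvar (Poly_Mapping.lookup m) :: (nat, 'a) mvpoly)" if "m \<in> Poly_Mapping.keys f" for m
  proof (rule prod.mono_neutral_left)
    show "Poly_Mapping.keys m \<subseteq> {..<n}"
      using assms that by (auto simp: polys_in_def)
  qed (auto simp: in_keys_iff)
  then show ?thesis
    by (subst mvpoly_expand) simp
qed

lemma monomial_in_polys_in: "(\<And>i. i < k \<Longrightarrow> y i \<in> polys_in I) \<Longrightarrow> monomial k y m \<in> polys_in I"
  by (auto intro!: polys_in_prod polys_in_power)

lemma polys_in_frac_spanI:
  fixes A W :: "(nat, 'a::field) mvpoly set"
  assumes A: "is_subring A" "\<And>c. mconst c \<in> A" and W: "finite W"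
    and mon: "\<And>m. monomial n mvar m \<in> frac_span A W"
  shows "polys_in {..<n} \<subseteq> frac_span A W"
proof
  fix f :: "(nat, 'a) mvpoly" assume "f \<in> polys_in {..<n}"
  then show "f \<in> frac_span A W"
    by (subst polys_in_expand) (auto intro!: frac_span_sum[OF A(1) W] frac_span_scale[OF A(1) W] A(2) mon)
qed

text \<open>One variable at a time: the product of the \<open>mvar i + v\<close> is monic in
  \<open>mvar i\<close> over the ring of earlier variables, so it allows reduction of the exponent
  below \<open>card (V i)\<close>. This is \<open>reduce_monomials\<close> with a single rewriting
  variable.\<close>

lemma span_triangular:
  fixes A :: "(nat, 'a::field) mvpoly set"
  assumes A: "is_subring A" "\<And>c. mconst c \<in> A"
    and V: "\<And>a. a < K \<Longrightarrow> finite (V a) \<and> V a \<noteq> {} \<and> V a \<subseteq> polys_in {..<a}"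
      "\<And>a. a < K \<Longrightarrow> (\<Prod>v\<in>V a. mvar a + v) \<in> A"
  shows "i \<le> K \<Longrightarrow> polys_in {..<i} \<subseteq> frac_span A (monomial i mvar ` (\<Pi>\<^sub>E a\<in>{..<i}. {..<card (V a)}))"
proof (induction i)
  case 0
  have "monomial 0 mvar m \<in> frac_span A {1}" for m
    using frac_span_base[OF A(1), of "{1}" 1] by simp
  then show ?case
    using polys_in_frac_spanI[OF A, of "{1}" 0] by simp
next
  case (Suc i)
  let ?U = "monomial i mvar ` (\<Pi>\<^sub>E a\<in>{..<i}. {..<card (V a)}) :: (nat, 'a) mvpoly set"
  let ?U' = "monomial (Suc i) mvar ` (\<Pi>\<^sub>E a\<in>{..<Suc i}. {..<card (V a)}) :: (nat, 'a) mvpoly set"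
  let ?S = "polys_in {..<i} :: (nat, 'a) mvpoly set"
  define W where "W = (\<lambda>(u, m). u * monomial 1 (\<lambda>_. mvar i) m) ` (?U \<times> (\<Pi>\<^sub>E j\<in>{..<1::nat}. {..<card (V i)}))"
  have fin: "finite ?U" "finite ?U'"
    by (auto intro!: finite_imageI finite_PiE)
  have S: "is_subring ?S"
    by (rule polys_in_subring)
  have i: "finite (V i)" "V i \<noteq> {}" "V i \<subseteq> ?S" "(\<Prod>v\<in>V i. mvar i + v) \<in> A"
    using V Suc.prems by auto
  have rel: "\<exists>u\<in>A. u \<noteq> 0 \<and> (\<exists>a\<in>A. \<exists>c. \<exists>\<rho>\<in>low_degree ?S 1 (\<lambda>_. mvar i) (card (V i)).
      (\<forall>i<1. c i \<in> ?S) \<and> u * mvar i ^ card (V i) = a + (\<Sum>i'\<in>{j<..<1}. c i' * mvar i ^ card (V i)) + \<rho>)"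
    if "j < 1" for j :: nat
    \<comment> \<open>The leading coefficient is 1, the element of \<open>A\<close> is the product
      itself, and the remainder is minus its lower part; there are no later variables.\<close>
    by (rule bexI[of _ 1], rule conjI[OF one_neq_zero], rule bexI[OF _ i(4)], rule exI[of _ "\<lambda>_. 0"],
        rule bexI[OF _ low_degree_uminus[OF S prod_monic[OF S i(1,3), of "mvar i"]]])
       (use subring_1[OF A(1)] in auto)
  have "card (V i) > 0"
    using i by (simp add: card_gt_0_iff)
  note red = reduce_monomials[OF A(1) S fin(1) Suc.IH, of 1 "\<lambda>_. card (V i)" "\<lambda>_. mvar i" W, OF _ this rel W_def]
  have W_sub: "W \<subseteq> ?U'"
  proof
    fix w assume "w \<in> W"
    then obtain u e' where u: "u \<in> ?U" "e' \<in> (\<Pi>\<^sub>E j\<in>{..<1::nat}. {..<card (V i)})" "w = u * mvar i ^ e' 0"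
      unfolding W_def by auto
    obtain m where "m \<in> (\<Pi>\<^sub>E a\<in>{..<i}. {..<card (V a)})" "u = monomial i mvar m"
      using u(1) by blast
    moreover define e where "e = e' 0"
    moreover have "e < card (V i)"
      using u(2) by (auto simp: e_def PiE_iff)
    ultimately have m: "m \<in> (\<Pi>\<^sub>E a\<in>{..<i}. {..<card (V a)})" "e < card (V i)"
      "w = monomial i mvar m * mvar i ^ e"
      using u(3) by auto
    have "w = monomial (Suc i) mvar (m(i := e))"
      using m(3) by simp
    moreover have "m(i := e) \<in> (\<Pi>\<^sub>E a\<in>{..<Suc i}. {..<card (V a)})"
      using PiE_fun_upd[of e "\<lambda>a. {..<card (V a)}" i m "{..<i}"] m(1,2) by (simp add: lessThan_Suc)
    ultimately show "w \<in> ?U'" by blast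
  qed
  show ?case
  proof (rule polys_in_frac_spanI[OF A fin(2)])
    fix m :: "nat \<Rightarrow> nat"
    have "monomial i mvar m * monomial 1 (\<lambda>_. mvar i) (\<lambda>_. m i) \<in> frac_span A W"
      using Suc.prems by (intro red) (auto intro!: monomial_in_polys_in)
    then have "monomial (Suc i) mvar m \<in> frac_span A W"
      by simp
    then have "monomial (Suc i) mvar m * 1 \<in> frac_span A ?U'"
    proof (rule frac_span_trans[OF A(1) fin(2)])
      fix w assume "w \<in> W"
      then have "w \<in> ?U'"
        using W_sub by (rule rev_subsetD)
      then show "w * 1 \<in> frac_span A ?U'"
        unfolding mult_1_right by (rule frac_span_base[OF A(1) fin(2)])
    qed
    then show "monomial (Suc i) mvar m \<in> frac_span A ?U'"
      by (simp only: mult.right_neutral)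
  qed
qed

lemma monomial_split:
  assumes "n = 2 * k + l"
  shows "monomial n y m = monomial (k + l) y m * monomial k (\<lambda>i. y (n - 1 - i)) (\<lambda>i. m (n - 1 - i))"
proof -
  have "(\<Prod>i\<in>{k + l..<n}. y i ^ m i) = (\<Prod>i<k. y (n - 1 - i) ^ m (n - 1 - i))"
    by (rule prod.reindex_bij_witness[of _ "\<lambda>i. n - 1 - i" "\<lambda>i. n - 1 - i"]) (use assms in auto)
  moreover have "{..<n} = {..<k + l} \<union> {k + l..<n}"
    using assms by auto
  then have "monomial n y m = monomial (k + l) y m * (\<Prod>i\<in>{k + l..<n}. y i ^ m i)"
    by (metis finite_lessThan finite_atLeastLessThan ivl_disj_int_one(2) prod.union_disjoint)
  ultimately show ?thesis
    by simp
qed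

text \<open>First the powers of the last \<open>k\<close> variables are reduced over the ring of the
  first \<open>k + l\<close>, then the coefficients are reduced by \<open>span_triangular\<close>.
  The last variables are listed backwards, as the partners of the first ones under the form.\<close>

lemma spanning_set:
  fixes A :: "(nat, 'a::field) mvpoly set"
  assumes A: "is_subring A" "\<And>c. mconst c \<in> A" and n: "n = 2 * k + l"
    and V: "\<And>a. a < k + l \<Longrightarrow> finite (V a) \<and> V a \<noteq> {} \<and> V a \<subseteq> polys_in {..<a}"
      "\<And>a. a < k + l \<Longrightarrow> (\<Prod>v\<in>V a. mvar a + v) \<in> A"
    and Q: "\<And>j. j < k \<Longrightarrow> Q j > 0"
    and rel: "\<And>j. j < k \<Longrightarrow> \<exists>u\<in>A. u \<noteq> 0 \<and> (\<exists>a\<in>A. \<exists>c.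
      \<exists>\<rho>\<in>low_degree (polys_in {..<k + l}) k (\<lambda>i. mvar (n - 1 - i)) (Q j).
      (\<forall>i<k. c i \<in> polys_in {..<k + l}) \<and>
      u * mvar (n - 1 - j) ^ Q j = a + (\<Sum>i\<in>{j<..<k}. c i * mvar (n - 1 - i) ^ Q j) + \<rho>)"
  obtains W where "finite W" "W \<subseteq> polys_in {..<n}" "card W \<le> (\<Prod>a<k + l. card (V a)) * (\<Prod>j<k. Q j)"
    "polys_in {..<n} \<subseteq> frac_span A W"
proof -
  let ?U = "monomial (k + l) mvar ` (\<Pi>\<^sub>E a\<in>{..<k + l}. {..<card (V a)}) :: (nat, 'a) mvpoly set"
  let ?y = "\<lambda>i. mvar (n - 1 - i) :: (nat, 'a) mvpoly"
  let ?E = "\<Pi>\<^sub>E j\<in>{..<k}. {..<Q j}"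
  define W where "W = (\<lambda>(u, m). u * monomial k ?y m) ` (?U \<times> ?E)"
  have fin: "finite ?U" "finite ?E"
    by (auto intro!: finite_imageI finite_PiE)
  then have finW: "finite W"
    by (auto simp: W_def)
  have S: "is_subring (polys_in {..<k + l} :: (nat, 'a) mvpoly set)"
    by (rule polys_in_subring)
  have SU: "polys_in {..<k + l} \<subseteq> frac_span A ?U"
    by (rule span_triangular[OF A V order_refl]) auto
  have "card W \<le> card ?U * card ?E"
    unfolding W_def card_cartesian_product[symmetric] using fin by (intro card_image_le finite_cartesian_product)
  also have "card ?U * card ?E \<le> card (\<Pi>\<^sub>E a\<in>{..<k + l}. {..<card (V a)}) * card ?E"
    by (intro mult_le_mono1 card_image_le finite_PiE) simp_all
  also have "\<dots> = (\<Prod>a<k + l. card (V a)) * (\<Prod>j<k. Q j)"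
    by (simp add: card_PiE)
  finally have card: "card W \<le> (\<Prod>a<k + l. card (V a)) * (\<Prod>j<k. Q j)" .
  have "monomial (k + l) mvar m * monomial k ?y m' \<in> polys_in {..<n}" for m m'
    by (rule polys_in_mult; rule monomial_in_polys_in; rule polys_in_mvar) (use n in auto)
  then have "W \<subseteq> polys_in {..<n}"
    unfolding W_def by (simp only: image_subset_iff split_paired_Ball_Sigma prod.case) blast
  moreover have "polys_in {..<n} \<subseteq> frac_span A W"
  proof (rule polys_in_frac_spanI[OF A finW])
    fix m :: "nat \<Rightarrow> nat"
    show "monomial n mvar m \<in> frac_span A W"
      unfolding monomial_split[OF n]
      by (rule reduce_monomials[OF A(1) S fin(1) SU Q rel W_def]) (auto intro!: monomial_in_polys_in)
  qed
  ultimately show thesis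
    using finW card that by blast
qed

section \<open>Generated fields and fraction fields as concrete subfields\<close>

section \<open>Subfields of the field of rational functions\<close>

definition is_subfield :: "'r::field set \<Rightarrow> bool" where
  "is_subfield K \<longleftrightarrow> is_subring K \<and> (\<forall>x\<in>K. inverse x \<in> K)"

text \<open>\<open>generate_field\<close> refers to a ring record, whose inverse is that of the
  monoid of units; on nonzero elements it agrees with the type class inverse.\<close>

lemma m_inv_type_algebra:
  fixes x :: "'r::field"
  assumes "x \<noteq> 0"
  shows "inv\<^bsub>ring_of_type_algebra\<^esub> x = inverse x"
proof -
  interpret field "ring_of_type_algebra :: 'r ring"
    by (rule field_from_type_algebra)
  have "inverse x \<otimes>\<^bsub>ring_of_type_algebra\<^esub> x = \<one>\<^bsub>ring_of_type_algebra\<^esub>"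
    using assms by (simp add: ring_of_type_algebra_def)
  then show ?thesis
    by (intro comm_inv_char) (simp_all add: ring_of_type_algebra_def mult.commute)
qed

lemma a_inv_type_algebra: "\<ominus>\<^bsub>ring_of_type_algebra\<^esub> x = - (x :: 'r::field)"
proof -
  interpret field "ring_of_type_algebra :: 'r ring"
    by (rule field_from_type_algebra)
  show ?thesis
    by (rule minus_equality) (simp_all add: ring_of_type_algebra_def)
qed

lemma field_adjoin_subfield: "is_subfield (field_adjoin S)"
proof -
  let ?R = "ring_of_type_algebra :: 'a ratfun ring"
  have *: "x + y \<in> field_adjoin S" "x * y \<in> field_adjoin S"
    if "x \<in> field_adjoin S" "y \<in> field_adjoin S" for x y
    using generate_field.eng_add[of x ?R "range fconst \<union> S" y]
      generate_field.eng_mult[of x ?R "range fconst \<union> S" y] that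
    by (simp_all add: field_adjoin_def ring_of_type_algebra_def)
  have minus: "- x \<in> field_adjoin S" if "x \<in> field_adjoin S" for x
    using generate_field.a_inv[of x ?R "range fconst \<union> S"] that
    by (simp add: field_adjoin_def a_inv_type_algebra)
  have one: "1 \<in> field_adjoin S"
    using generate_field.one[of ?R "range fconst \<union> S"]
    by (simp add: field_adjoin_def ring_of_type_algebra_def)
  have "inverse x \<in> field_adjoin S" if "x \<in> field_adjoin S" for x
  proof (cases "x = 0")
    case True
    then show ?thesis
      using that by simp
  next
    case False
    then show ?thesis
      using generate_field.m_inv[of x ?R "range fconst \<union> S"] that
      by (simp add: field_adjoin_def m_inv_type_algebra) (simp add: ring_of_type_algebra_def)
  qed
  moreover have "x - y \<in> field_adjoin S" if "x \<in> field_adjoin S" "y \<in> field_adjoin S" for x y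
    using *(1)[OF that(1) minus[OF that(2)]] by simp
  ultimately show ?thesis
    using * one by (auto simp: is_subfield_def is_subring_def)
qed

lemma fconst_in_field_adjoin: "fconst c \<in> field_adjoin S"
  unfolding field_adjoin_def by (intro generate_field.incl) auto

lemma field_adjoin_incl: "S \<subseteq> field_adjoin S"
  unfolding field_adjoin_def by (auto intro: generate_field.incl)

lemma field_adjoin_minimal:
  assumes K: "is_subfield K" and "range fconst \<subseteq> K" "S \<subseteq> K"
  shows "field_adjoin S \<subseteq> K"
proof
  fix x assume "x \<in> field_adjoin S"
  then have "x \<in> generate_field ring_of_type_algebra (range fconst \<union> S)"
    by (simp add: field_adjoin_def)
  then show "x \<in> K"
  proof induction
    case (m_inv h)
    then have "h \<noteq> 0"
      by (simp add: ring_of_type_algebra_def)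
    with m_inv K show ?case
      by (simp add: m_inv_type_algebra is_subfield_def)
  next
    case (a_inv h)
    with K show ?case
      by (simp add: a_inv_type_algebra is_subfield_def subring_uminus)
  next
    case one
    then show ?case
      using K subring_1[of K] by (simp add: is_subfield_def ring_of_type_algebra_def)
  next
    case (eng_add x y)
    then show ?case
      using K subring_add[of K x y] by (simp add: is_subfield_def ring_of_type_algebra_def)
  next
    case (eng_mult x y)
    then show ?case
      using K subring_mult[of K x y] by (simp add: is_subfield_def ring_of_type_algebra_def)
  qed (use assms in auto)
qed

lemma field_adjoin_mono: "S \<subseteq> T \<Longrightarrow> field_adjoin S \<subseteq> field_adjoin T"
  by (rule field_adjoin_minimal[OF field_adjoin_subfield])
     (auto simp: fconst_in_field_adjoin intro: field_adjoin_incl[THEN subsetD])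

lemma quot_field_eq: "quot_field A = {to_fract a / to_fract b | a b. a \<in> A \<and> b \<in> A \<and> b \<noteq> 0}"
  unfolding quot_field_def Fract_conv_to_fract ..

lemma quot_fieldI:
  "a \<in> A \<Longrightarrow> b \<in> A \<Longrightarrow> b \<noteq> 0 \<Longrightarrow> x = to_fract a / to_fract b \<Longrightarrow> x \<in> quot_field A"
  unfolding quot_field_eq by blast

lemma quot_field_subfield:
  assumes A: "is_subring A"
  shows "is_subfield (quot_field A)"
  unfolding is_subfield_def is_subring_def
proof (intro conjI ballI)
  show "1 \<in> quot_field A"
    by (rule quot_fieldI[OF subring_1[OF A] subring_1[OF A]]) simp_all
next
  fix x y assume "x \<in> quot_field A" "y \<in> quot_field A"
  then obtain a b c d where *: "x = to_fract a / to_fract b" "y = to_fract c / to_fract d"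
    "a \<in> A" "b \<in> A" "b \<noteq> 0" "c \<in> A" "d \<in> A" "d \<noteq> 0"
    by (auto simp: quot_field_eq)
  have "x - y = to_fract (a * d - c * b) / to_fract (b * d)"
    "x * y = to_fract (a * c) / to_fract (b * d)"
    unfolding *(1,2) using *(5,8) by (simp_all add: field_simps)
  moreover have "a * d - c * b \<in> A" "a * c \<in> A" "b * d \<in> A" "b * d \<noteq> 0"
    using * by (auto intro!: subring_diff[OF A] subring_mult[OF A])
  ultimately show "x - y \<in> quot_field A" "x * y \<in> quot_field A"
    by (simp_all add: quot_fieldI[of _ A "b * d"])
next
  fix x assume "x \<in> quot_field A"
  then obtain a b where *: "x = to_fract a / to_fract b" "a \<in> A" "b \<in> A" "b \<noteq> 0"
    by (auto simp: quot_field_eq)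
  show "inverse x \<in> quot_field A"
  proof (cases "a = 0")
    case True
    then show ?thesis
      by (intro quot_fieldI[OF subring_0[OF A] subring_1[OF A]]) (simp_all add: *)
  next
    case False
    then have "inverse x = to_fract b / to_fract a"
      using * by simp
    then show ?thesis
      using False * by (intro quot_fieldI[of b A a])
  qed
qed

section \<open>Matrix groups acting by substitution, their orbit products and invariants\<close>

section \<open>Linear substitutions\<close>

text \<open>Composition of f with v -> N v, that is, the action of the inverse of N; composition
  therefore reverses the order of factors, as in \<open>lsub_lsub\<close>.\<close>

definition lsub :: "nat \<Rightarrow> 'a::comm_ring_1 mat \<Rightarrow> (nat, 'a) mvpoly \<Rightarrow> (nat, 'a) mvpoly" where
  "lsub n N = meval mconst (\<lambda>j. \<Sum>k<n. mconst (N $$ (j, k)) * mvar k)"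

lemma lsub_hom: "comm_semiring_hom (lsub n N)"
  unfolding lsub_def by (rule meval_hom[OF mconst_hom])

interpretation lsub: comm_ring_hom "lsub n N"
  by (intro comm_ring_hom.intro ring_hom.intro comm_semiring_hom.axioms(1)[OF lsub_hom])

lemma lsub_mconst [simp]: "lsub n N (mconst c) = mconst c"
  unfolding lsub_def by (rule meval_mconst[OF mconst_hom])

lemma lsub_mvar: "lsub n N (mvar j) = (\<Sum>k<n. mconst (N $$ (j, k)) * mvar k)"
  unfolding lsub_def by (rule meval_mvar[OF mconst_hom])

lemma lsub_in_poly_ring: "lsub n N f \<in> poly_ring n"
  unfolding lsub_def
proof (rule meval_in_polys_in[where I = UNIV])
  show "f \<in> polys_in UNIV"
    by (simp add: polys_in_def)
qed (rule polys_in_sum, rule polys_in_mult, simp_all)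

lemma lsub_lsub:
  assumes "M \<in> carrier_mat n n" "N \<in> carrier_mat n n" "f \<in> poly_ring n"
  shows "lsub n M (lsub n N f) = lsub n (N * M) f"
proof (rule polys_in_hom_eqI[OF _ _ _ _ assms(3)])
  show "comm_semiring_hom (\<lambda>f. lsub n M (lsub n N f))"
    by (rule hom_comp[OF lsub_hom lsub_hom])
next
  fix i assume "i \<in> {..<n}"
  then have i: "i < n" by simp
  have "lsub n M (lsub n N (mvar i)) = (\<Sum>j<n. \<Sum>k<n. mconst (N $$ (i, j) * M $$ (j, k)) * mvar k)"
    by (simp add: lsub_mvar lsub.hom_sum lsub.hom_mult sum_distrib_left mult.assoc mconst.hom_mult)
  also have "\<dots> = (\<Sum>k<n. mconst (\<Sum>j<n. N $$ (i, j) * M $$ (j, k)) * mvar k)"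
    by (subst sum.swap) (simp add: sum_distrib_right mconst.hom_sum)
  also have "\<dots> = lsub n (N * M) (mvar i)"
    unfolding lsub_mvar
  proof (intro sum.cong refl)
    fix k assume "k \<in> {..<n}"
    then show "mconst (\<Sum>j<n. N $$ (i, j) * M $$ (j, k)) * mvar k = mconst ((N * M) $$ (i, k)) * mvar k"
      using assms i by (simp add: scalar_prod_def atLeast0LessThan)
  qed
  finally show "lsub n M (lsub n N (mvar i)) = lsub n (N * M) (mvar i)" .
qed (simp_all add: lsub_hom)

lemma lsub_one:
  assumes "f \<in> poly_ring n"
  shows "lsub n (1\<^sub>m n) f = f"
proof (rule polys_in_hom_eqI[OF lsub_hom _ _ _ assms])
  show "comm_semiring_hom (\<lambda>f :: (nat, 'a) mvpoly. f)"
    by unfold_locales auto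
  fix i assume "i \<in> {..<n}"
  then show "lsub n (1\<^sub>m n) (mvar i) = mvar i"
    by (simp add: lsub_mvar if_distrib[of mconst] if_distrib[of "\<lambda>x. x * _"] cong: if_cong)
qed simp

definition matrix_group :: "nat \<Rightarrow> 'a::field mat set \<Rightarrow> bool" where
  "matrix_group n G \<longleftrightarrow> G \<subseteq> carrier_mat n n \<and> 1\<^sub>m n \<in> G \<and> (\<forall>M\<in>G. \<forall>N\<in>G. M * N \<in> G)
     \<and> (\<forall>M\<in>G. \<exists>N\<in>G. M * N = 1\<^sub>m n \<and> N * M = 1\<^sub>m n)"

lemma finite_carrier_mat: "finite (carrier_mat n n :: 'a::finite mat set)"
proof (rule finite_subset)
  show "(carrier_mat n n :: 'a mat set) \<subseteq> mat n n ` (\<Pi>\<^sub>E p\<in>{..<n} \<times> {..<n}. UNIV)"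
  proof
    fix M :: "'a mat" assume "M \<in> carrier_mat n n"
    then have "M = mat n n (restrict (\<lambda>p. M $$ p) ({..<n} \<times> {..<n}))"
      by (intro eq_matI) auto
    then show "M \<in> mat n n ` (\<Pi>\<^sub>E p\<in>{..<n} \<times> {..<n}. UNIV)"
      by (rule image_eqI[of M "mat n n"]) simp
  qed
qed (intro finite_imageI finite_PiE finite_cartesian_product finite_lessThan finite)

lemma unitriangular_carrier: "N \<in> unitriangular n \<Longrightarrow> N \<in> carrier_mat n n"
  by (simp add: unitriangular_def)

lemma unitriangular_invertible:
  assumes "M \<in> unitriangular n"
  obtains B where "B \<in> carrier_mat n n" "M * B = 1\<^sub>m n" "B * M = 1\<^sub>m n"
proof -
  have "det M = prod_list (diag_mat M)"
    using assms by (intro det_lower_triangular[of n]) (auto simp: unitriangular_def)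
  also have "\<dots> = 1"
  proof -
    have "diag_mat M = replicate n 1"
      using assms by (intro nth_equalityI) (auto simp: diag_mat_def unitriangular_def)
    then show ?thesis by simp
  qed
  finally have "M \<in> Units (ring_mat TYPE('a) n ())"
    using assms by (intro det_non_zero_imp_unit) (simp_all add: unitriangular_def)
  then show thesis
    using that by (auto simp: Units_def ring_mat_def)
qed

text \<open>Left multiplication by an invertible matrix is injective, hence surjective on a finite
  set closed under products, so it reaches the identity and inverses come for free.\<close>

lemma matrix_groupI:
  fixes G :: "'a::{field, finite} mat set"
  assumes G: "G \<subseteq> unitriangular n" and one: "1\<^sub>m n \<in> G"
    and mult: "\<And>M N. M \<in> G \<Longrightarrow> N \<in> G \<Longrightarrow> M * N \<in> G"
  shows "matrix_group n G"
  unfolding matrix_group_def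
proof (intro conjI ballI)
  show sub: "G \<subseteq> carrier_mat n n"
    using G unitriangular_carrier by blast
  then have fin: "finite G"
    using finite_carrier_mat finite_subset by blast
  fix M assume M: "M \<in> G"
  obtain B where B: "B \<in> carrier_mat n n" "B * M = 1\<^sub>m n"
    using G M unitriangular_invertible[of M n] by blast
  have "inj_on (\<lambda>N. M * N) G"
  proof
    fix N N' assume N: "N \<in> G" "N' \<in> G" and eq: "M * N = M * N'"
    have "K = B * (M * K)" if "K \<in> G" for K
    proof -
      have "M \<in> carrier_mat n n" "K \<in> carrier_mat n n"
        using M that sub by auto
      then show ?thesis
        using assoc_mult_mat[OF B(1), of M n K n] B(2) by simp
    qed
    from this[OF N(1)] this[OF N(2)] eq show "N = N'"
      by simp
  qed
  then have "(\<lambda>N. M * N) ` G = G"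
    using mult M fin by (intro endo_inj_surj) auto
  with one have "1\<^sub>m n \<in> (\<lambda>N. M * N) ` G"
    by simp
  then obtain N where N: "N \<in> G" "M * N = 1\<^sub>m n"
    by (elim imageE) (rule that, assumption, simp only:)
  have "N * M = 1\<^sub>m n"
    by (rule mat_mult_left_right_inverse[OF subsetD[OF sub M] subsetD[OF sub N(1)] N(2)])
  with N show "\<exists>N\<in>G. M * N = 1\<^sub>m n \<and> N * M = 1\<^sub>m n"
    by (intro bexI conjI)
qed (simp_all add: one mult)

lemma act_eq_lsub:
  fixes g :: "'a::field mat"
  assumes g: "g \<in> carrier_mat n n" and h: "h \<in> carrier_mat n n" "g * h = 1\<^sub>m n" "h * g = 1\<^sub>m n"
  shows "act g = lsub n h"
proof -
  have "g \<in> Units (ring_mat TYPE('a) n ())"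
    using g h by (auto simp: Units_def ring_mat_def)
  then obtain B where B: "mat_inverse g = Some B"
    using mat_inverse(1)[OF g, where b = "()"] by (cases "mat_inverse g") auto
  then have B': "g * B = 1\<^sub>m n" "B * g = 1\<^sub>m n" "B \<in> carrier_mat n n"
    using mat_inverse(2)[OF g] by auto
  have "B = B * (g * h)"
    using B' h by simp
  also have "\<dots> = h"
    using assoc_mult_mat[OF B'(3) g h(1)] B' h by simp
  finally show ?thesis
    using B g by (simp add: act_def lsub_def)
qed

context
  fixes n and G :: "'a::field mat set"
  assumes G: "matrix_group n G"
begin

lemma group_carrier: "N \<in> G \<Longrightarrow> N \<in> carrier_mat n n"
  and group_one: "1\<^sub>m n \<in> G"
  and group_mult: "M \<in> G \<Longrightarrow> N \<in> G \<Longrightarrow> M * N \<in> G"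
  using G by (auto simp: matrix_group_def)

lemma group_inverse:
  assumes "M \<in> G"
  obtains N where "N \<in> G" "M * N = 1\<^sub>m n" "N * M = 1\<^sub>m n"
  using G assms unfolding matrix_group_def by blast

text \<open>Inversion permutes the group, so orbits and invariants can be computed with
  substitutions by group elements instead of by their inverses.\<close>

lemma act_image: "act ` G = lsub n ` G"
proof (intro equalityI image_subsetI)
  fix g assume g: "g \<in> G"
  obtain h where h: "h \<in> G" "g * h = 1\<^sub>m n" "h * g = 1\<^sub>m n"
    using group_inverse[OF g] .
  have "act g = lsub n h" "act h = lsub n g"
    using g h by (auto intro!: act_eq_lsub group_carrier)
  then show "act g \<in> lsub n ` G" "lsub n g \<in> act ` G"
    using h(1) by (auto, metis imageI)
qed

lemma invariant_ring_eq: "invariant_ring n G = {f \<in> poly_ring n. \<forall>N\<in>G. lsub n N f = f}"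
proof -
  have "(\<forall>g\<in>G. act g f = f) \<longleftrightarrow> (\<forall>\<sigma>\<in>act ` G. \<sigma> f = f)" for f
    by blast
  then show ?thesis
    unfolding invariant_ring_def act_image by blast
qed

lemma orbit_product_eq: "orbit_product G i = (\<Prod>y\<in>(\<lambda>N. lsub n N (mvar i)) ` G. y)"
proof -
  have "(\<lambda>g. act g (mvar i)) ` G = (\<lambda>\<sigma>. \<sigma> (mvar i)) ` act ` G"
    by (simp add: image_image)
  also have "\<dots> = (\<lambda>N. lsub n N (mvar i)) ` G"
    by (simp add: act_image image_image)
  finally show ?thesis
    by (simp add: orbit_product_def)
qed

lemma invariant_ring_subring: "is_subring (invariant_ring n G)"
  unfolding invariant_ring_eq is_subring_def
  by (auto simp: lsub.hom_minus lsub.hom_mult)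

lemma lsub_inverse:
  assumes "N \<in> G"
  shows "\<exists>N'\<in>G. \<forall>f\<in>poly_ring n. lsub n N' (lsub n N f) = f"
proof -
  obtain N' where "N' \<in> G" "N * N' = 1\<^sub>m n"
    using group_inverse[OF assms] .
  with assms show ?thesis
    by (intro bexI[of _ N']) (simp_all add: lsub_lsub group_carrier lsub_one)
qed

lemma lsub_eq_0_iff:
  assumes "N \<in> G" "f \<in> poly_ring n"
  shows "lsub n N f = 0 \<longleftrightarrow> f = 0"
  using lsub_inverse[OF assms(1)] assms(2) by (metis lsub.hom_zero)

lemma bij_group_mult:
  assumes M: "M \<in> G"
  shows "bij_betw (\<lambda>N. N * M) G G"
proof -
  obtain M' where M': "M' \<in> G" "M * M' = 1\<^sub>m n" "M' * M = 1\<^sub>m n"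
    using group_inverse[OF M] .
  have "N * M * M' = N \<and> N * M' * M = N" if "N \<in> G" for N
    using assoc_mult_mat[of N n n M n M' n] assoc_mult_mat[of N n n M' n M n] M M' that group_carrier
      right_mult_one_mat[OF group_carrier[OF that]]
    by simp
  then show ?thesis
    using M M' group_mult by (intro bij_betwI[where g = "\<lambda>N. N * M'"]) auto
qed

lemma prod_over_group_invariant:
  assumes M: "M \<in> G" and f: "f \<in> poly_ring n"
  shows "lsub n M (\<Prod>N\<in>G. lsub n N f) = (\<Prod>N\<in>G. lsub n N f)"
proof -
  have "lsub n M (\<Prod>N\<in>G. lsub n N f) = (\<Prod>N\<in>G. lsub n (N * M) f)"
    using assms by (auto simp: lsub.hom_prod lsub_lsub group_carrier intro!: prod.cong)
  also have "\<dots> = (\<Prod>N\<in>G. lsub n N f)"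
    using prod.reindex_bij_betw[OF bij_group_mult[OF M], of "\<lambda>N. lsub n N f"] by simp
  finally show ?thesis .
qed

lemma orbit_invariant:
  assumes M: "M \<in> G" and f: "f \<in> poly_ring n"
  shows "lsub n M ` (\<lambda>N. lsub n N f) ` G = (\<lambda>N. lsub n N f) ` G"
proof -
  have "lsub n M ` (\<lambda>N. lsub n N f) ` G = (\<lambda>N. lsub n (N * M) f) ` G"
    using assms by (auto simp: image_image lsub_lsub group_carrier intro!: image_cong)
  also have "\<dots> = (\<lambda>N. lsub n N f) ` (\<lambda>N. N * M) ` G"
    by (simp add: image_image)
  also have "(\<lambda>N. N * M) ` G = G"
    using bij_group_mult[OF M] by (simp add: bij_betw_def)
  finally show ?thesis .
qed

lemma orbit_product_invariant:
  assumes i: "i < n"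
  shows "orbit_product G i \<in> invariant_ring n G"
  unfolding invariant_ring_eq
proof (intro CollectI conjI ballI)
  show "orbit_product G i \<in> poly_ring n"
    by (auto simp: orbit_product_eq intro!: polys_in_prod lsub_in_poly_ring)
  fix M assume M: "M \<in> G"
  let ?O = "(\<lambda>N. lsub n N (mvar i)) ` G"
  obtain M' where M': "M' \<in> G" "\<forall>f\<in>poly_ring n. lsub n M' (lsub n M f) = f"
    using lsub_inverse[OF M] by (elim bexE)
  have inj: "inj_on (lsub n M) ?O"
  proof (rule inj_on_inverseI)
    fix y assume "y \<in> ?O"
    then show "lsub n M' (lsub n M y) = y"
      by (auto intro!: M'(2)[rule_format] lsub_in_poly_ring)
  qed
  have "lsub n M (orbit_product G i) = (\<Prod>y\<in>?O. lsub n M y)"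
    by (simp add: orbit_product_eq lsub.hom_prod)
  also have "\<dots> = (\<Prod>y\<in>lsub n M ` ?O. y)"
    by (simp add: prod.reindex[OF inj])
  also have "lsub n M ` ?O = ?O"
    using i by (intro orbit_invariant M) simp
  finally show "lsub n M (orbit_product G i) = orbit_product G i"
    by (simp add: orbit_product_eq)
qed

lemma invariant_field_eq: "invariant_field n G =
  {Fract a b | a b. a \<in> poly_ring n \<and> b \<in> poly_ring n \<and> b \<noteq> 0 \<and>
     (\<forall>N\<in>G. Fract (lsub n N a) (lsub n N b) = Fract a b)}"
proof -
  have "(\<forall>g\<in>G. Fract (act g a) (act g b) = Fract a b)
    \<longleftrightarrow> (\<forall>\<sigma>\<in>act ` G. Fract (\<sigma> a) (\<sigma> b) = Fract a b)" for a b
    by blast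
  then show ?thesis
    unfolding invariant_field_def act_image by simp
qed

text \<open>Multiplying numerator and denominator by the conjugates of the denominator makes both invariant.\<close>

lemma invariant_field_eq_quot_field:
  assumes fin: "finite G"
  shows "invariant_field n G = quot_field (invariant_ring n G)"
proof (intro equalityI subsetI)
  fix x assume "x \<in> quot_field (invariant_ring n G)"
  then obtain a b where "x = Fract a b" "a \<in> invariant_ring n G" "b \<in> invariant_ring n G" "b \<noteq> 0"
    unfolding quot_field_def by blast
  then show "x \<in> invariant_field n G"
    unfolding invariant_field_eq invariant_ring_eq by (intro CollectI exI[of _ a] exI[of _ b]) simp
next
  fix x assume "x \<in> invariant_field n G"
  then obtain a b where x: "x = Fract a b" "a \<in> poly_ring n" "b \<in> poly_ring n" "b \<noteq> 0"
    "\<And>N. N \<in> G \<Longrightarrow> Fract (lsub n N a) (lsub n N b) = Fract a b"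
    unfolding invariant_field_eq by blast
  define c where "c = (\<Prod>N\<in>G - {1\<^sub>m n}. lsub n N b)"
  define b' where "b' = (\<Prod>N\<in>G. lsub n N b)"
  have b': "b' = b * c"
    using fin group_one x(3) by (simp add: b'_def c_def prod.remove[of G "1\<^sub>m n"] lsub_one)
  have b'0: "b' \<noteq> 0"
    using fin x by (simp add: b'_def lsub_eq_0_iff)
  have in_ring: "c \<in> poly_ring n" "b' \<in> poly_ring n"
    by (auto simp: c_def b'_def intro!: polys_in_prod lsub_in_poly_ring)
  have b'_inv: "lsub n N b' = b'" if "N \<in> G" for N
    unfolding b'_def using that x by (intro prod_over_group_invariant)
  have "lsub n N (a * c) = a * c" if N: "N \<in> G" for N
  proof -
    have nz: "lsub n N b \<noteq> 0"
      using N x by (simp add: lsub_eq_0_iff)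
    have a: "lsub n N a * b = a * lsub n N b"
      using x(5)[OF N] x(4) nz by (simp add: eq_fract)
    have c: "lsub n N c * lsub n N b = b * c"
      using b'_inv[OF N] unfolding b' by (simp add: lsub.hom_mult mult.commute)
    have "lsub n N (a * c) * lsub n N b = lsub n N a * (lsub n N c * lsub n N b)"
      by (simp only: lsub.hom_mult mult.assoc)
    also have "\<dots> = (lsub n N a * b) * c"
      by (simp only: c mult.assoc)
    also have "\<dots> = a * c * lsub n N b"
      unfolding a by (simp only: mult_ac)
    finally have "lsub n N (a * c) * lsub n N b = a * c * lsub n N b" .
    with nz show ?thesis by simp
  qed
  then have "a * c \<in> invariant_ring n G" "b' \<in> invariant_ring n G"
    using in_ring x b'_inv by (auto simp: invariant_ring_eq)
  moreover have "x = Fract (a * c) b'"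
    using x b'0 unfolding b' by (simp add: eq_fract)
  ultimately show "x \<in> quot_field (invariant_ring n G)"
    using b'0 by (intro quot_fieldI[of "a * c" _ b']) (simp_all add: Fract_conv_to_fract)
qed

end

section \<open>Leading monomials with respect to integer weights\<close>

section \<open>Algebraic independence from leading monomials\<close>

text \<open>Weights may be negative and distinct monomials may tie; a leading monomial is required
  to beat all other terms strictly.\<close>

definition weight :: "(nat \<Rightarrow> int) \<Rightarrow> (nat \<Rightarrow>\<^sub>0 nat) \<Rightarrow> int" where
  "weight \<omega> m = (\<Sum>i\<in>Poly_Mapping.keys m. int (Poly_Mapping.lookup m i) * \<omega> i)"

lemma weight_superset:
  "finite S \<Longrightarrow> Poly_Mapping.keys m \<subseteq> S \<Longrightarrow> weight \<omega> m = (\<Sum>i\<in>S. int (Poly_Mapping.lookup m i) * \<omega> i)"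
  unfolding weight_def by (intro sum.mono_neutral_left) (auto simp: in_keys_iff)

lemma weight_add: "weight \<omega> (m + m') = weight \<omega> m + weight \<omega> m'"
proof -
  let ?S = "Poly_Mapping.keys m \<union> Poly_Mapping.keys m'"
  have "finite ?S" by simp
  note * = weight_superset[OF this, of _ \<omega>]
  show ?thesis
    unfolding *[OF Poly_Mapping.keys_add] *[OF Un_upper1] *[OF Un_upper2]
    by (simp add: lookup_add distrib_right sum.distrib)
qed

lemma weight_single [simp]: "weight \<omega> (Poly_Mapping.single i e) = int e * \<omega> i"
  by (simp add: weight_def)

definition below :: "(nat \<Rightarrow> int) \<Rightarrow> int \<Rightarrow> (nat, 'a::comm_ring_1) mvpoly set" where
  "below \<omega> w = {f. \<forall>m\<in>Poly_Mapping.keys f. weight \<omega> m < w}"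

lemma below_0 [simp]: "0 \<in> below \<omega> w"
  by (simp add: below_def)

lemma below_add: "f \<in> below \<omega> w \<Longrightarrow> g \<in> below \<omega> w \<Longrightarrow> f + g \<in> below \<omega> w"
  using Poly_Mapping.keys_add[of f g] unfolding below_def by blast

lemma below_uminus: "f \<in> below \<omega> w \<Longrightarrow> - f \<in> below \<omega> w"
  unfolding below_def by (simp add: in_keys_iff)

lemma below_diff: "f \<in> below \<omega> w \<Longrightarrow> g \<in> below \<omega> w \<Longrightarrow> f - g \<in> below \<omega> w"
  using below_add[of f \<omega> w "- g", OF _ below_uminus] by simp

lemma below_sum: "(\<And>i. i \<in> I \<Longrightarrow> f i \<in> below \<omega> w) \<Longrightarrow> (\<Sum>i\<in>I. f i) \<in> below \<omega> w"
  by (induction I rule: infinite_finite_induct) (simp_all add: below_add)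

lemma below_mono: "w \<le> w' \<Longrightarrow> f \<in> below \<omega> w \<Longrightarrow> f \<in> below \<omega> w'"
  unfolding below_def by auto

lemma below_single: "weight \<omega> m < w \<Longrightarrow> Poly_Mapping.single m c \<in> below \<omega> w"
  by (simp add: below_def)

text \<open>Over the integers each strict inequality leaves a gap of one, so the sum bound improves
  by one. In \<open>has_lead_mult\<close> this absorbs the bound
  \<open>weight \<omega> \<mu> + 1\<close> of a factor containing its leading term.\<close>

lemma below_mult:
  assumes "f \<in> below \<omega> w" "g \<in> below \<omega> w'"
  shows "f * g \<in> below \<omega> (w + w' - 1)"
  unfolding below_def
proof (intro CollectI ballI)
  fix m assume "m \<in> Poly_Mapping.keys (f * g)"
  then obtain a b where m: "m = a + b" "a \<in> Poly_Mapping.keys f" "b \<in> Poly_Mapping.keys g"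
    using Poly_Mapping.keys_mult[of f g] by blast
  then have "weight \<omega> a < w" "weight \<omega> b < w'"
    using assms by (auto simp: below_def)
  then show "weight \<omega> m < w + w' - 1"
    by (simp add: m weight_add)
qed

lemma lookup_below: "f \<in> below \<omega> w \<Longrightarrow> w \<le> weight \<omega> m \<Longrightarrow> Poly_Mapping.lookup f m = 0"
  unfolding below_def by (metis (no_types, lifting) in_keys_iff mem_Collect_eq not_less)

text \<open>The leading monomial is \<open>\<mu>\<close>, with coefficient 1.\<close>

definition has_lead :: "(nat \<Rightarrow> int) \<Rightarrow> (nat, 'a::comm_ring_1) mvpoly \<Rightarrow> (nat \<Rightarrow>\<^sub>0 nat) \<Rightarrow> bool" where
  "has_lead \<omega> f \<mu> \<longleftrightarrow> f - Poly_Mapping.single \<mu> 1 \<in> below \<omega> (weight \<omega> \<mu>)"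

lemma has_lead_1: "has_lead \<omega> 1 0"
  by (simp add: has_lead_def)

lemma has_lead_mult:
  assumes "has_lead \<omega> f \<mu>" "has_lead \<omega> g \<nu>"
  shows "has_lead \<omega> (f * g) (\<mu> + \<nu>)"
proof -
  let ?M = "Poly_Mapping.single \<mu> 1 :: (nat, 'a) mvpoly" and ?N = "Poly_Mapping.single \<nu> 1 :: (nat, 'a) mvpoly"
  have g: "g \<in> below \<omega> (weight \<omega> \<nu> + 1)"
    using below_add[OF below_mono[of _ "weight \<omega> \<nu> + 1", OF _ assms(2)[unfolded has_lead_def]]
        below_single[of \<omega> \<nu> "weight \<omega> \<nu> + 1" 1]] by simp
  have "?M * (g - ?N) \<in> below \<omega> (weight \<omega> (\<mu> + \<nu>))"
    using below_mult[OF below_single[of \<omega> \<mu> "weight \<omega> \<mu> + 1" 1] assms(2)[unfolded has_lead_def]]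
    by (simp add: weight_add)
  moreover have "(f - ?M) * g \<in> below \<omega> (weight \<omega> (\<mu> + \<nu>))"
    using below_mult[OF assms(1)[unfolded has_lead_def] g] by (simp add: weight_add)
  ultimately have "?M * (g - ?N) + (f - ?M) * g \<in> below \<omega> (weight \<omega> (\<mu> + \<nu>))"
    by (rule below_add)
  moreover have "?M * (g - ?N) + (f - ?M) * g = f * g - ?M * ?N"
    by (simp add: algebra_simps)
  ultimately show ?thesis
    by (simp add: has_lead_def mult_single)
qed

lemma has_lead_prod:
  "(\<And>i. i \<in> I \<Longrightarrow> has_lead \<omega> (f i) (\<mu> i)) \<Longrightarrow> has_lead \<omega> (\<Prod>i\<in>I. f i) (\<Sum>i\<in>I. \<mu> i)"
  by (induction I rule: infinite_finite_induct) (simp_all add: has_lead_1 has_lead_mult)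

lemma has_lead_power: "has_lead \<omega> f \<mu> \<Longrightarrow> has_lead \<omega> (f ^ e) (\<Sum>_\<in>{..<e}. \<mu>)"
  using has_lead_prod[of "{..<e}" \<omega> "\<lambda>_. f" "\<lambda>_. \<mu>"] by simp

lemma has_lead_unique:
  fixes f :: "(nat, 'a::comm_ring_1) mvpoly"
  assumes "has_lead \<omega> f \<mu>" "has_lead \<omega> f \<nu>"
  shows "\<mu> = \<nu>"
proof -
  have *: "\<mu> = \<nu>" if "has_lead \<omega> f \<mu>" "has_lead \<omega> f \<nu>" "weight \<omega> \<nu> \<le> weight \<omega> \<mu>" for \<mu> \<nu>
  proof (rule ccontr)
    assume "\<mu> \<noteq> \<nu>"
    have "Poly_Mapping.lookup (f - Poly_Mapping.single \<mu> 1) \<mu> = 0"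
      "Poly_Mapping.lookup (f - Poly_Mapping.single \<nu> 1) \<mu> = 0"
      using that lookup_below unfolding has_lead_def by blast+
    with \<open>\<mu> \<noteq> \<nu>\<close> show False
      by (simp add: lookup_minus lookup_single when_def)
  qed
  then show ?thesis
    using assms by (metis linear)
qed

lemma lookup_mconst_mult: "Poly_Mapping.lookup (mconst c * p) m = c * Poly_Mapping.lookup p m"
  unfolding mconst_def mult_map_scale_conv_mult[symmetric] by (simp add: Poly_Mapping.map.rep_eq when_def)

lemma to_fract_hom: "comm_semiring_hom (to_fract :: 'r::idom \<Rightarrow> 'r fract)"
  by unfold_locales simp_all

interpretation to_fract: comm_semiring_hom "to_fract :: 'r::idom \<Rightarrow> 'r fract"
  by (rule to_fract_hom)

text \<open>Here \<open>e i * lookup (\<mu> i) j\<close> summed over \<open>i\<close> is the exponent of the \<open>j\<close>-th variable in the leading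
  monomial of \<open>\<Prod>i<n. b i ^ e i\<close>.\<close>

lemma algebraically_independent_leading:
  fixes b :: "nat \<Rightarrow> (nat, 'a::field) mvpoly"
  assumes lead: "\<And>i. i < n \<Longrightarrow> has_lead \<omega> (b i) (\<mu> i)"
    and inj: "\<And>e e' :: nat \<Rightarrow> nat. \<forall>j. (\<Sum>i<n. e i * Poly_Mapping.lookup (\<mu> i) j)
        = (\<Sum>i<n. e' i * Poly_Mapping.lookup (\<mu> i) j) \<Longrightarrow> \<forall>i<n. e i = e' i"
  shows "algebraically_independent (to_fract ` b ` {..<n})"
  unfolding algebraically_independent_def
proof (intro allI impI)
  fix f :: "('a ratfun, 'a) mvpoly"
  let ?B = "to_fract ` b ` {..<n}"
  assume f: "f \<in> polys_in ?B" and 0: "meval fconst (\<lambda>b. b) f = 0"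
  define \<nu> where "\<nu> e = (\<Sum>i<n. \<Sum>_\<in>{..<e i}. \<mu> i)" for e :: "nat \<Rightarrow> nat"
  have lookup_\<nu>: "Poly_Mapping.lookup (\<nu> e) j = (\<Sum>i<n. e i * Poly_Mapping.lookup (\<mu> i) j)" for e j
    unfolding \<nu>_def lookup_sum by simp
  have \<nu>_inj: "\<forall>i<n. e i = e' i" if "\<nu> e = \<nu> e'" for e e'
    using that by (intro inj) (simp flip: lookup_\<nu>)
  have lead': "has_lead \<omega> (monomial n b e) (\<nu> e)" for e
    unfolding \<nu>_def by (intro has_lead_prod has_lead_power lead) simp
  \<comment> \<open>The elements serve as their own variable names, so repetitions must be excluded:
    equal elements would have equal leading monomials, contradicting \<open>inj\<close> on unit
    exponent vectors.\<close>
  have inj_b: "inj_on (\<lambda>i. to_fract (b i)) {..<n}"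
  proof
    fix i j assume ij: "i \<in> {..<n}" "j \<in> {..<n}" and "to_fract (b i) = to_fract (b j)"
    then have "\<mu> i = \<mu> j"
      using has_lead_unique[of \<omega> "b j" "\<mu> i" "\<mu> j"] lead[of i] lead[of j] by simp
    then have "\<forall>i'<n. (if i' = i then 1 else 0) = (if i' = j then 1 else (0 :: nat))"
      using ij by (intro inj) (simp add: if_distrib[of "\<lambda>x. x * _"] cong: if_cong)
    then have "(if i = i then 1 else 0) = (if i = j then 1 else (0 :: nat))"
      using ij by blast
    then show "i = j"
      by (simp split: if_splits)
  qed
  define e where "e m i = Poly_Mapping.lookup m (to_fract (b i))" for m :: "'a ratfun \<Rightarrow>\<^sub>0 nat" and i
  have "(\<Prod>x\<in>Poly_Mapping.keys m. x ^ Poly_Mapping.lookup m x) = to_fract (monomial n b (e m))"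
    if "m \<in> Poly_Mapping.keys f" for m
  proof -
    have "(\<Prod>x\<in>Poly_Mapping.keys m. x ^ Poly_Mapping.lookup m x) = (\<Prod>x\<in>?B. x ^ Poly_Mapping.lookup m x)"
      using f that by (intro prod.mono_neutral_left) (auto simp: polys_in_def in_keys_iff)
    also have "\<dots> = (\<Prod>i<n. to_fract (b i) ^ e m i)"
      unfolding image_image by (subst prod.reindex[OF inj_b]) (simp add: e_def)
    finally show ?thesis
      by (simp add: to_fract.hom_prod to_fract.hom_power)
  qed
  then have "meval fconst (\<lambda>b. b) f
      = to_fract (\<Sum>m\<in>Poly_Mapping.keys f. mconst (Poly_Mapping.lookup f m) * monomial n b (e m))"
    by (simp add: meval_def to_fract.hom_sum fconst_def)
  with 0 have eq0: "(\<Sum>m\<in>Poly_Mapping.keys f. mconst (Poly_Mapping.lookup f m) * monomial n b (e m)) = 0"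
    by (simp only: to_fract_eq_0_iff)
  show "f = 0"
  proof (rule ccontr)
    assume "f \<noteq> 0"
    let ?K = "Poly_Mapping.keys f" and ?w = "\<lambda>m. weight \<omega> (\<nu> (e m))"
    \<comment> \<open>Choose a term whose leading monomial has maximal weight. The other terms have
      different leading monomials by injectivity and nothing else that heavy, so its coefficient
      survives alone.\<close>
    have "?K \<noteq> {}"
      using \<open>f \<noteq> 0\<close> by simp
    then have "Max (?w ` ?K) \<in> ?w ` ?K"
      by (intro Max_in) auto
    then obtain m where m: "m \<in> ?K" "?w m = Max (?w ` ?K)"
      by (elim imageE) (rule that, assumption, simp)
    have max: "?w m' \<le> ?w m" if "m' \<in> ?K" for m'
      unfolding m(2) using that by (intro Max_ge) auto
    have lookup: "Poly_Mapping.lookup (mconst c * monomial n b (e m')) (\<nu> (e m)) = (if m' = m then c else 0)"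
      if m': "m' \<in> ?K" for m' c
    proof -
      have "Poly_Mapping.lookup (monomial n b (e m') - Poly_Mapping.single (\<nu> (e m')) 1) (\<nu> (e m)) = 0"
        using lead'[of "e m'"] max[OF m'] unfolding has_lead_def by (rule lookup_below)
      moreover have "m' = m" if "\<nu> (e m') = \<nu> (e m)"
      proof (rule poly_mapping_eqI)
        fix x
        have sub: "Poly_Mapping.keys m' \<subseteq> ?B" "Poly_Mapping.keys m \<subseteq> ?B"
          using f m m' by (auto simp: polys_in_def)
        show "Poly_Mapping.lookup m' x = Poly_Mapping.lookup m x"
        proof (cases "x \<in> ?B")
          case True
          then obtain i where "i < n" "x = to_fract (b i)" by auto
          then show ?thesis
            using \<nu>_inj[OF that] by (simp add: e_def)
        next
          case False
          with sub have "x \<notin> Poly_Mapping.keys m'" "x \<notin> Poly_Mapping.keys m" by auto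
          then show ?thesis by (simp add: in_keys_iff)
        qed
      qed
      ultimately have "Poly_Mapping.lookup (monomial n b (e m')) (\<nu> (e m)) = (if m' = m then 1 else 0)"
        by (auto simp: lookup_minus lookup_single when_def)
      then show ?thesis
        by (simp add: lookup_mconst_mult)
    qed
    have "Poly_Mapping.lookup f m = (\<Sum>m'\<in>?K. if m' = m then Poly_Mapping.lookup f m' else 0)"
      using m by simp
    also have "\<dots> = Poly_Mapping.lookup (\<Sum>m\<in>?K. mconst (Poly_Mapping.lookup f m) * monomial n b (e m)) (\<nu> (e m))"
      unfolding lookup_sum by (intro sum.cong) (simp_all add: lookup)
    also have "\<dots> = 0"
      by (simp add: eq0)
    finally show False
      using m by (simp add: in_keys_iff)
  qed
qed

section \<open>Cartan formula, invariance of Steenrod images, and the sequence of forms they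
  produce\<close>

section \<open>Steenrod operations\<close>

lemma steenrod_const_hom: "comm_semiring_hom (\<lambda>c. fps_const (mconst c))"
  by unfold_locales (simp_all add: mconst.hom_add mconst.hom_mult flip: fps_const_add fps_const_mult)

lemma steenrod_series_hom: "comm_semiring_hom (steenrod_series :: (nat, 'a::finite_field) mvpoly \<Rightarrow> _)"
  unfolding steenrod_series_def by (rule meval_hom[OF steenrod_const_hom])

interpretation St: comm_ring_hom "steenrod_series :: (nat, 'a::finite_field) mvpoly \<Rightarrow> _"
  by (intro comm_ring_hom.intro ring_hom.intro comm_semiring_hom.axioms(1)[OF steenrod_series_hom])

lemma steenrod_series_mconst [simp]: "steenrod_series (mconst c) = fps_const (mconst c)"
  unfolding steenrod_series_def by (rule meval_mconst[OF steenrod_const_hom])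

lemma steenrod_series_mvar: "steenrod_series (mvar j :: (nat, 'a::finite_field) mvpoly)
    = fps_const (mvar j) + fps_const (mvar j ^ CARD('a)) * fps_X"
  unfolding steenrod_series_def by (rule meval_mvar[OF steenrod_const_hom])

lemma steenrod_op_add: "steenrod_op i (f + g) = steenrod_op i f + steenrod_op i g"
  by (simp add: steenrod_op_def St.hom_add)

lemma steenrod_op_sum: "steenrod_op i (\<Sum>a\<in>S. f a) = (\<Sum>a\<in>S. steenrod_op i (f a))"
  by (simp add: steenrod_op_def St.hom_sum fps_sum_nth)

lemma steenrod_op_scale: "steenrod_op i (mconst c * f) = mconst c * steenrod_op i f"
  by (simp add: steenrod_op_def St.hom_mult)

lemma steenrod_op_mult: "steenrod_op i (f * g) = (\<Sum>j=0..i. steenrod_op j f * steenrod_op (i - j) g)"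
  by (simp add: steenrod_op_def St.hom_mult fps_mult_nth)

lemma steenrod_op_mconst: "steenrod_op i (mconst c) = (if i = 0 then mconst c else 0)"
  by (simp add: steenrod_op_def)

lemma steenrod_op_mvar: "steenrod_op i (mvar j :: (nat, 'a::finite_field) mvpoly)
    = (if i = 0 then mvar j else if i = 1 then mvar j ^ CARD('a) else 0)"
  by (simp add: steenrod_op_def steenrod_series_mvar)

lemma steenrod_op_polys_in: "f \<in> polys_in I \<Longrightarrow> steenrod_op i f \<in> polys_in I"
proof (induction arbitrary: i rule: polys_in_induct)
  case (mult f g)
  show ?case
    unfolding steenrod_op_mult by (rule polys_in_sum, rule polys_in_mult) (rule mult.IH)+
qed (simp_all add: steenrod_op_mconst steenrod_op_mvar steenrod_op_add polys_in_add polys_in_power)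

text \<open>The \<open>r\<close>-th power map is linear over the field with \<open>r\<close> elements, so Steenrod operations
  commute with linear substitutions.\<close>

lemma lsub_steenrod_op:
  fixes f :: "(nat, 'a::finite_field) mvpoly"
  assumes frob: "\<And>f g :: (nat, 'a) mvpoly. (f + g) ^ CARD('a) = f ^ CARD('a) + g ^ CARD('a)"
  shows "lsub n N (steenrod_op i f) = steenrod_op i (lsub n N f)"
proof (induction f arbitrary: i rule: mvpoly_induct)
  case (mvar j)
  have "CARD('a) > 0" by simp
  then show ?case
    by (simp add: steenrod_op_mvar lsub_mvar steenrod_op_sum steenrod_op_scale lsub.hom_power frob_sum[OF _ frob]
        power_mult_distrib finite_field_power_card_eq_same flip: mconst.hom_power)
next
  case (mult f g)
  then show ?case
    by (simp add: steenrod_op_mult lsub.hom_sum lsub.hom_mult)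
qed (simp_all add: steenrod_op_mconst steenrod_op_add lsub.hom_add)

lemma steenrod_images_invariant:
  fixes h :: "(nat, 'a::finite_field) mvpoly"
  assumes frob: "\<And>f g :: (nat, 'a) mvpoly. (f + g) ^ CARD('a) = f ^ CARD('a) + g ^ CARD('a)"
    and G: "matrix_group n G" and h: "h \<in> poly_ring n" "\<And>N. N \<in> G \<Longrightarrow> lsub n N h = h"
  shows "steenrod_images h \<subseteq> invariant_ring n G"
proof -
  have "f \<in> poly_ring n \<Longrightarrow> \<theta> f \<in> poly_ring n \<and> lsub n N (\<theta> f) = \<theta> (lsub n N f)"
    if "\<theta> \<in> steenrod_algebra" for \<theta> :: "(nat, 'a) mvpoly \<Rightarrow> (nat, 'a) mvpoly" and f N
    using that
  proof (induction arbitrary: f rule: steenrod_algebra.induct)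
    case (op i)
    then show ?case
      by (simp add: steenrod_op_polys_in lsub_steenrod_op[OF frob])
  qed (simp_all add: polys_in_add polys_in_mult lsub.hom_add lsub.hom_mult)
  with h show ?thesis
    by (auto simp: steenrod_images_def invariant_ring_eq[OF G])
qed

lemma steenrod_op_in_images: "f \<in> steenrod_images h \<Longrightarrow> steenrod_op i f \<in> steenrod_images h"
  unfolding steenrod_images_def using steenrod_algebra.comp[OF steenrod_algebra.op[of i]]
  by (auto simp: comp_def intro: exI[of _ "\<lambda>f. steenrod_op i (_ f)"])

lemma steenrod_op_0: "steenrod_op 0 f = f"
  by (induction f rule: mvpoly_induct)
     (simp_all add: steenrod_op_mconst steenrod_op_mvar steenrod_op_add steenrod_op_mult)

lemma in_steenrod_images: "h \<in> steenrod_images h"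
  unfolding steenrod_images_def using steenrod_algebra.op[of 0] steenrod_op_0[of h]
  by (metis (mono_tags, lifting) mem_Collect_eq)

text \<open>\<open>Q\<close> is a power of the characteristic, so the series of y^Q is (y + y^r X)^Q
  = y^Q + y^(Qr) X^Q.\<close>

lemma steenrod_op_mvar_power:
  assumes "Q = CHAR('a) ^ e"
  shows "steenrod_op i (mvar j ^ Q :: (nat, 'a::finite_field) mvpoly)
    = (if i = 0 then mvar j ^ Q else if i = Q then mvar j ^ (Q * CARD('a)) else 0)"
proof -
  have "Q > 0"
    using assms by simp
  have "steenrod_series (mvar j ^ Q :: (nat, 'a) mvpoly)
      = fps_const (mvar j ^ Q) + fps_const (mvar j ^ (Q * CARD('a))) * fps_X ^ Q"
    using assms by (simp add: St.hom_power steenrod_series_mvar freshmans_dream'[where n = e]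
        power_mult_distrib fps_const_power mult.commute flip: power_mult)
  with \<open>Q > 0\<close> show ?thesis
    by (simp add: steenrod_op_def)
qed

lemma steenrod_op_mvar_mult_power:
  fixes i j :: nat
  assumes Q: "Q = CHAR('a) ^ e"
  shows "steenrod_op Q (mvar i * mvar j ^ Q :: (nat, 'a::finite_field) mvpoly)
    = mvar i * mvar j ^ (Q * CARD('a)) + (if Q = 1 then mvar i ^ CARD('a) * mvar j else 0)"
proof -
  have "Q > 0"
    using assms by simp
  have "steenrod_op Q (mvar i * mvar j ^ Q :: (nat, 'a) mvpoly)
      = (\<Sum>a\<in>{0, 1}. steenrod_op a (mvar i) * steenrod_op (Q - a) (mvar j ^ Q))"
    unfolding steenrod_op_mult using \<open>Q > 0\<close>
    by (intro sum.mono_neutral_right) (auto simp: steenrod_op_mvar)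
  then show ?thesis
    using \<open>Q > 0\<close> by (auto simp: steenrod_op_mvar steenrod_op_mvar_power[OF Q])
qed

text \<open>The hyperbolic part common to all the forms; the index \<open>n - 1 - i\<close> is the
  partner of \<open>i\<close>.\<close>

definition bilin :: "nat \<Rightarrow> nat \<Rightarrow> nat \<Rightarrow> 'a::comm_ring_1 \<Rightarrow> (nat, 'a) mvpoly" where
  "bilin n k Q \<epsilon> = (\<Sum>i<k. mvar i * mvar (n - 1 - i) ^ Q + mconst \<epsilon> * (mvar (n - 1 - i) * mvar i ^ Q))"

text \<open>The operation of index Q raises y_i^Q to y_i^(Qr) and leaves x_i alone. For Q = 1 the
  two factors are symmetric, and the Cartan formula also yields x_i^r y_i, so a quadratic form turns
  into one with \<epsilon> = 1.\<close>

lemma steenrod_op_bilin: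
  assumes Q: "Q = CHAR('a) ^ e" and \<epsilon>: "Q = 1 \<Longrightarrow> \<epsilon> = 0"
  shows "steenrod_op Q (bilin n k Q \<epsilon> :: (nat, 'a::finite_field) mvpoly)
    = bilin n k (Q * CARD('a)) (if Q = 1 then 1 else \<epsilon>)"
  unfolding bilin_def steenrod_op_sum steenrod_op_add steenrod_op_scale steenrod_op_mvar_mult_power[OF Q]
  using \<epsilon> by (intro sum.cong) (auto simp: mult.commute)

text \<open>Iterate \<open>steenrod_op_bilin\<close>, each time with the current exponent as index.
  Of the middle summand only the variables matter, since Steenrod operations introduce no new
  ones.\<close>

lemma steenrod_sequence:
  fixes h \<mu> :: "(nat, 'a::finite_field) mvpoly"
  assumes r: "CARD('a) = CHAR('a) ^ e" and \<delta>: "\<delta> = CHAR('a) ^ d" and \<epsilon>: "\<delta> = 1 \<Longrightarrow> \<epsilon> = 0"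
    and h: "h = bilin n k \<delta> \<epsilon> + \<mu>" and \<mu>: "\<mu> \<in> polys_in I"
  shows "\<exists>f\<in>steenrod_images h. \<exists>\<epsilon>. \<exists>\<mu>\<in>polys_in I. f = bilin n k (\<delta> * CARD('a) ^ j) \<epsilon> + \<mu>
    \<and> (\<delta> * CARD('a) ^ j = 1 \<longrightarrow> \<epsilon> = 0)"
proof (induction j)
  case 0
  show ?case
    using h \<mu> \<epsilon> in_steenrod_images[of h] by auto
next
  case (Suc j)
  let ?Q = "\<delta> * CARD('a) ^ j"
  have r2: "CARD('a) \<ge> 2"
    using card_mono[of "UNIV :: 'a set" "{0, 1}"] by simp
  have Q: "?Q = CHAR('a) ^ (d + e * j)"
    by (simp add: \<delta> r power_add power_mult)
  obtain f \<epsilon>' \<mu>' where f: "f \<in> steenrod_images h" "\<mu>' \<in> polys_in I" "f = bilin n k ?Q \<epsilon>' + \<mu>'"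
    "?Q = 1 \<Longrightarrow> \<epsilon>' = 0"
    using Suc by blast
  have "steenrod_op ?Q f = bilin n k (\<delta> * CARD('a) ^ Suc j) (if ?Q = 1 then 1 else \<epsilon>') + steenrod_op ?Q \<mu>'"
    unfolding f(3) steenrod_op_add by (subst steenrod_op_bilin[OF Q f(4)]) (simp_all add: mult_ac)
  moreover have "\<delta> * CARD('a) ^ Suc j \<noteq> 1"
    using r2 by simp
  ultimately show ?case
    using steenrod_op_in_images[OF f(1)] steenrod_op_polys_in[OF f(2)] by blast
qed

section \<open>The theorem for an abstract group of unitriangular isometries that is large
  enough\<close>

section \<open>Generators of the invariant field\<close>

lemma single_1_eq_iff: "Poly_Mapping.single a (Suc 0) = Poly_Mapping.single j (Suc 0) \<longleftrightarrow> a = j"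
  by (auto dest: arg_cong[where f = Poly_Mapping.keys])

lemma lookup_linear_form:
  fixes t j :: nat
  shows "Poly_Mapping.lookup (\<Sum>a<t. mconst (c a) * mvar a) (Poly_Mapping.single j 1) = (if j < t then c j else 0)"
proof -
  have "Poly_Mapping.lookup (mconst (c a) * mvar a) (Poly_Mapping.single j 1) = (if a = j then c a else 0)" for a
    by (auto simp: lookup_mconst_mult mvar_def lookup_single when_def single_1_eq_iff)
  then show ?thesis
    by (simp add: lookup_sum)
qed

lemma mvar_plus_linear_form_nonzero:
  "mvar j + (\<Sum>a<j. mconst (c a) * mvar a) \<noteq> (0 :: (nat, 'a::field) mvpoly)"
proof
  assume "mvar j + (\<Sum>a<j. mconst (c a) * mvar a) = 0"
  then have "Poly_Mapping.lookup (mvar j + (\<Sum>a<j. mconst (c a) * mvar a)) (Poly_Mapping.single j 1) = 0"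
    by simp
  then show False
    unfolding lookup_add lookup_linear_form by (simp add: mvar_def)
qed

lemma addpoly_mvar_nonzero:
  assumes frob: "\<And>f g :: (nat, 'a::finite_field) mvpoly. (f + g) ^ CARD('a) = f ^ CARD('a) + g ^ CARD('a)"
  shows "addpoly CARD('a) mvar j (mvar j :: (nat, 'a) mvpoly) \<noteq> 0"
proof (induction j rule: less_induct)
  case (less j)
  have "addpoly CARD('a) mvar j (mvar j)
      = (\<Prod>c\<in>(\<Pi>\<^sub>E i\<in>{..<j}. (UNIV :: 'a set)). mvar j + (\<Sum>i<j. mconst (c i) * mvar i))"
    by (rule prod_span_eq_addpoly[symmetric]) (fact frob, fact less)
  moreover have "finite (\<Pi>\<^sub>E i\<in>{..<j}. (UNIV :: 'a set))"
    by (intro finite_PiE) simp_all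
  ultimately show ?case
    by (simp add: mvar_plus_linear_form_nonzero)
qed

text \<open>In the y-variables the terms \<epsilon> y_i x_i^Q have degree 1 and \<mu> has degree 0.
  Both are below Q, except that y_i has degree Q when Q = 1; then \<epsilon> = 0.\<close>

lemma low_degree_bilin:
  fixes \<mu> :: "(nat, 'a::comm_ring_1) mvpoly"
  assumes \<mu>: "\<mu> \<in> polys_in {..<k + l}" and Q: "Q > 0" "Q = 1 \<Longrightarrow> \<epsilon> = 0"
  shows "bilin n k Q \<epsilon> + \<mu> - (\<Sum>i<k. mvar i * mvar (n - 1 - i) ^ Q)
    \<in> low_degree (polys_in {..<k + l}) k (\<lambda>i. mvar (n - 1 - i)) Q"
proof -
  let ?L = "low_degree (polys_in {..<k + l}) k (\<lambda>i. mvar (n - 1 - i) :: (nat, 'a) mvpoly) Q"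
  have "mconst \<epsilon> * (mvar (n - 1 - i) * mvar i ^ Q) \<in> ?L" if i: "i < k" for i
  proof (cases "Q = 1")
    case True
    with Q show ?thesis
      by (simp add: low_degree.zero)
  next
    case False
    have "(mconst \<epsilon> * mvar i ^ Q) * monomial k (\<lambda>i. mvar (n - 1 - i)) (\<lambda>j. if j = i then 1 else 0) \<in> ?L"
      using i False Q by (intro low_degree.monom) (auto intro!: polys_in_mult polys_in_power)
    moreover have "monomial k (\<lambda>i. mvar (n - 1 - i)) (\<lambda>j. if j = i then 1 else 0)
        = (\<Prod>j<k. if j = i then mvar (n - 1 - j) else (1 :: (nat, 'a) mvpoly))"
      by (intro prod.cong) auto
    ultimately show ?thesis
      using i by (simp add: mult_ac)
  qed
  then have "(\<Sum>i<k. mconst \<epsilon> * (mvar (n - 1 - i) * mvar i ^ Q)) \<in> ?L"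
    by (intro low_degree_sum) simp
  moreover have "\<mu> \<in> ?L"
    using low_degree.monom[OF \<mu>, of "\<lambda>_. 0" k Q] Q by simp
  ultimately have "(\<Sum>i<k. mconst \<epsilon> * (mvar (n - 1 - i) * mvar i ^ Q)) + \<mu> \<in> ?L"
    by (rule low_degree.add)
  then show ?thesis
    by (simp add: bilin_def sum.distrib)
qed

text \<open>For variable weights \<open>- Q\<^sub>a\<^sup>2\<close> and \<open>2 * Q\<^sub>a\<close> of the two variables in the \<open>a\<close>-th product, its weight in the form with
  exponent \<open>Q\<^sub>s\<close> is \<open>Q\<^sub>s\<^sup>2 - (Q\<^sub>s - Q\<^sub>a)\<^sup>2\<close>, so that different forms are dominated by
  different products.\<close>

lemma has_lead_bilin:
  fixes \<mu> :: "(nat, 'a::comm_ring_1) mvpoly" and Q :: "nat \<Rightarrow> nat"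
  assumes n: "n = 2 * k + l" and \<mu>: "\<mu> \<in> polys_in {k..<k + l}"
    and Q: "strict_mono Q" "\<And>s. Q s > 0" and \<epsilon>: "Q s = 1 \<Longrightarrow> \<epsilon> = 0"
    and \<omega>: "\<omega> = (\<lambda>i. if i < k then - (int (Q (k - 1 - i)))\<^sup>2 else if i < k + l then 0 else 2 * int (Q (i - (k + l))))"
    and s: "s < k"
  shows "has_lead \<omega> (bilin n k (Q s) \<epsilon> + \<mu>)
    (Poly_Mapping.single (k - 1 - s) 1 + Poly_Mapping.single (k + l + s) (Q s))"
proof -
  let ?p = "\<lambda>a. Poly_Mapping.single a 1 + Poly_Mapping.single (n - 1 - a) (Q s)"
  let ?q = "\<lambda>a. Poly_Mapping.single (n - 1 - a) 1 + Poly_Mapping.single a (Q s)"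
  let ?w = "(int (Q s))\<^sup>2"
  let ?R = "\<lambda>a. int (Q (k - 1 - a))"
  have wx: "\<omega> a = - (?R a)\<^sup>2" "\<omega> (n - 1 - a) = 2 * ?R a" if "a < k" for a
  proof -
    have "n - 1 - a - (k + l) = k - 1 - a" "\<not> n - 1 - a < k + l"
      using that n by auto
    with that show "\<omega> a = - (?R a)\<^sup>2" "\<omega> (n - 1 - a) = 2 * ?R a"
      by (simp_all add: \<omega>)
  qed
  have p: "mvar a * mvar (n - 1 - a) ^ Q s = (Poly_Mapping.single (?p a) 1 :: (nat, 'a) mvpoly)"
    and q: "mvar (n - 1 - a) * mvar a ^ Q s = (Poly_Mapping.single (?q a) 1 :: (nat, 'a) mvpoly)" for a
    unfolding mvar_power by (simp_all add: mvar_def mult_single)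
  have wp: "weight \<omega> (?p a) = ?w - (int (Q s) - ?R a)\<^sup>2" if "a < k" for a
    using wx[OF that] by (simp add: weight_add power2_eq_square algebra_simps)
  define b where "b = k - 1 - s"
  have b: "b < k" "k - 1 - b = s" "n - 1 - b = k + l + s"
    using s n by (auto simp: b_def)
  have wb: "weight \<omega> (?p b) = ?w"
    using wp[OF b(1)] b(2) by simp
  have "(Poly_Mapping.single (?p a) 1 :: (nat, 'a) mvpoly) \<in> below \<omega> ?w" if "a < k" "a \<noteq> b" for a
  proof (rule below_single)
    have "k - 1 - a \<noteq> s"
      using that s by (auto simp: b_def)
    then have "Q (k - 1 - a) \<noteq> Q s"
      using strict_mono_eq[OF Q(1)] by simp
    then show "weight \<omega> (?p a) < ?w"
      using wp[OF that(1)] by simp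
  qed
  then have 1: "(\<Sum>a\<in>{..<k} - {b}. Poly_Mapping.single (?p a) 1 :: (nat, 'a) mvpoly) \<in> below \<omega> ?w"
    by (intro below_sum) simp
  have "mconst \<epsilon> * (Poly_Mapping.single (?q a) 1 :: (nat, 'a) mvpoly) \<in> below \<omega> ?w" if a: "a < k" for a
  proof (cases "Q s = 1")
    case True
    with \<epsilon> show ?thesis by simp
  next
    case False
    have "?R a \<ge> 1" "int (Q s) \<ge> 2"
      using Q(2)[of "k - 1 - a"] Q(2)[of s] False by simp_all
    then have "2 * ?R a \<le> int (Q s) * (?R a * ?R a)"
      by (intro mult_mono) (simp_all add: mult_le_cancel_left1)
    moreover have "weight \<omega> (?q a) = 2 * ?R a - int (Q s) * (?R a * ?R a)"
      using wx[OF a] by (simp add: weight_add power2_eq_square)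
    moreover have "0 < ?w"
      using Q(2)[of s] by simp
    ultimately have "weight \<omega> (?q a) < ?w"
      by linarith
    then show ?thesis
      unfolding single_eq_mconst_mult[symmetric] by (rule below_single)
  qed
  then have 2: "(\<Sum>a<k. mconst \<epsilon> * Poly_Mapping.single (?q a) 1) \<in> below \<omega> ?w"
    by (intro below_sum) simp
  have 3: "\<mu> \<in> below \<omega> ?w"
    unfolding below_def
  proof (intro CollectI ballI)
    fix m assume "m \<in> Poly_Mapping.keys \<mu>"
    then have "Poly_Mapping.keys m \<subseteq> {k..<k + l}"
      using \<mu> by (auto simp: polys_in_def)
    then have "weight \<omega> m = 0"
      unfolding weight_def by (intro sum.neutral) (auto simp: \<omega>)
    then show "weight \<omega> m < ?w"
      using Q(2)[of s] by simp
  qed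
  have "bilin n k (Q s) \<epsilon> = Poly_Mapping.single (?p b) 1
      + (\<Sum>a\<in>{..<k} - {b}. Poly_Mapping.single (?p a) 1) + (\<Sum>a<k. mconst \<epsilon> * Poly_Mapping.single (?q a) 1)"
    unfolding bilin_def p q sum.distrib using b(1) by (subst sum.remove[of "{..<k}" b]) simp_all
  then have "bilin n k (Q s) \<epsilon> + \<mu> - Poly_Mapping.single (?p b) 1 \<in> below \<omega> ?w"
    using below_add[OF below_add[OF 1 2] 3] by (simp add: algebra_simps)
  then show ?thesis
    unfolding has_lead_def using wb b by (simp add: b_def)
qed

text \<open>The exponent matrix is triangular: the last k variables occur only in the leading
  monomials of the forms, which determines those exponents; what they contribute to the first k
  variables then cancels.\<close>

lemma exponents_injective:
  fixes c :: "nat \<Rightarrow> nat" and e e' :: "nat \<Rightarrow> nat"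
  assumes n: "n = 2 * k + l" and c: "\<And>i. i < n \<Longrightarrow> c i > 0"
    and \<mu>: "\<mu> = (\<lambda>i. if i < k + l then Poly_Mapping.single i (c i)
       else Poly_Mapping.single (n - 1 - i) 1 + Poly_Mapping.single i (c i))"
    and eq: "\<forall>j. (\<Sum>i<n. e i * Poly_Mapping.lookup (\<mu> i) j) = (\<Sum>i<n. e' i * Poly_Mapping.lookup (\<mu> i) j)"
  shows "\<forall>i<n. e i = e' i"
proof -
  have sum: "(\<Sum>i<n. e i * Poly_Mapping.lookup (\<mu> i) j) = e j * c j + (if j < k then e (n - 1 - j) else 0)"
    if j: "j < n" for j and e :: "nat \<Rightarrow> nat"
  proof -
    have "e i * Poly_Mapping.lookup (\<mu> i) j
        = (if i = j then e j * c j else 0) + (if i = n - 1 - j then if j < k then e (n - 1 - j) else 0 else 0)"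
      if "i < n" for i
    proof -
      have "(k + l \<le> i \<and> n - 1 - i = j) \<longleftrightarrow> (i = n - 1 - j \<and> j < k)"
        using that j n by auto
      then show ?thesis
        using that j n by (auto simp: \<mu> lookup_add lookup_single when_def)
    qed
    then show ?thesis
      using j by (simp add: sum.distrib)
  qed
  have high: "e i = e' i" if "k + l \<le> i" "i < n" for i
    using eq[rule_format, of i] c[OF that(2)] that(1) unfolding sum[OF that(2)] by simp
  show ?thesis
  proof (intro allI impI)
    fix i assume i: "i < n"
    show "e i = e' i"
    proof (cases "i < k")
      case True
      then have "e (n - 1 - i) = e' (n - 1 - i)"
        using n by (intro high) auto
      then show ?thesis
        using eq[rule_format, of i] c[OF i] True unfolding sum[OF i] by simp
    next
      case False
      then show ?thesis
        using eq[rule_format, of i] c[OF i] unfolding sum[OF i] by simp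
    qed
  qed
qed

text \<open>What the counting argument needs from the group. \<open>full\<close> makes the orbit of
  x_i the whole coset of the span of earlier variables, \<open>middle\<close> keeps the orbits of
  the middle variables within r^k elements, and \<open>large\<close> says that the group order is at
  least the product of all degree bounds.\<close>

locale form_invariants =
  fixes n k l e d \<delta> :: nat and \<epsilon> :: "'a::finite_field" and h \<mu> :: "(nat, 'a) mvpoly" and G :: "'a mat set"
  assumes card_field: "CARD('a) = CHAR('a) ^ e" and \<delta>: "\<delta> = CHAR('a) ^ d" and \<epsilon>: "\<delta> = 1 \<Longrightarrow> \<epsilon> = 0"
    and n: "n = 2 * k + l" and h: "h = bilin n k \<delta> \<epsilon> + \<mu>" and \<mu>: "\<mu> \<in> polys_in {k..<k + l}"
    and unitri: "G \<subseteq> unitriangular n" and group: "matrix_group n G"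
    and inv: "\<And>N. N \<in> G \<Longrightarrow> lsub n N h = h"
    and middle: "\<And>N i j. N \<in> G \<Longrightarrow> k \<le> j \<Longrightarrow> j < i \<Longrightarrow> i < k + l \<Longrightarrow> N $$ (i, j) = 0"
    and full: "\<And>A. A \<in> unitriangular k \<Longrightarrow> \<exists>N\<in>G. \<forall>i<k. \<forall>j<k. N $$ (i, j) = A $$ (i, j)"
    and large: "(\<Prod>i<k. CARD('a) ^ i) * (CARD('a) ^ k) ^ l * (\<Prod>j<k. \<delta> * CARD('a) ^ j) \<le> card G"
begin

definition Q :: "nat \<Rightarrow> nat" where "Q s = \<delta> * CARD('a) ^ s"

lemma frob: "(f + g :: (nat, 'a) mvpoly) ^ CARD('a) = f ^ CARD('a) + g ^ CARD('a)"
  by (rule freshmans_dream'[where n = e]) (simp_all add: card_field)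

lemma r_ge_2: "CARD('a) \<ge> 2"
  using card_mono[of "UNIV :: 'a set" "{0, 1}"] by simp

lemma Q_pos: "Q s > 0"
proof -
  have "\<delta> > 0"
    by (subst \<delta>) simp
  then show ?thesis
    by (simp add: Q_def)
qed

lemma Q_Suc: "Q (Suc s) = Q s * CARD('a)"
  by (simp add: Q_def)

lemma Q_strict_mono: "strict_mono Q"
  using Q_pos r_ge_2 by (intro strict_mono_Suc_iff[THEN iffD2] allI) (simp add: Q_Suc)

lemma index_bounds: "k + l \<le> n" "s < k \<Longrightarrow> k + l + s < n"
  using n by auto

lemma finite_G: "finite G"
  using group finite_carrier_mat finite_subset unfolding matrix_group_def by blast

lemma h_in: "h \<in> poly_ring n"
proof -
  have "\<mu> \<in> poly_ring n"
    using n by (intro subsetD[OF polys_in_mono \<mu>]) auto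
  moreover have "bilin n k \<delta> \<epsilon> \<in> poly_ring n"
    unfolding bilin_def using n
    by (intro polys_in_sum polys_in_add polys_in_mult polys_in_power polys_in_mvar polys_in_mconst) auto
  ultimately show ?thesis
    unfolding h by (rule polys_in_add[rotated])
qed

lemma images_invariant: "steenrod_images h \<subseteq> invariant_ring n G"
  by (rule steenrod_images_invariant[OF frob group h_in inv])

text \<open>The orbit of \<open>mvar i\<close> translated to the origin, so that for
  \<open>i < k + l\<close> the orbit product is visibly monic in \<open>mvar i\<close> over the
  earlier variables.\<close>

definition shifts :: "nat \<Rightarrow> (nat, 'a) mvpoly set" where
  "shifts i = (\<lambda>N. lsub n N (mvar i) - mvar i) ` G"

lemma lsub_mvar_unitri:
  assumes N: "N \<in> G" and i: "i < k + l"
  shows "lsub n N (mvar i) - mvar i = (\<Sum>a<min i k. mconst (N $$ (i, a)) * mvar a)"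
proof -
  have "N \<in> unitriangular n"
    using N unitri by auto
  then have N': "N $$ (i, i) = 1" "\<And>a. i < a \<Longrightarrow> a < n \<Longrightarrow> N $$ (i, a) = 0"
    using i n by (auto simp: unitriangular_def)
  have "lsub n N (mvar i) = (\<Sum>a\<in>{..<n}. mconst (N $$ (i, a)) * mvar a)"
    by (simp add: lsub_mvar)
  also have "\<dots> = (\<Sum>a\<in>insert i {..<min i k}. mconst (N $$ (i, a)) * mvar a)"
  proof (rule sum.mono_neutral_right)
    show "\<forall>a\<in>{..<n} - insert i {..<min i k}. mconst (N $$ (i, a)) * mvar a = 0"
    proof
      fix a assume a: "a \<in> {..<n} - insert i {..<min i k}"
      then have "i < a \<or> (k \<le> a \<and> a < i)" by auto
      then have "N $$ (i, a) = 0"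
        using N'(2)[of a] middle[OF N, of a i] a i by auto
      then show "mconst (N $$ (i, a)) * mvar a = 0" by simp
    qed
  qed (use i n in auto)
  finally show ?thesis
    using N'(1) by simp
qed

lemma shifts_subset:
  assumes "i < k + l"
  shows "shifts i \<subseteq> (\<lambda>c. \<Sum>a<min i k. mconst (c a) * mvar a) ` (\<Pi>\<^sub>E a\<in>{..<min i k}. UNIV)"
proof
  fix v assume "v \<in> shifts i"
  then obtain N where N: "N \<in> G" "v = lsub n N (mvar i) - mvar i"
    by (auto simp: shifts_def)
  show "v \<in> (\<lambda>c. \<Sum>a<min i k. mconst (c a) * mvar a) ` (\<Pi>\<^sub>E a\<in>{..<min i k}. UNIV)"
    unfolding N(2) lsub_mvar_unitri[OF N(1) assms]
    by (rule image_eqI[of _ _ "restrict (\<lambda>a. N $$ (i, a)) {..<min i k}"]) simp_all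
qed

lemma shifts_in:
  assumes "i < k + l"
  shows "shifts i \<subseteq> polys_in {..<min i k}"
proof -
  have "(\<Sum>a<min i k. mconst (c a) * mvar a) \<in> polys_in {..<min i k}" for c :: "nat \<Rightarrow> 'a"
    by (intro polys_in_sum polys_in_mult polys_in_mvar polys_in_mconst) auto
  then show ?thesis
    using shifts_subset[OF assms] by blast
qed

lemma card_shifts:
  assumes "i < k + l"
  shows "card (shifts i) \<le> CARD('a) ^ min i k"
proof -
  have "finite (\<Pi>\<^sub>E a\<in>{..<min i k}. (UNIV :: 'a set))"
    by (intro finite_PiE) simp_all
  then have "card (shifts i) \<le> card (\<Pi>\<^sub>E a\<in>{..<min i k}. (UNIV :: 'a set))"
    using shifts_subset[OF assms] by (rule surj_card_le)
  then show ?thesis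
    by (simp add: card_PiE)
qed

lemma finite_shifts: "finite (shifts i)" and shifts_nonempty: "shifts i \<noteq> {}"
  using finite_G group_one[OF group] by (auto simp: shifts_def)

lemma orbit_product_shifts: "orbit_product G i = (\<Prod>v\<in>shifts i. mvar i + v)"
proof -
  have "(\<lambda>N. lsub n N (mvar i)) ` G = (\<lambda>v. mvar i + v) ` shifts i"
    by (simp add: shifts_def image_image)
  then have "orbit_product G i = (\<Prod>y\<in>(\<lambda>v. mvar i + v) ` shifts i. y)"
    unfolding orbit_product_eq[OF group] by simp
  also have "\<dots> = (\<Prod>v\<in>shifts i. mvar i + v)"
    by (subst prod.reindex) (auto simp: inj_on_def)
  finally show ?thesis .
qed

lemma shifts_full:
  assumes i: "i < k"
  shows "shifts i = (\<lambda>c. \<Sum>a<i. mconst (c a) * mvar a) ` (\<Pi>\<^sub>E a\<in>{..<i}. UNIV)" (is "_ = ?f ` ?C")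
proof
  have ik: "i < k + l" "min i k = i"
    using i by auto
  show "shifts i \<subseteq> ?f ` ?C"
    using shifts_subset[OF ik(1)] unfolding ik(2) .
  show "?f ` ?C \<subseteq> shifts i"
  proof (rule image_subsetI)
    fix c :: "nat \<Rightarrow> 'a"
    \<comment> \<open>The identity with the prescribed coefficients in row \<open>i\<close> only;
      \<open>full\<close> extends it to a group element.\<close>
    define A where "A = mat k k (\<lambda>(a, b). if a = b then 1 else if a = i \<and> b < i then c b else 0)"
    have "A \<in> unitriangular k"
      by (auto simp: A_def unitriangular_def)
    then obtain N where N: "N \<in> G" "\<forall>i<k. \<forall>j<k. N $$ (i, j) = A $$ (i, j)"
      using full by blast
    have "lsub n N (mvar i) - mvar i = ?f c"
      unfolding lsub_mvar_unitri[OF N(1) ik(1)] ik(2) using N(2) i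
      by (intro sum.cong) (auto simp: A_def)
    then show "?f c \<in> shifts i"
      using N(1) unfolding shifts_def by (intro image_eqI[of _ _ N]) simp_all
  qed
qed

text \<open>The link between the group and the elimination: the orbit of x_i is x_i plus the full
  span of the earlier variables, so the pivots are themselves orbit products.\<close>

lemma orbit_product_eq_addpoly:
  assumes i: "i < k"
  shows "orbit_product G i = addpoly CARD('a) mvar i (mvar i)"
proof -
  let ?f = "\<lambda>c. \<Sum>a<i. mconst (c a) * mvar a :: (nat, 'a) mvpoly" and ?C = "\<Pi>\<^sub>E a\<in>{..<i}. (UNIV :: 'a set)"
  have inj: "inj_on ?f ?C"
  proof (rule inj_onI)
    fix c c' :: "nat \<Rightarrow> 'a" assume c: "c \<in> ?C" "c' \<in> ?C" and eq: "?f c = ?f c'"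
    show "c = c'"
    proof (rule PiE_ext[OF c])
      fix a assume "a \<in> {..<i}"
      then show "c a = c' a"
        using arg_cong[OF eq, of "\<lambda>f. Poly_Mapping.lookup f (Poly_Mapping.single a 1)"]
        unfolding lookup_linear_form by simp
    qed
  qed
  have "orbit_product G i = (\<Prod>c\<in>?C. mvar i + ?f c)"
    unfolding orbit_product_shifts shifts_full[OF i] by (simp add: prod.reindex[OF inj])
  also have "\<dots> = addpoly CARD('a) mvar i (mvar i)"
    by (rule prod_span_eq_addpoly) (rule frob, rule addpoly_mvar_nonzero, rule frob)
  finally show ?thesis .
qed

text \<open>A choice of the Steenrod image supplied by \<open>steenrod_sequence\<close>; only the
  shape of its hyperbolic part and the variables of its middle part are used later.\<close>

definition form_seq :: "nat \<Rightarrow> (nat, 'a) mvpoly" where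
  "form_seq s = (SOME f. f \<in> steenrod_images h \<and> (\<exists>\<epsilon>. \<exists>\<mu>\<in>polys_in {k..<k + l}. f = bilin n k (Q s) \<epsilon> + \<mu> \<and> (Q s = 1 \<longrightarrow> \<epsilon> = 0)))"

lemma form_seq: "form_seq s \<in> steenrod_images h"
  "\<exists>\<epsilon>. \<exists>\<mu>\<in>polys_in {k..<k + l}. form_seq s = bilin n k (Q s) \<epsilon> + \<mu> \<and> (Q s = 1 \<longrightarrow> \<epsilon> = 0)"
proof -
  have "\<exists>f. f \<in> steenrod_images h \<and> (\<exists>\<epsilon>. \<exists>\<mu>\<in>polys_in {k..<k + l}. f = bilin n k (Q s) \<epsilon> + \<mu> \<and> (Q s = 1 \<longrightarrow> \<epsilon> = 0))"
    using steenrod_sequence[OF card_field \<delta> \<epsilon> h \<mu>, of s] unfolding Q_def by blast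
  from someI_ex[OF this] show "form_seq s \<in> steenrod_images h"
    "\<exists>\<epsilon>. \<exists>\<mu>\<in>polys_in {k..<k + l}. form_seq s = bilin n k (Q s) \<epsilon> + \<mu> \<and> (Q s = 1 \<longrightarrow> \<epsilon> = 0)"
    unfolding form_seq_def by blast+
qed

definition gen :: "nat \<Rightarrow> (nat, 'a) mvpoly" where
  "gen i = (if i < k + l then orbit_product G i else form_seq (i - (k + l)))"

definition K :: "'a ratfun set" where "K = field_adjoin (to_fract ` gen ` {..<n})"

lemma gen_in_gens: "gen ` {..<n} \<subseteq> orbit_product G ` {..<n} \<union> steenrod_images h"
proof
  fix f assume "f \<in> gen ` {..<n}"
  then obtain i where i: "i < n" "f = gen i" by blast
  show "f \<in> orbit_product G ` {..<n} \<union> steenrod_images h"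
    using i(1) form_seq(1) unfolding i(2) gen_def by simp
qed

lemma gens_invariant: "orbit_product G ` {..<n} \<union> steenrod_images h \<subseteq> invariant_ring n G"
  using images_invariant orbit_product_invariant[OF group] by auto

text \<open>The base ring of the descent: it consists of invariants, as
  \<open>invariant_in_fraction_field\<close> requires, and its fractions stay inside
  \<open>K\<close>.\<close>

definition A :: "(nat, 'a) mvpoly set" where
  "A = {f \<in> invariant_ring n G. to_fract f \<in> K}"

lemma K_subfield: "is_subfield K"
  unfolding K_def by (rule field_adjoin_subfield)

lemma K_subring: "is_subring K"
  using K_subfield by (simp add: is_subfield_def)

lemma A_subring: "is_subring A"
  unfolding is_subring_def
  using subring_1[OF K_subring] subring_diff[OF K_subring] subring_mult[OF K_subring]
    subring_1[OF invariant_ring_subring[OF group]] subring_diff[OF invariant_ring_subring[OF group]]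
    subring_mult[OF invariant_ring_subring[OF group]]
  by (simp add: A_def)

lemma const_in_A: "mconst c \<in> A"
  using fconst_in_field_adjoin[of c] by (simp add: A_def K_def fconst_def invariant_ring_eq[OF group])

lemma gen_in_A:
  assumes "i < n"
  shows "gen i \<in> A"
proof -
  have "gen i \<in> gen ` {..<n}"
    using assms by simp
  then have "gen i \<in> invariant_ring n G" "to_fract (gen i) \<in> K"
    using gen_in_gens gens_invariant field_adjoin_incl[of "to_fract ` gen ` {..<n}"]
    unfolding K_def by blast+
  then show ?thesis
    by (simp add: A_def)
qed

lemma orbit_product_in_A: "i < k + l \<Longrightarrow> orbit_product G i \<in> A"
  using gen_in_A[of i] index_bounds(1) by (simp add: gen_def)

lemma form_seq_in_A: "s < k \<Longrightarrow> form_seq s \<in> A"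
  using gen_in_A[OF index_bounds(2)] by (simp add: gen_def)

lemma relation:
  assumes j: "j < k"
  shows "\<exists>u\<in>A. u \<noteq> 0 \<and> (\<exists>a\<in>A. \<exists>c. \<exists>\<rho>\<in>low_degree (polys_in {..<k + l}) k (\<lambda>i. mvar (n - 1 - i)) (Q j).
      (\<forall>i<k. c i \<in> polys_in {..<k + l}) \<and>
      u * mvar (n - 1 - j) ^ Q j = a + (\<Sum>i\<in>{j<..<k}. c i * mvar (n - 1 - i) ^ Q j) + \<rho>)"
proof (rule elimination_relation[OF A_subring polys_in_subring _ frob, where x = mvar and h = form_seq])
  show "form_seq s - (\<Sum>i<k. mvar i * mvar (n - 1 - i) ^ Q s)
      \<in> low_degree (polys_in {..<k + l}) k (\<lambda>i. mvar (n - 1 - i)) (Q s)" for s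
  proof -
    obtain \<epsilon> \<mu> where f: "\<mu> \<in> polys_in {k..<k + l}" "form_seq s = bilin n k (Q s) \<epsilon> + \<mu>" "Q s = 1 \<longrightarrow> \<epsilon> = 0"
      using form_seq(2)[of s] by blast
    have "\<mu> \<in> polys_in {..<k + l}"
      by (rule subsetD[OF polys_in_mono f(1)]) auto
    from low_degree_bilin[OF this Q_pos[of s], of \<epsilon> n] f(3) show ?thesis
      unfolding f(2) by simp
  qed
  show "addpoly CARD('a) mvar j (mvar j) \<in> A" if "j < k" for j
    using orbit_product_in_A[of j] orbit_product_eq_addpoly[OF that] that by simp
qed (use j r_ge_2 Q_Suc form_seq_in_A addpoly_mvar_nonzero[OF frob] in auto)

text \<open>The spanning set has at most as many elements as the product of the orbit bounds r^(min
  a k) and the exponents Q_j, which by \<open>large\<close> does not exceed |G|. Distinct matrices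
  act differently already on some variable, so the descent applies.\<close>

lemma invariants_in_fraction_field:
  assumes f: "f \<in> invariant_ring n G"
  shows "\<exists>a\<in>A. \<exists>b\<in>A. b \<noteq> 0 \<and> b * f = a"
proof -
  have shifts: "finite (shifts a) \<and> shifts a \<noteq> {} \<and> shifts a \<subseteq> polys_in {..<a}" if "a < k + l" for a
  proof -
    have "shifts a \<subseteq> polys_in {..<a}"
      using shifts_in[OF that] polys_in_mono[of "{..<min a k}" "{..<a}"] by auto
    then show ?thesis
      using finite_shifts shifts_nonempty by blast
  qed
  have prods: "(\<Prod>v\<in>shifts a. mvar a + v) \<in> A" if "a < k + l" for a
    using orbit_product_in_A[OF that] unfolding orbit_product_shifts .
  obtain W where W: "finite W" "W \<subseteq> poly_ring n" "card W \<le> (\<Prod>a<k + l. card (shifts a)) * (\<Prod>j<k. Q j)"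
    "poly_ring n \<subseteq> frac_span A W"
    by (rule spanning_set[OF A_subring const_in_A n shifts prods Q_pos relation])
  have "(\<Prod>a<k + l. card (shifts a)) \<le> (\<Prod>a<k + l. CARD('a) ^ min a k)"
    by (intro prod_mono) (simp add: card_shifts)
  also have "(\<Prod>a<k + l. CARD('a) ^ min a k) = (\<Prod>a<k. CARD('a) ^ min a k) * (\<Prod>a\<in>{k..<k + l}. CARD('a) ^ min a k)"
  proof -
    have "{..<k + l} = {..<k} \<union> {k..<k + l}" "{..<k} \<inter> {k..<k + l} = {}"
      by auto
    then show ?thesis
      by (simp only: prod.union_disjoint finite_lessThan finite_atLeastLessThan)
  qed
  also have "\<dots> = (\<Prod>a<k. CARD('a) ^ a) * (CARD('a) ^ k) ^ l"
    by simp
  finally have "card W \<le> card G"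
    using W(3) large unfolding Q_def by (meson le_trans mult_le_mono1)
  moreover have "\<exists>p\<in>poly_ring n. lsub n N p \<noteq> lsub n N' p" if N: "N \<in> G" "N' \<in> G" "N \<noteq> N'" for N N'
  proof -
    obtain i j where ij: "i < n" "j < n" "N $$ (i, j) \<noteq> N' $$ (i, j)"
    proof (rule ccontr)
      assume "\<not> thesis"
      then have "N = N'"
        using that group_carrier[OF group N(1)] group_carrier[OF group N(2)] by (intro eq_matI) auto
      with N(3) show False ..
    qed
    have "lsub n N (mvar i) \<noteq> lsub n N' (mvar i)"
    proof
      assume "lsub n N (mvar i) = lsub n N' (mvar i)"
      from arg_cong[OF this, of "\<lambda>f. Poly_Mapping.lookup f (Poly_Mapping.single j 1)"] ij show False
        unfolding lsub_mvar lookup_linear_form by simp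
    qed
    with ij show ?thesis
      by (intro bexI[of _ "mvar i"]) auto
  qed
  moreover have "A \<subseteq> poly_ring n" "\<And>N a. N \<in> G \<Longrightarrow> a \<in> A \<Longrightarrow> lsub n N a = a"
    by (auto simp: A_def invariant_ring_eq[OF group])
  ultimately show ?thesis
    using f W
    by (intro invariant_in_fraction_field[where G = G and P = "poly_ring n" and \<chi> = "lsub n" and W = W,
            OF finite_G polys_in_subring A_subring])
       (simp_all add: invariant_ring_eq[OF group] lsub.hom_add lsub.hom_mult)
qed

lemma quot_field_subset: "quot_field (invariant_ring n G) \<subseteq> K"
proof
  fix x assume "x \<in> quot_field (invariant_ring n G)"
  then obtain a b where x: "x = to_fract a / to_fract b" "a \<in> invariant_ring n G" "b \<in> invariant_ring n G"
    unfolding quot_field_eq by blast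
  have "to_fract f \<in> K" if f: "f \<in> invariant_ring n G" for f
  proof -
    obtain a b where ab: "a \<in> A" "b \<in> A" "b \<noteq> 0" "b * f = a"
      using invariants_in_fraction_field[OF f] by blast
    have "to_fract f = to_fract (b * f) * inverse (to_fract b)"
      using ab(3) by simp
    also have "\<dots> \<in> K"
      using ab K_subfield unfolding A_def ab(4)
      by (intro subring_mult[OF K_subring]) (simp_all add: is_subfield_def)
    finally show ?thesis .
  qed
  then show "x \<in> K"
    using x K_subfield unfolding x(1) divide_inverse
    by (intro subring_mult[OF K_subring]) (simp_all add: is_subfield_def)
qed

lemma gen_independent: "algebraically_independent (to_fract ` gen ` {..<n})"
proof -
  \<comment> \<open>The weights of \<open>has_lead_bilin\<close>. They also increase along the first
    k variables and are negative there and zero in the middle, so each orbit product is led by the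
    pure power of its own variable.\<close>
  define \<omega> where "\<omega> = (\<lambda>i. if i < k then - (int (Q (k - 1 - i)))\<^sup>2 else if i < k + l then 0 else 2 * int (Q (i - (k + l))))"
  define c where "c i = (if i < k + l then card (shifts i) else Q (i - (k + l)))" for i
  define \<nu> where "\<nu> = (\<lambda>i. if i < k + l then Poly_Mapping.single i (c i)
       else Poly_Mapping.single (n - 1 - i) 1 + Poly_Mapping.single i (c i))"
  show ?thesis
  proof (rule algebraically_independent_leading[where \<omega> = \<omega> and \<mu> = \<nu>])
    fix i assume i: "i < n"
    show "has_lead \<omega> (gen i) (\<nu> i)"
    proof (cases "i < k + l")
      case True
      have "has_lead \<omega> (mvar i + v) (Poly_Mapping.single i 1)" if "v \<in> shifts i" for v
      proof -
        have "\<omega> a < \<omega> i" if "a < min i k" for a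
        proof (cases "i < k")
          case True
          then have "Q (k - 1 - i) < Q (k - 1 - a)"
            using that by (intro strict_monoD[OF Q_strict_mono]) auto
          then show ?thesis
            using True that by (simp add: \<omega>_def power_strict_mono)
        next
          case False
          then show ?thesis
            using \<open>i < k + l\<close> that Q_pos[of "k - 1 - a"] by (simp add: \<omega>_def)
        qed
        then have "mconst (c a) * mvar a \<in> below \<omega> (\<omega> i)" if "a < min i k" for c a
          unfolding mvar_def single_eq_mconst_mult[symmetric] using that by (intro below_single) simp
        then have "(\<Sum>a<min i k. mconst (c a) * mvar a) \<in> below \<omega> (\<omega> i)" for c
          by (intro below_sum) simp
        then have "v \<in> below \<omega> (\<omega> i)"
          using that shifts_subset[OF True] by blast
        then show ?thesis
          by (simp add: has_lead_def mvar_def)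
      qed
      from has_lead_prod[of "shifts i" \<omega> "\<lambda>v. mvar i + v", OF this]
      have "has_lead \<omega> (gen i) (\<Sum>v\<in>shifts i. Poly_Mapping.single i 1)"
        using True by (simp add: gen_def orbit_product_shifts)
      moreover have "(\<Sum>v\<in>shifts i. Poly_Mapping.single i 1) = Poly_Mapping.single i (card (shifts i))"
        by (rule poly_mapping_eqI) (simp only: lookup_sum lookup_single when_def, simp)
      ultimately show ?thesis
        using True by (simp add: \<nu>_def c_def)
    next
      case False
      define s where "s = i - (k + l)"
      have s: "s < k" "k - 1 - s = n - 1 - i" "k + l + s = i"
        using False i n by (auto simp: s_def)
      obtain \<epsilon> \<mu> where f: "\<mu> \<in> polys_in {k..<k + l}" "form_seq s = bilin n k (Q s) \<epsilon> + \<mu>" "Q s = 1 \<longrightarrow> \<epsilon> = 0"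
        using form_seq(2)[of s] by blast
      have "has_lead \<omega> (form_seq s) (Poly_Mapping.single (n - 1 - i) 1 + Poly_Mapping.single i (Q s))"
        unfolding f(2) using has_lead_bilin[OF n f(1) Q_strict_mono Q_pos _ \<omega>_def s(1)] f(3) unfolding s by simp
      then show ?thesis
        using False by (simp add: \<nu>_def c_def gen_def s_def)
    qed
  next
    fix e e' :: "nat \<Rightarrow> nat"
    assume "\<forall>j. (\<Sum>i<n. e i * Poly_Mapping.lookup (\<nu> i) j) = (\<Sum>i<n. e' i * Poly_Mapping.lookup (\<nu> i) j)"
    then show "\<forall>i<n. e i = e' i"
    proof (rule exponents_injective[OF n _ \<nu>_def, rotated])
      fix i assume "i < n"
      then show "c i > 0"
        using finite_shifts shifts_nonempty Q_pos by (simp add: c_def card_gt_0_iff)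
    qed
  qed
qed

text \<open>A circle of inclusions: K lies in the field generated by all orbit products and Steenrod
  images, this lies in the fraction field of the invariants, and that lies in K by the
  descent.\<close>

theorem invariant_field_generators:
  "invariant_field n G = quot_field (invariant_ring n G)
    \<and> purely_transcendental (invariant_field n G)
    \<and> invariant_field n G = field_adjoin (to_fract ` (orbit_product G ` {..<n} \<union> steenrod_images h))"
proof -
  let ?gens = "to_fract ` (orbit_product G ` {..<n} \<union> steenrod_images h)"
  have inv: "invariant_field n G = quot_field (invariant_ring n G)"
    by (rule invariant_field_eq_quot_field[OF group finite_G])
  have incl: "to_fract f \<in> quot_field (invariant_ring n G)" if "f \<in> invariant_ring n G" for f
    using that subring_1[OF invariant_ring_subring[OF group]] by (intro quot_fieldI[of f _ 1]) simp_all
  have "K \<subseteq> field_adjoin ?gens"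
    unfolding K_def by (intro field_adjoin_mono image_mono gen_in_gens)
  moreover have "field_adjoin ?gens \<subseteq> quot_field (invariant_ring n G)"
  proof (rule field_adjoin_minimal[OF quot_field_subfield[OF invariant_ring_subring[OF group]]])
    show "range fconst \<subseteq> quot_field (invariant_ring n G)"
      using incl const_in_A by (auto simp: fconst_def A_def)
    show "?gens \<subseteq> quot_field (invariant_ring n G)"
      using incl gens_invariant by blast
  qed
  ultimately have "invariant_field n G = K" "invariant_field n G = field_adjoin ?gens"
    using quot_field_subset inv by auto
  then show ?thesis
    using inv gen_independent unfolding purely_transcendental_def K_def by blast
qed

end

section \<open>The isometry group and a lower bound for its order by three kinds of elements\<close>

section \<open>Groups of unitriangular isometries\<close>

lemma unitriangular_mult:
  assumes M: "M \<in> unitriangular n" and N: "N \<in> unitriangular n" and i: "i < n" "j < n"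
  shows "(M * N) $$ (i, j) = (\<Sum>a\<in>{j..i}. M $$ (i, a) * N $$ (a, j))"
proof -
  have "(M * N) $$ (i, j) = (\<Sum>a<n. M $$ (i, a) * N $$ (a, j))"
    using M N i by (auto simp: unitriangular_def scalar_prod_def atLeast0LessThan)
  also have "\<dots> = (\<Sum>a\<in>{j..i}. M $$ (i, a) * N $$ (a, j))"
    using M N i by (intro sum.mono_neutral_right) (auto simp: unitriangular_def not_le)
  finally show ?thesis .
qed

lemma unitriangular_mult_closed:
  assumes M: "M \<in> unitriangular n" and N: "N \<in> unitriangular n"
  shows "M * N \<in> unitriangular n"
proof -
  have "(M * N) $$ (i, i) = 1" if "i < n" for i
    using unitriangular_mult[OF M N that that] M N that by (simp add: unitriangular_def)
  moreover have "(M * N) $$ (i, j) = 0" if "i < j" "j < n" for i j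
    using unitriangular_mult[OF M N _ that(2), of i] that by simp
  ultimately show ?thesis
    using M N by (auto simp: unitriangular_def)
qed

lemma unitriangular_one: "1\<^sub>m n \<in> unitriangular n"
  by (auto simp: unitriangular_def)

text \<open>The common description of all the subgroups in question. Together with unitriangularity
  the last condition says that the middle block is the identity.\<close>

definition isom :: "nat \<Rightarrow> nat \<Rightarrow> nat \<Rightarrow> (nat, 'a::field) mvpoly \<Rightarrow> 'a mat set" where
  "isom n k l h = {N \<in> unitriangular n. lsub n N h = h \<and>
     (\<forall>i j. k \<le> j \<longrightarrow> j < i \<longrightarrow> i < k + l \<longrightarrow> N $$ (i, j) = 0)}"

lemma isom_matrix_group:
  fixes h :: "(nat, 'a::{field, finite}) mvpoly"
  assumes h: "h \<in> poly_ring n" and l: "l \<le> 2" "k + l \<le> n"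
  shows "matrix_group n (isom n k l h)"
proof (rule matrix_groupI)
  show "isom n k l h \<subseteq> unitriangular n"
    by (auto simp: isom_def)
  show "1\<^sub>m n \<in> isom n k l h"
    using h l by (auto simp: isom_def unitriangular_one lsub_one)
  fix M N assume "M \<in> isom n k l h" "N \<in> isom n k l h"
  then have MN: "M \<in> unitriangular n" "N \<in> unitriangular n" "lsub n M h = h" "lsub n N h = h"
    "\<And>i j. k \<le> j \<Longrightarrow> j < i \<Longrightarrow> i < k + l \<Longrightarrow> M $$ (i, j) = 0"
    "\<And>i j. k \<le> j \<Longrightarrow> j < i \<Longrightarrow> i < k + l \<Longrightarrow> N $$ (i, j) = 0"
    by (auto simp: isom_def)
  have "lsub n (M * N) h = h"
    using lsub_lsub[of N n M h] MN h by (simp add: unitriangular_carrier)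
  moreover have "(M * N) $$ (i, j) = 0" if ij: "k \<le> j" "j < i" "i < k + l" for i j
  proof -
    \<comment> \<open>For \<open>l \<le> 2\<close> the middle block has at most one strictly lower
      entry, and such an entry is additive under multiplication.\<close>
    have "i = Suc j"
      using ij l(1) by linarith
    then show ?thesis
      using unitriangular_mult[OF MN(1,2), of i j] MN(5,6)[OF ij] ij l(2) by simp
  qed
  ultimately show "M * N \<in> isom n k l h"
    using unitriangular_mult_closed[OF MN(1,2)] by (auto simp: isom_def)
qed

text \<open>Every element of the group is a product of elements of three kinds, which the first \<open>k\<close> rows, the
  middle rows and the last rows tell apart.\<close>

lemma card_unitriangular: "(\<Prod>i<k. CARD('a) ^ i) \<le> card (unitriangular k :: 'a::{field, finite} mat set)"
proof -
  let ?P = "\<Pi>\<^sub>E i\<in>{..<k}. \<Pi>\<^sub>E j\<in>{..<i}. (UNIV :: 'a set)"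
  let ?f = "\<lambda>f. mat k k (\<lambda>(i, j). if i = j then 1 else if j < i then f i j else 0)"
  have "inj_on ?f ?P"
  proof (rule inj_onI)
    fix f g assume f: "f \<in> ?P" "g \<in> ?P" and eq: "?f f = ?f g"
    show "f = g"
    proof (rule PiE_ext[OF f])
      fix i assume i: "i \<in> {..<k}"
      show "f i = g i"
      proof (rule PiE_ext)
        show "f i \<in> (\<Pi>\<^sub>E j\<in>{..<i}. UNIV)" "g i \<in> (\<Pi>\<^sub>E j\<in>{..<i}. UNIV)"
          using f i by (auto simp: PiE_iff)
        fix j assume "j \<in> {..<i}"
        with i arg_cong[OF eq, of "\<lambda>M. M $$ (i, j)"] show "f i j = g i j"
          by simp
      qed
    qed
  qed
  moreover have "?f ` ?P \<subseteq> unitriangular k"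
    by (auto simp: unitriangular_def)
  moreover have "finite (unitriangular k :: 'a mat set)"
    by (rule finite_subset[OF _ finite_carrier_mat[of k]]) (auto simp: unitriangular_def)
  ultimately have "card ?P \<le> card (unitriangular k :: 'a mat set)"
    by (rule card_inj_on_le)
  then show ?thesis
    by (simp add: card_PiE)
qed

text \<open>Products N * FB B * FA A are pairwise distinct. Both left factors have unit rows at the
  top, so the first k rows reveal A; after cancelling FA A the middle rows reveal B, because N has
  unit rows there; cancelling again leaves N.\<close>

lemma card_group_ge:
  fixes G :: "'a::{field, finite} mat set"
  assumes G: "matrix_group n G" and kl: "k + l \<le> n"
    and top: "\<And>A. A \<in> unitriangular k \<Longrightarrow> \<exists>N\<in>G. \<forall>i<k. \<forall>j<k. N $$ (i, j) = A $$ (i, j)"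
    and mid: "\<And>B :: nat \<Rightarrow> nat \<Rightarrow> 'a. \<exists>N\<in>G. (\<forall>i<k. \<forall>j<n. N $$ (i, j) = (if i = j then 1 else 0))
      \<and> (\<forall>t<l. \<forall>j<k. N $$ (k + t, j) = B t j)"
    and bot: "S \<subseteq> G" "\<And>N i j. N \<in> S \<Longrightarrow> i < k + l \<Longrightarrow> j < n \<Longrightarrow> N $$ (i, j) = (if i = j then 1 else 0)"
  shows "(\<Prod>i<k. CARD('a) ^ i) * (CARD('a) ^ k) ^ l * card S \<le> card G"
proof -
  let ?U = "unitriangular k :: 'a mat set" and ?B = "\<Pi>\<^sub>E t\<in>{..<l}. \<Pi>\<^sub>E j\<in>{..<k}. (UNIV :: 'a set)"
  obtain FA where FA: "\<And>A. A \<in> ?U \<Longrightarrow> FA A \<in> G"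
    "\<And>A i j. A \<in> ?U \<Longrightarrow> i < k \<Longrightarrow> j < k \<Longrightarrow> FA A $$ (i, j) = A $$ (i, j)"
  proof -
    have "\<forall>A\<in>?U. \<exists>N. N \<in> G \<and> (\<forall>i<k. \<forall>j<k. N $$ (i, j) = A $$ (i, j))"
      using top by blast
    from bchoice[OF this] show thesis
      using that by blast
  qed
  obtain FB where FB: "\<And>B. FB B \<in> G"
    "\<And>B i j. i < k \<Longrightarrow> j < n \<Longrightarrow> FB B $$ (i, j) = (if i = j then 1 else 0)"
    "\<And>B t j. t < l \<Longrightarrow> j < k \<Longrightarrow> FB B $$ (k + t, j) = B t j"
  proof -
    have "\<forall>B :: nat \<Rightarrow> nat \<Rightarrow> 'a. \<exists>N. N \<in> G \<and> (\<forall>i<k. \<forall>j<n. N $$ (i, j) = (if i = j then 1 else 0))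
      \<and> (\<forall>t<l. \<forall>j<k. N $$ (k + t, j) = B t j)"
      using mid by blast
    from choice[OF this] show thesis
      using that by blast
  qed
  let ?f = "\<lambda>(A, B, N). N * FB B * FA A"
  have carr: "N \<in> carrier_mat n n" if "N \<in> G" for N
    using group_carrier[OF G that] .
  have unit_row: "(M * N) $$ (i, j) = N $$ (i, j)"
    if "M \<in> G" "N \<in> G" "i < n" "j < n" "\<And>a. a < n \<Longrightarrow> M $$ (i, a) = (if i = a then 1 else 0)" for M N i j
  proof -
    have "(M * N) $$ (i, j) = (\<Sum>a<n. M $$ (i, a) * N $$ (a, j))"
      using carr[OF that(1)] carr[OF that(2)] that(3,4) by (auto simp: scalar_prod_def atLeast0LessThan)
    also have "\<dots> = (\<Sum>a<n. if a = i then N $$ (i, j) else 0)"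
      using that(5) by (intro sum.cong) auto
    finally show ?thesis
      using that(3) by simp
  qed
  have cancel: "M = M'" if "M * N = M' * N" "M \<in> G" "M' \<in> G" and N: "N \<in> G" for M M' N
  proof -
    obtain N' where N': "N' \<in> G" "N * N' = 1\<^sub>m n"
      using group_inverse[OF G N] .
    have "K = K * N * N'" if "K \<in> G" for K
      using assoc_mult_mat[OF carr[OF that] carr[OF N] carr[OF N'(1)]] N'(2)
        right_mult_one_mat[OF carr[OF that]] by simp
    from this[OF that(2)] this[OF that(3)] that(1) show ?thesis by simp
  qed
  note mult = group_mult[OF G]
  have inj: "A = A' \<and> B = B' \<and> N = N'"
    if *: "A \<in> ?U" "B \<in> ?B" "N \<in> S" "A' \<in> ?U" "B' \<in> ?B" "N' \<in> S"
      and eq: "N * FB B * FA A = N' * FB B' * FA A'" for A B N A' B' N'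
  proof -
    have N: "N \<in> G" "N' \<in> G"
      using * bot(1) by auto
    have top_row: "(M * FB C * FA D) $$ (i, j) = D $$ (i, j)"
      if "M \<in> S" "D \<in> ?U" "i < k" "j < k" for M C D i j
    proof -
      have M: "M \<in> G" using that(1) bot(1) by auto
      have row: "(M * FB C) $$ (i, a) = (if i = a then 1 else 0)" if "a < n" for a
        using that \<open>i < k\<close> kl bot(2)[OF \<open>M \<in> S\<close>, of i] FB(2)[of i a C]
        by (subst unit_row[OF M FB(1)]) auto
      show ?thesis
        using that kl FA(2)[OF that(2-4)] by (subst unit_row[OF mult[OF M FB(1)] FA(1)[OF that(2)]]) (auto simp: row)
    qed
    have "A = A'"
    proof (rule eq_matI)
      fix i j assume "i < dim_row A'" "j < dim_col A'"
      then have ij: "i < k" "j < k"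
        using * by (auto simp: unitriangular_def)
      show "A $$ (i, j) = A' $$ (i, j)"
        using top_row[OF *(3,1) ij, of B] top_row[OF *(6,4) ij, of B'] eq by simp
    qed (use * in \<open>auto simp: unitriangular_def\<close>)
    with eq have eq': "N * FB B = N' * FB B'"
      using * N by (intro cancel[OF _ mult[OF N(1) FB(1)] mult[OF N(2) FB(1)] FA(1)]) auto
    have mid_row: "(M * FB C) $$ (k + t, j) = C t j" if "M \<in> S" "t < l" "j < k" for M C t j
    proof -
      have M: "M \<in> G" using that(1) bot(1) by auto
      show ?thesis
        using that kl bot(2)[OF that(1), of "k + t"] FB(3)[OF that(2,3), of C] by (subst unit_row[OF M FB(1)]) auto
    qed
    have "B = B'"
    proof (rule PiE_ext[OF *(2,5)])
      fix t assume t: "t \<in> {..<l}"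
      show "B t = B' t"
      proof (rule PiE_ext)
        show "B t \<in> (\<Pi>\<^sub>E j\<in>{..<k}. UNIV)" "B' t \<in> (\<Pi>\<^sub>E j\<in>{..<k}. UNIV)"
          using *(2,5) t by (auto simp: PiE_iff)
        fix j assume "j \<in> {..<k}"
        with t show "B t j = B' t j"
          using mid_row[OF *(3), of t j B] mid_row[OF *(6), of t j B'] eq' by simp
      qed
    qed
    moreover have "N = N'"
      using eq' N \<open>B = B'\<close> by (intro cancel[OF _ N FB(1)]) simp
    ultimately show "A = A' \<and> B = B' \<and> N = N'"
      using \<open>A = A'\<close> by simp
  qed
  have "inj_on ?f (?U \<times> ?B \<times> S)"
  proof (rule inj_onI)
    fix p p' assume p: "p \<in> ?U \<times> ?B \<times> S" "p' \<in> ?U \<times> ?B \<times> S" and eq: "?f p = ?f p'"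
    obtain A B N A' B' N' where pp: "p = (A, B, N)" "p' = (A', B', N')"
      by (metis prod_cases3)
    show "p = p'"
      using inj[of A B N A' B' N'] p eq unfolding pp by simp
  qed
  moreover have "?f ` (?U \<times> ?B \<times> S) \<subseteq> G"
    using FA(1) FB(1) bot(1) mult by auto
  moreover have "finite G"
    using carr finite_carrier_mat finite_subset by (metis subsetI)
  ultimately have "card (?U \<times> ?B \<times> S) \<le> card G"
    by (rule card_inj_on_le)
  moreover have "card (?U \<times> ?B \<times> S) = card ?U * (CARD('a) ^ k) ^ l * card S"
    by (simp add: card_PiE card_cartesian_product)
  ultimately have "card ?U * ((CARD('a) ^ k) ^ l * card S) \<le> card G"
    by (simp only: mult.assoc)
  with mult_le_mono1[OF card_unitriangular[of k, where 'a = 'a], of "(CARD('a) ^ k) ^ l * card S"]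
  show ?thesis
    unfolding mult.assoc by (rule order.trans)
qed

subsection \<open>Block matrices\<close>

text \<open>Block triangular with identity middle block. The last rows and columns are numbered
  backwards, so that index i of \<open>Z\<close>, \<open>D\<close>, \<open>E\<close> refers to the
  partner y_i of x_i.\<close>

definition bmat :: "nat \<Rightarrow> nat \<Rightarrow> nat \<Rightarrow> (nat \<Rightarrow> nat \<Rightarrow> 'a) \<Rightarrow> (nat \<Rightarrow> nat \<Rightarrow> 'a) \<Rightarrow> (nat \<Rightarrow> nat \<Rightarrow> 'a)
    \<Rightarrow> (nat \<Rightarrow> nat \<Rightarrow> 'a) \<Rightarrow> (nat \<Rightarrow> nat \<Rightarrow> 'a) \<Rightarrow> 'a::comm_ring_1 mat" where
  "bmat n k l a b D Z E = mat n n (\<lambda>(i, j).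
     if i < k then (if j < k then a i j else 0)
     else if i < k + l then (if j < k then b (i - k) j else if i = j then 1 else 0)
     else if j < k then Z (n - 1 - i) j else if j < k + l then D (n - 1 - i) (j - k)
     else E (n - 1 - i) (n - 1 - j))"

lemma sum_split_blocks:
  fixes f :: "nat \<Rightarrow> 'b::comm_monoid_add"
  assumes "n = 2 * k + l"
  shows "(\<Sum>j<n. f j) = (\<Sum>j<k. f j) + (\<Sum>t<l. f (k + t)) + (\<Sum>b<k. f (n - 1 - b))"
proof -
  have "(\<Sum>j\<in>{k..<k + l}. f j) = (\<Sum>t<l. f (k + t))"
    by (rule sum.reindex_bij_witness[of _ "\<lambda>t. k + t" "\<lambda>j. j - k"]) auto
  moreover have "(\<Sum>j\<in>{k + l..<n}. f j) = (\<Sum>b<k. f (n - 1 - b))"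
    by (rule sum.reindex_bij_witness[of _ "\<lambda>i. n - 1 - i" "\<lambda>i. n - 1 - i"]) (use assms in auto)
  moreover have "(\<Sum>j<n. f j) = (\<Sum>j<k. f j) + (\<Sum>j\<in>{k..<k + l}. f j) + (\<Sum>j\<in>{k + l..<n}. f j)"
    unfolding lessThan_atLeast0 using assms by (simp add: sum.atLeastLessThan_concat)
  ultimately show ?thesis by simp
qed

context
  fixes n k l :: nat and a b D Z E :: "nat \<Rightarrow> nat \<Rightarrow> 'a::comm_ring_1" and N
  assumes n: "n = 2 * k + l" and N: "N = bmat n k l a b D Z E"
begin

lemma lsub_bmat_first:
  assumes "i < k"
  shows "lsub n N (mvar i) = (\<Sum>j<k. mconst (a i j) * mvar j)"
proof -
  have kn: "k \<le> n" "k + l \<le> n" using n by auto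
  have "(\<Sum>b<k. mconst (N $$ (i, n - 1 - b)) * mvar (n - 1 - b)) = (0 :: (nat, 'a) mvpoly)"
    using n assms by (intro sum.neutral) (auto simp: N bmat_def)
  moreover have "(\<Sum>t<l. mconst (N $$ (i, k + t)) * mvar (k + t)) = (0 :: (nat, 'a) mvpoly)"
    using kn assms by (intro sum.neutral) (auto simp: N bmat_def)
  moreover have "(\<Sum>j<k. mconst (N $$ (i, j)) * mvar j) = (\<Sum>j<k. mconst (a i j) * mvar j)"
    using kn assms by (intro sum.cong) (auto simp: N bmat_def)
  ultimately show ?thesis
    unfolding lsub_mvar sum_split_blocks[OF n] by simp
qed

lemma lsub_bmat_middle:
  assumes t: "t < l"
  shows "lsub n N (mvar (k + t)) = (\<Sum>j<k. mconst (b t j) * mvar j) + mvar (k + t)"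
proof -
  have kn: "k \<le> n" "k + l \<le> n" using n by auto
  have "(\<Sum>t'<l. mconst (N $$ (k + t, k + t')) * mvar (k + t')) = (\<Sum>t'<l. if t' = t then mvar (k + t) else (0 :: (nat, 'a) mvpoly))"
    using kn t by (intro sum.cong) (auto simp: N bmat_def)
  moreover have "(\<Sum>b<k. mconst (N $$ (k + t, n - 1 - b)) * mvar (n - 1 - b)) = (0 :: (nat, 'a) mvpoly)"
    using n t by (intro sum.neutral) (auto simp: N bmat_def)
  moreover have "(\<Sum>j<k. mconst (N $$ (k + t, j)) * mvar j) = (\<Sum>j<k. mconst (b t j) * mvar j)"
    using kn t by (intro sum.cong) (auto simp: N bmat_def)
  ultimately show ?thesis
    using t unfolding lsub_mvar sum_split_blocks[OF n] by simp
qed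

lemma lsub_bmat_last:
  assumes i: "i < k"
  shows "lsub n N (mvar (n - 1 - i)) = (\<Sum>j<k. mconst (Z i j) * mvar j) + (\<Sum>t<l. mconst (D i t) * mvar (k + t))
    + (\<Sum>b<k. mconst (E i b) * mvar (n - 1 - b))"
proof -
  have *: "n - 1 - i < n" "\<not> n - 1 - i < k + l" "\<not> n - 1 - i < k" "n - 1 - (n - 1 - i) = i" "k + l \<le> n" if "i < k" for i
    using that n by auto
  have "(\<Sum>j<k. mconst (N $$ (n - 1 - i, j)) * mvar j) = (\<Sum>j<k. mconst (Z i j) * mvar j)"
    using *[OF i] by (intro sum.cong) (auto simp: N bmat_def)
  moreover have "(\<Sum>t<l. mconst (N $$ (n - 1 - i, k + t)) * mvar (k + t)) = (\<Sum>t<l. mconst (D i t) * mvar (k + t))"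
    using *[OF i] by (intro sum.cong) (auto simp: N bmat_def)
  moreover have "(\<Sum>b<k. mconst (N $$ (n - 1 - i, n - 1 - b)) * mvar (n - 1 - b)) = (\<Sum>b<k. mconst (E i b) * mvar (n - 1 - b))"
  proof (intro sum.cong refl)
    fix b assume "b \<in> {..<k}"
    then have "b < k" by simp
    from *[OF i] *[OF this] show "mconst (N $$ (n - 1 - i, n - 1 - b)) * mvar (n - 1 - b) = mconst (E i b) * mvar (n - 1 - b)"
      by (simp add: N bmat_def)
  qed
  ultimately show ?thesis
    unfolding lsub_mvar sum_split_blocks[OF n] by simp
qed

end

lemma bmat_unitriangular:
  assumes n: "n = 2 * k + l"
    and a: "\<And>i. i < k \<Longrightarrow> a i i = 1" "\<And>i j. i < j \<Longrightarrow> j < k \<Longrightarrow> a i j = 0"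
    and E: "\<And>i. i < k \<Longrightarrow> E i i = 1" "\<And>i j. j < i \<Longrightarrow> i < k \<Longrightarrow> E i j = 0"
  shows "bmat n k l a b D Z E \<in> unitriangular n"
proof -
  have "bmat n k l a b D Z E $$ (i, i) = 1" if "i < n" for i
    using that n by (auto simp: bmat_def a E)
  moreover have "bmat n k l a b D Z E $$ (i, j) = 0" if "i < j" "j < n" for i j
  proof -
    have "n - 1 - j < n - 1 - i" "n - 1 - i < k" if "\<not> i < k + l"
      using that \<open>i < j\<close> \<open>j < n\<close> n by auto
    then show ?thesis
      using that by (auto simp: bmat_def a E)
  qed
  ultimately show ?thesis
    by (auto simp: unitriangular_def) (simp add: bmat_def)
qed

section \<open>Enough diagonal, middle and corner isometries for the counting bound\<close>

subsection \<open>Counting isometries\<close>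

text \<open>Only two facts vary between the families. \<open>mid\<close>: any translation of the
  middle variables by linear forms in the x_i can be compensated by adding suitable W_i to the y_i.
  \<open>bot\<close>: sufficiently many shears of the y_i by linear forms in the x_i alone preserve
  the form.\<close>

locale isometries =
  fixes n k l e d \<delta> :: nat and \<epsilon> :: "'a::finite_field" and h \<mu> :: "(nat, 'a) mvpoly"
    and W :: "(nat \<Rightarrow> nat \<Rightarrow> 'a) \<Rightarrow> (nat \<Rightarrow> nat \<Rightarrow> 'a) \<Rightarrow> nat \<Rightarrow> (nat, 'a) mvpoly"
    and \<sigma> :: "(nat \<Rightarrow> nat \<Rightarrow> 'a) \<Rightarrow> nat \<Rightarrow> (nat, 'a) mvpoly"
  assumes card_field: "CARD('a) = CHAR('a) ^ e" and \<delta>: "\<delta> = CHAR('a) ^ d" and \<epsilon>: "\<delta> = 1 \<Longrightarrow> \<epsilon> = 0"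
    and n: "n = 2 * k + l" and h: "h = bilin n k \<delta> \<epsilon> + \<mu>" and \<mu>: "\<mu> \<in> polys_in {k..<k + l}" and l: "l \<le> 2"
    and \<delta>\<delta>: "\<And>c :: 'a. c ^ (\<delta> * \<delta>) = c"
    and W: "\<And>Z D i. W Z D i = (\<Sum>j<k. mconst (Z i j) * mvar j) + (\<Sum>t<l. mconst (D i t) * mvar (k + t))"
    and \<sigma>: "\<And>B i. \<sigma> B i = (\<Sum>j<k. mconst (B (i - k) j) * mvar j) + mvar i"
    and mid: "\<And>B. \<exists>Z D. (\<Sum>i<k. mvar i * W Z D i ^ \<delta> + mconst \<epsilon> * (W Z D i * mvar i ^ \<delta>)) + meval mconst (\<sigma> B) \<mu> = \<mu>"
    and bot: "\<exists>\<Z>. (\<Prod>j<k. \<delta> * CARD('a) ^ j) \<le> card \<Z> \<and> \<Z> \<subseteq> (\<Pi>\<^sub>E i\<in>{..<k}. \<Pi>\<^sub>E j\<in>{..<k}. UNIV)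
      \<and> (\<forall>Z\<in>\<Z>. (\<Sum>i<k. mvar i * (\<Sum>j<k. mconst (Z i j) * mvar j) ^ \<delta>
          + mconst \<epsilon> * ((\<Sum>j<k. mconst (Z i j) * mvar j) * mvar i ^ \<delta>)) = 0)"
begin

abbreviation idm :: "nat \<Rightarrow> nat \<Rightarrow> 'a" where "idm i j \<equiv> (if i = j then 1 else 0)"

lemma delta_pos: "\<delta> > 0"
  by (subst \<delta>) simp

lemma frob_delta: "(f + g :: (nat, 'a) mvpoly) ^ \<delta> = f ^ \<delta> + g ^ \<delta>"
  by (rule freshmans_dream'[where n = d]) (simp_all add: \<delta>)

lemma sum_idm: "i < k \<Longrightarrow> (\<Sum>j<k. mconst (idm i j) * f j) = (f i :: (nat, 'a) mvpoly)"
  by (simp add: if_distrib[of mconst] if_distrib[of "\<lambda>x. x * _"] cong: if_cong)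

lemma lsub_h: "lsub n N h = (\<Sum>i<k. lsub n N (mvar i) * lsub n N (mvar (n - 1 - i)) ^ \<delta>
    + mconst \<epsilon> * (lsub n N (mvar (n - 1 - i)) * lsub n N (mvar i) ^ \<delta>)) + lsub n N \<mu>"
  by (simp add: h bilin_def lsub.hom_add lsub.hom_sum lsub.hom_mult lsub.hom_power)

lemma lsub_mu:
  assumes "\<And>t. t < l \<Longrightarrow> lsub n N (mvar (k + t)) = \<sigma> B (k + t)"
  shows "lsub n N \<mu> = meval mconst (\<sigma> B) \<mu>"
proof (rule polys_in_hom_eqI[OF lsub_hom meval_hom[OF mconst_hom] _ _ \<mu>])
  fix i assume "i \<in> {k..<k + l}"
  then obtain t where "i = k + t" "t < l"
    by (auto simp: le_iff_add)
  then show "lsub n N (mvar i) = meval mconst (\<sigma> B) (mvar i)"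
    using assms by (simp add: meval_mvar[OF mconst_hom])
qed (simp add: meval_mconst[OF mconst_hom])

lemma meval_sigma_0: "meval mconst (\<sigma> (\<lambda>_ _. 0)) \<mu> = \<mu>"
proof (rule polys_in_hom_eqI[OF meval_hom[OF mconst_hom] _ _ _ \<mu>])
  show "comm_semiring_hom (\<lambda>f :: (nat, 'a) mvpoly. f)"
    by unfold_locales auto
qed (simp_all add: meval_mconst[OF mconst_hom] meval_mvar[OF mconst_hom] \<sigma>)

text \<open>Such a matrix fixes the x_i, and y_i -> y_i + W_i is additive under the \<delta>-th
  power, so h changes exactly by the W-terms and the change of \<mu>; the hypothesis says that these
  cancel.\<close>

lemma shear_isom:
  assumes "(\<Sum>i<k. mvar i * W Z D i ^ \<delta> + mconst \<epsilon> * (W Z D i * mvar i ^ \<delta>)) + meval mconst (\<sigma> B) \<mu> = \<mu>"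
  shows "bmat n k l idm B D Z idm \<in> isom n k l h"
  unfolding isom_def
proof (intro CollectI conjI allI impI)
  let ?N = "bmat n k l idm B D Z idm"
  show "?N \<in> unitriangular n"
    by (rule bmat_unitriangular[OF n]) auto
  show "?N $$ (i, j) = 0" if "k \<le> j" "j < i" "i < k + l" for i j
    using that n by (simp add: bmat_def)
  have x: "lsub n ?N (mvar i) = mvar i" if "i < k" for i
    using that by (simp add: lsub_bmat_first[OF n refl] sum_idm)
  have y: "lsub n ?N (mvar (n - 1 - i)) = W Z D i + mvar (n - 1 - i)" if "i < k" for i
    unfolding lsub_bmat_last[OF n refl that] W sum_idm[OF that, of "\<lambda>b. mvar (n - 1 - b)"] ..
  have "lsub n ?N \<mu> = meval mconst (\<sigma> B) \<mu>"
    by (rule lsub_mu) (simp add: lsub_bmat_middle[OF n refl] \<sigma>)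
  moreover have "(\<Sum>i<k. lsub n ?N (mvar i) * lsub n ?N (mvar (n - 1 - i)) ^ \<delta>
      + mconst \<epsilon> * (lsub n ?N (mvar (n - 1 - i)) * lsub n ?N (mvar i) ^ \<delta>))
    = bilin n k \<delta> \<epsilon> + (\<Sum>i<k. mvar i * W Z D i ^ \<delta> + mconst \<epsilon> * (W Z D i * mvar i ^ \<delta>))"
    unfolding bilin_def sum.distrib[symmetric]
  proof (intro sum.cong refl)
    fix i assume "i \<in> {..<k}"
    then have i: "i < k" by simp
    show "lsub n ?N (mvar i) * lsub n ?N (mvar (n - 1 - i)) ^ \<delta>
      + mconst \<epsilon> * (lsub n ?N (mvar (n - 1 - i)) * lsub n ?N (mvar i) ^ \<delta>)
      = mvar i * mvar (n - 1 - i) ^ \<delta> + mconst \<epsilon> * (mvar (n - 1 - i) * mvar i ^ \<delta>)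
        + (mvar i * W Z D i ^ \<delta> + mconst \<epsilon> * (W Z D i * mvar i ^ \<delta>))"
      unfolding x[OF i] y[OF i] frob_delta by (simp only: distrib_left distrib_right add_ac)
  qed
  ultimately have "lsub n ?N h = bilin n k \<delta> \<epsilon>
      + ((\<Sum>i<k. mvar i * W Z D i ^ \<delta> + mconst \<epsilon> * (W Z D i * mvar i ^ \<delta>)) + meval mconst (\<sigma> B) \<mu>)"
    unfolding lsub_h by (simp only: add.assoc)
  then show "lsub n ?N h = h"
    unfolding assms h .
qed

text \<open>Let A act on the x_i and its inverse transpose, with entries raised to the power
  \<delta>, on the y_i. Both summands of the form are then dual pairings: raising to the power
  \<delta> once more restores the entries, because c^(\<delta>\<delta>) = c.\<close>

lemma diagonal_isom:
  assumes A: "A \<in> unitriangular k"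
  shows "\<exists>N\<in>isom n k l h. \<forall>i<k. \<forall>j<k. N $$ (i, j) = A $$ (i, j)"
proof -
  have "matrix_group k (unitriangular k :: 'a mat set)"
    by (rule matrix_groupI) (auto intro: unitriangular_one unitriangular_mult_closed)
  from group_inverse[OF this A] obtain A' where A': "A' \<in> unitriangular k" "A * A' = 1\<^sub>m k" "A' * A = 1\<^sub>m k" .
  have AA': "(\<Sum>i<k. A' $$ (b, i) * A $$ (i, a)) = idm b a" if "a < k" "b < k" for a b
  proof -
    have "(A' * A) $$ (b, a) = (\<Sum>i<k. A' $$ (b, i) * A $$ (i, a))"
      using that A A'(1) by (auto simp: unitriangular_def scalar_prod_def atLeast0LessThan)
    then show ?thesis
      using that by (simp add: A'(3))
  qed
  define N where "N = bmat n k l (\<lambda>i j. A $$ (i, j)) (\<lambda>_ _. 0) (\<lambda>_ _. 0) (\<lambda>_ _. 0) (\<lambda>i b. A' $$ (b, i) ^ \<delta>)"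
  let ?x = "\<lambda>i. \<Sum>a<k. mconst (A $$ (i, a)) * mvar a :: (nat, 'a) mvpoly"
  let ?y = "\<lambda>i. \<Sum>b<k. mconst (A' $$ (b, i) ^ \<delta>) * mvar (n - 1 - b) :: (nat, 'a) mvpoly"
  have x: "lsub n N (mvar i) = ?x i" if "i < k" for i
    by (rule lsub_bmat_first[OF n N_def that])
  have y: "lsub n N (mvar (n - 1 - i)) = ?y i" if "i < k" for i
    using lsub_bmat_last[OF n N_def that] by simp
  have "lsub n N \<mu> = \<mu>"
    by (subst lsub_mu[where B = "\<lambda>_ _. 0"]) (simp_all add: lsub_bmat_middle[OF n N_def] \<sigma> meval_sigma_0)
  have x\<delta>: "?x i ^ \<delta> = (\<Sum>a<k. mconst (A $$ (i, a) ^ \<delta>) * mvar a ^ \<delta>)"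
    and y\<delta>: "?y i ^ \<delta> = (\<Sum>b<k. mconst (A' $$ (b, i)) * mvar (n - 1 - b) ^ \<delta>)" for i
    using \<delta>\<delta> by (simp_all add: frob_sum[OF delta_pos frob_delta] power_mult_distrib flip: mconst.hom_power power_mult)
  \<comment> \<open>A coordinate change and its dual preserve the canonical pairing; used once for
    each of the two summands of \<open>bilin\<close>.\<close>
  have pair: "(\<Sum>i<k. (\<Sum>a<k. mconst (f i a) * p a) * (\<Sum>b<k. mconst (g b i) * q b)) = (\<Sum>a<k. p a * q a)"
    if *: "\<And>a b. a < k \<Longrightarrow> b < k \<Longrightarrow> (\<Sum>i<k. g b i * f i a) = idm b a"
    for f g and p q :: "nat \<Rightarrow> (nat, 'a) mvpoly"
  proof -
    have "(\<Sum>i<k. (\<Sum>a<k. mconst (f i a) * p a) * (\<Sum>b<k. mconst (g b i) * q b))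
        = (\<Sum>i<k. \<Sum>a<k. \<Sum>b<k. mconst (g b i * f i a) * (p a * q b))"
      by (simp add: sum_product mconst.hom_mult mult_ac)
    also have "\<dots> = (\<Sum>a<k. \<Sum>i<k. \<Sum>b<k. mconst (g b i * f i a) * (p a * q b))"
      by (rule sum.swap)
    also have "\<dots> = (\<Sum>a<k. \<Sum>b<k. \<Sum>i<k. mconst (g b i * f i a) * (p a * q b))"
      by (rule sum.cong[OF refl], rule sum.swap)
    also have "\<dots> = (\<Sum>a<k. \<Sum>b<k. if b = a then p a * q b else 0)"
    proof (rule sum.cong[OF refl], rule sum.cong[OF refl])
      fix a b assume "a \<in> {..<k}" "b \<in> {..<k}"
      then have "(\<Sum>i<k. mconst (g b i * f i a)) = (mconst (idm b a) :: (nat, 'a) mvpoly)"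
        using *[of a b] by (simp flip: mconst.hom_sum)
      then show "(\<Sum>i<k. mconst (g b i * f i a) * (p a * q b)) = (if b = a then p a * q b else 0)"
        by (simp flip: sum_distrib_right)
    qed
    finally show ?thesis by simp
  qed
  have s1: "(\<Sum>i<k. ?x i * ?y i ^ \<delta>) = (\<Sum>a<k. mvar a * mvar (n - 1 - a) ^ \<delta>)"
    unfolding y\<delta> by (rule pair[OF AA'])
  have s2: "(\<Sum>i<k. ?x i ^ \<delta> * ?y i) = (\<Sum>a<k. mvar a ^ \<delta> * mvar (n - 1 - a))"
    unfolding x\<delta>
  proof (rule pair)
    fix a b assume ab: "a < k" "b < k"
    have "(\<Sum>i<k. A' $$ (b, i) ^ \<delta> * A $$ (i, a) ^ \<delta>) = (\<Sum>i<k. A' $$ (b, i) * A $$ (i, a)) ^ \<delta>"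
      using \<delta> by (simp add: freshmans_dream_sum'[where n = d] power_mult_distrib)
    then show "(\<Sum>i<k. A' $$ (b, i) ^ \<delta> * A $$ (i, a) ^ \<delta>) = idm b a"
      unfolding AA'[OF ab] using delta_pos by (simp add: power_0_left)
  qed
  have "(\<Sum>i<k. ?y i * ?x i ^ \<delta>) = (\<Sum>i<k. ?x i ^ \<delta> * ?y i)"
    by (rule sum.cong[OF refl], rule mult.commute)
  also have "\<dots> = (\<Sum>a<k. mvar (n - 1 - a) * mvar a ^ \<delta>)"
    unfolding s2 by (rule sum.cong[OF refl], rule mult.commute)
  finally have "(\<Sum>i<k. ?x i * ?y i ^ \<delta> + mconst \<epsilon> * (?y i * ?x i ^ \<delta>)) = bilin n k \<delta> \<epsilon>"
    unfolding bilin_def sum.distrib s1 sum_distrib_left[symmetric] by (rule arg_cong)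
  moreover have "lsub n N (mvar i) * lsub n N (mvar (n - 1 - i)) ^ \<delta>
      + mconst \<epsilon> * (lsub n N (mvar (n - 1 - i)) * lsub n N (mvar i) ^ \<delta>)
    = ?x i * ?y i ^ \<delta> + mconst \<epsilon> * (?y i * ?x i ^ \<delta>)" if "i \<in> {..<k}" for i
    unfolding x[OF that[unfolded lessThan_iff]] y[OF that[unfolded lessThan_iff]] ..
  ultimately have "(\<Sum>i<k. lsub n N (mvar i) * lsub n N (mvar (n - 1 - i)) ^ \<delta>
      + mconst \<epsilon> * (lsub n N (mvar (n - 1 - i)) * lsub n N (mvar i) ^ \<delta>)) = bilin n k \<delta> \<epsilon>"
    by (rule trans[OF sum.cong[OF refl], rotated])
  then have "lsub n N h = h"
    unfolding lsub_h \<open>lsub n N \<mu> = \<mu>\<close> by (simp only: h)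
  moreover have "N \<in> unitriangular n"
    unfolding N_def using A A' delta_pos
    by (intro bmat_unitriangular[OF n]) (auto simp: unitriangular_def power_0_left)
  moreover have "N $$ (i, j) = 0" if "k \<le> j" "j < i" "i < k + l" for i j
    using that n by (simp add: N_def bmat_def)
  moreover have "\<forall>i<k. \<forall>j<k. N $$ (i, j) = A $$ (i, j)"
    using n by (simp add: N_def bmat_def)
  ultimately show ?thesis
    unfolding isom_def by (intro bexI[of _ N]) auto
qed

lemma h_poly_ring: "h \<in> poly_ring n"
proof -
  have "\<mu> \<in> poly_ring n"
    using n by (intro subsetD[OF polys_in_mono \<mu>]) auto
  moreover have "bilin n k \<delta> \<epsilon> \<in> poly_ring n"
    unfolding bilin_def using n
    by (intro polys_in_sum polys_in_add polys_in_mult polys_in_power polys_in_mvar polys_in_mconst) auto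
  ultimately show ?thesis
    unfolding h by (rule polys_in_add[rotated])
qed

lemma group: "matrix_group n (isom n k l h)"
  using h_poly_ring l n by (intro isom_matrix_group) auto

lemma card_isom: "(\<Prod>i<k. CARD('a) ^ i) * (CARD('a) ^ k) ^ l * (\<Prod>j<k. \<delta> * CARD('a) ^ j) \<le> card (isom n k l h)"
proof -
  obtain \<Z> where \<Z>: "(\<Prod>j<k. \<delta> * CARD('a) ^ j) \<le> card \<Z>" "\<Z> \<subseteq> (\<Pi>\<^sub>E i\<in>{..<k}. \<Pi>\<^sub>E j\<in>{..<k}. UNIV)"
    "\<And>Z. Z \<in> \<Z> \<Longrightarrow> (\<Sum>i<k. mvar i * (\<Sum>j<k. mconst (Z i j) * mvar j) ^ \<delta>
          + mconst \<epsilon> * ((\<Sum>j<k. mconst (Z i j) * mvar j) * mvar i ^ \<delta>)) = 0"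
    using bot by blast
  let ?z = "\<lambda>_ _. 0 :: 'a" and ?N = "\<lambda>Z. bmat n k l idm (\<lambda>_ _. 0) (\<lambda>_ _. 0) Z idm"
  have W0: "W Z ?z i = (\<Sum>j<k. mconst (Z i j) * mvar j)" for Z i
    by (simp add: W)
  have mem: "?N Z \<in> isom n k l h" if "Z \<in> \<Z>" for Z
    by (rule shear_isom) (simp add: W0 \<Z>(3)[OF that] meval_sigma_0)
  have "inj_on ?N \<Z>"
  proof (rule inj_onI)
    fix Y Z assume Z: "Y \<in> \<Z>" "Z \<in> \<Z>" and eq: "?N Y = ?N Z"
    then have Z': "Y \<in> (\<Pi>\<^sub>E i\<in>{..<k}. \<Pi>\<^sub>E j\<in>{..<k}. UNIV)" "Z \<in> (\<Pi>\<^sub>E i\<in>{..<k}. \<Pi>\<^sub>E j\<in>{..<k}. UNIV)"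
      using \<Z>(2) by auto
    show "Y = Z"
    proof (rule PiE_ext[OF Z'])
      fix i assume i: "i \<in> {..<k}"
      show "Y i = Z i"
      proof (rule PiE_ext)
        show "Y i \<in> (\<Pi>\<^sub>E j\<in>{..<k}. UNIV)" "Z i \<in> (\<Pi>\<^sub>E j\<in>{..<k}. UNIV)"
          using Z' i by (auto simp: PiE_iff)
        fix j assume j: "j \<in> {..<k}"
        have "n - 1 - i < n" "\<not> n - 1 - i < k + l" "\<not> n - 1 - i < k" "n - 1 - (n - 1 - i) = i" "j < n"
          using i j n by auto
        with arg_cong[OF eq, of "\<lambda>M. M $$ (n - 1 - i, j)"] j show "Y i j = Z i j"
          by (simp add: bmat_def)
      qed
    qed
  qed
  then have card: "card (?N ` \<Z>) = card \<Z>"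
    by (rule card_image)
  have "(\<Prod>i<k. CARD('a) ^ i) * (CARD('a) ^ k) ^ l * card (?N ` \<Z>) \<le> card (isom n k l h)"
  proof (rule card_group_ge[OF group _ diagonal_isom])
    fix B :: "nat \<Rightarrow> nat \<Rightarrow> 'a"
    obtain Z D where "(\<Sum>i<k. mvar i * W Z D i ^ \<delta> + mconst \<epsilon> * (W Z D i * mvar i ^ \<delta>)) + meval mconst (\<sigma> B) \<mu> = \<mu>"
      using mid[of B] by blast
    from shear_isom[OF this] show "\<exists>N\<in>isom n k l h. (\<forall>i<k. \<forall>j<n. N $$ (i, j) = idm i j)
      \<and> (\<forall>t<l. \<forall>j<k. N $$ (k + t, j) = B t j)"
      by (rule bexI[rotated]) (use n in \<open>auto simp: bmat_def\<close>)
  next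
    fix N i j assume "N \<in> ?N ` \<Z>" "i < k + l" "j < n"
    then show "N $$ (i, j) = idm i j"
      using n by (auto simp: bmat_def)
  qed (use mem n in auto)
  then show ?thesis
    unfolding card using mult_le_mono2[OF \<Z>(1), of "(\<Prod>i<k. CARD('a) ^ i) * (CARD('a) ^ k) ^ l"] by linarith
qed

lemma form_invariants: "form_invariants n k l e d \<delta> \<epsilon> h \<mu> (isom n k l h)"
proof (rule form_invariants.intro)
  show "isom n k l h \<subseteq> unitriangular n"
    and "N \<in> isom n k l h \<Longrightarrow> lsub n N h = h"
    and "N \<in> isom n k l h \<Longrightarrow> k \<le> j \<Longrightarrow> j < i \<Longrightarrow> i < k + l \<Longrightarrow> N $$ (i, j) = 0" for N i j
    by (auto simp: isom_def)
qed (fact card_field \<delta> \<epsilon> n h \<mu> group diagonal_isom card_isom)+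

end

section \<open>Translating between polynomials and their coefficient matrices\<close>

section \<open>Forms and their matrices\<close>

definition mform :: "nat \<Rightarrow> nat \<Rightarrow> (nat \<Rightarrow> nat \<Rightarrow> 'a::comm_ring_1) \<Rightarrow> (nat, 'a) mvpoly" where
  "mform n q T = (\<Sum>i<n. \<Sum>j<n. mconst (T i j) * (mvar i * mvar j ^ q))"

definition transform :: "nat \<Rightarrow> nat \<Rightarrow> (nat \<Rightarrow> nat \<Rightarrow> 'a) \<Rightarrow> 'a::comm_ring_1 mat \<Rightarrow> nat \<Rightarrow> nat \<Rightarrow> 'a" where
  "transform n q T N a b = (\<Sum>i<n. \<Sum>j<n. N $$ (i, a) * T i j * N $$ (j, b) ^ q)"

lemma sum_swap_middle:
  "(\<Sum>i\<in>I. \<Sum>j\<in>J. \<Sum>a\<in>A. \<Sum>b\<in>B. f i j a b) = (\<Sum>a\<in>A. \<Sum>b\<in>B. \<Sum>i\<in>I. \<Sum>j\<in>J. f i j a b)"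
proof -
  have "(\<Sum>i\<in>I. \<Sum>j\<in>J. \<Sum>a\<in>A. \<Sum>b\<in>B. f i j a b) = (\<Sum>i\<in>I. \<Sum>a\<in>A. \<Sum>j\<in>J. \<Sum>b\<in>B. f i j a b)"
    by (rule sum.cong[OF refl], rule sum.swap)
  also have "\<dots> = (\<Sum>a\<in>A. \<Sum>i\<in>I. \<Sum>j\<in>J. \<Sum>b\<in>B. f i j a b)"
    by (rule sum.swap)
  also have "\<dots> = (\<Sum>a\<in>A. \<Sum>i\<in>I. \<Sum>b\<in>B. \<Sum>j\<in>J. f i j a b)"
    by (rule sum.cong[OF refl], rule sum.cong[OF refl], rule sum.swap)
  also have "\<dots> = (\<Sum>a\<in>A. \<Sum>b\<in>B. \<Sum>i\<in>I. \<Sum>j\<in>J. f i j a b)"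
    by (rule sum.cong[OF refl], rule sum.swap)
  finally show ?thesis .
qed

lemma lsub_mform:
  fixes T :: "nat \<Rightarrow> nat \<Rightarrow> 'a::comm_ring_1"
  assumes q: "q > 0" and frob: "\<And>f g :: (nat, 'a) mvpoly. (f + g) ^ q = f ^ q + g ^ q"
  shows "lsub n N (mform n q T) = mform n q (transform n q T N)"
proof -
  have "lsub n N (mform n q T) = (\<Sum>i<n. \<Sum>j<n. mconst (T i j) *
      ((\<Sum>a<n. mconst (N $$ (i, a)) * mvar a) * (\<Sum>b<n. mconst (N $$ (j, b) ^ q) * mvar b ^ q)))"
    by (simp add: mform_def lsub.hom_sum lsub.hom_mult lsub.hom_power lsub_mvar frob_sum[OF q frob]
        power_mult_distrib mconst.hom_power)
  also have "\<dots> = (\<Sum>i<n. \<Sum>j<n. \<Sum>a<n. \<Sum>b<n. mconst (N $$ (i, a) * T i j * N $$ (j, b) ^ q) * (mvar a * mvar b ^ q))"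
    unfolding sum_product unfolding sum_distrib_left
    by (intro sum.cong refl) (simp only: mconst.hom_mult mult_ac)
  also have "\<dots> = (\<Sum>a<n. \<Sum>b<n. \<Sum>i<n. \<Sum>j<n. mconst (N $$ (i, a) * T i j * N $$ (j, b) ^ q) * (mvar a * mvar b ^ q))"
    by (rule sum_swap_middle)
  also have "\<dots> = mform n q (transform n q T N)"
    unfolding mform_def transform_def mconst.hom_sum sum_distrib_right ..
  finally show ?thesis .
qed

text \<open>The monomial x_a x_b^q comes from the entry (a, b) alone, except that for q = 1 the
  entry (b, a) produces it as well.\<close>

lemma lookup_mform:
  assumes ab: "a < n" "b < n" and q: "q > 0"
  shows "Poly_Mapping.lookup (mform n q T) (Poly_Mapping.single a 1 + Poly_Mapping.single b q)
    = T a b + (if q = 1 \<and> a \<noteq> b then T b a else 0)"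
proof -
  let ?m = "\<lambda>i j. Poly_Mapping.single i 1 + Poly_Mapping.single j q :: nat \<Rightarrow>\<^sub>0 nat"
  have eq: "?m i j = ?m a b \<longleftrightarrow> i = a \<and> j = b \<or> q = 1 \<and> i = b \<and> j = a" for i j
  proof
    assume *: "?m i j = ?m a b"
    have "Poly_Mapping.lookup (?m i j) x = Poly_Mapping.lookup (?m a b) x" for x
      by (simp only: *)
    from this[of i] this[of j] this[of a] this[of b] q
    show "i = a \<and> j = b \<or> q = 1 \<and> i = b \<and> j = a"
      by (auto simp: lookup_add lookup_single when_def split: if_splits)
  qed (auto simp: add.commute)
  have "mvar i * mvar j ^ q = (Poly_Mapping.single (?m i j) 1 :: (nat, 'a) mvpoly)" for i j
    unfolding mvar_power by (simp add: mvar_def mult_single)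
  then have "Poly_Mapping.lookup (mform n q T) (?m a b) = (\<Sum>i<n. \<Sum>j<n. if ?m i j = ?m a b then T i j else 0)"
    by (simp add: mform_def lookup_sum lookup_mconst_mult lookup_single when_def if_distrib[of "\<lambda>x. _ * x"] cong: if_cong)
  also have "\<dots> = (\<Sum>i<n. \<Sum>j<n. (if i = a then if j = b then T i j else 0 else 0)
      + (if i = b then if j = a then if q = 1 \<and> a \<noteq> b then T b a else 0 else 0 else 0))"
    unfolding eq by (intro sum.cong refl) auto
  also have "\<dots> = T a b + (if q = 1 \<and> a \<noteq> b then T b a else 0)"
  proof -
    have dbl: "(\<Sum>i<n. \<Sum>j<n. (if i = c then if j = d then f i j else 0 else 0)) = f c d"
      if "c < n" "d < n" for c d and f :: "nat \<Rightarrow> nat \<Rightarrow> 'a"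
    proof -
      have "(\<Sum>i<n. \<Sum>j<n. (if i = c then if j = d then f i j else 0 else 0)) = (\<Sum>i<n. if i = c then f i d else 0)"
        using that by (intro sum.cong refl) simp
      then show ?thesis
        using that by simp
    qed
    show ?thesis
      unfolding sum.distrib dbl[OF ab] dbl[OF ab(2,1), of "\<lambda>_ _. if q = 1 \<and> a \<noteq> b then T b a else 0"] ..
  qed
  finally show ?thesis .
qed

lemma mform_cong: "(\<And>i j. i < n \<Longrightarrow> j < n \<Longrightarrow> S i j = T i j) \<Longrightarrow> mform n q S = mform n q T"
  unfolding mform_def by (intro sum.cong refl) simp

lemma mform_eq_iff:
  fixes S T :: "nat \<Rightarrow> nat \<Rightarrow> 'a::comm_ring_1"
  assumes "q \<ge> 2"
  shows "mform n q S = mform n q T \<longleftrightarrow> (\<forall>i<n. \<forall>j<n. S i j = T i j)"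
proof
  assume eq: "mform n q S = mform n q T"
  show "\<forall>i<n. \<forall>j<n. S i j = T i j"
  proof (intro allI impI)
    fix i j assume "i < n" "j < n"
    with arg_cong[OF eq, of "\<lambda>f. Poly_Mapping.lookup f (Poly_Mapping.single i 1 + Poly_Mapping.single j q)"] assms
    show "S i j = T i j"
      by (simp only: lookup_mform) simp
  qed
qed (auto intro: mform_cong)

lemma mform_1_diff: "mform n q S - mform n q T = mform n q (\<lambda>i j. S i j - T i j)"
  by (simp add: mform_def mconst_ring.hom_minus left_diff_distrib sum_subtractf)

text \<open>Peel off the last variable: its row and column cancel and its diagonal entry is
  zero.\<close>

lemma mform_1_alternating:
  fixes T :: "nat \<Rightarrow> nat \<Rightarrow> 'a::comm_ring_1"
  shows "(\<And>i. i < n \<Longrightarrow> T i i = 0) \<Longrightarrow> (\<And>i j. i < n \<Longrightarrow> j < n \<Longrightarrow> T i j + T j i = 0) \<Longrightarrow> mform n 1 T = 0"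
proof (induction n)
  case (Suc n)
  have T: "T j n = - T n j" if "j < n" for j
    using Suc.prems(2)[of j n] that by (simp add: eq_neg_iff_add_eq_0)
  have "mform (Suc n) 1 T = mform n 1 T + (\<Sum>i<n. mconst (T i n) * (mvar i * mvar n))
      + ((\<Sum>j<n. mconst (T n j) * (mvar n * mvar j)) + mconst (T n n) * (mvar n * mvar n))"
    by (simp add: mform_def sum.distrib)
  also have "mform n 1 T = 0"
    using Suc.prems by (intro Suc.IH) auto
  also have "T n n = 0"
    using Suc.prems(1) by simp
  also have "(\<Sum>i<n. mconst (T i n) * (mvar i * mvar n)) = (\<Sum>i<n. - (mconst (T n i) * (mvar n * mvar i)))"
    by (intro sum.cong refl) (simp add: T mconst_ring.hom_uminus mult.commute)
  finally show ?case
    by (simp add: sum_negf)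
qed (simp add: mform_def)

lemma mform_1_eq_iff:
  fixes S T :: "nat \<Rightarrow> nat \<Rightarrow> 'a::comm_ring_1"
  shows "mform n 1 S = mform n 1 T \<longleftrightarrow>
    (\<forall>i<n. \<forall>j<n. S i j + S j i = T i j + T j i) \<and> (\<forall>i<n. S i i = T i i)"
proof
  assume eq: "mform n 1 S = mform n 1 T"
  have *: "S i j + (if i \<noteq> j then S j i else 0) = T i j + (if i \<noteq> j then T j i else 0)" if "i < n" "j < n" for i j
    using arg_cong[OF eq, of "\<lambda>f. Poly_Mapping.lookup f (Poly_Mapping.single i 1 + Poly_Mapping.single j 1)"] that
    by (simp add: lookup_mform[where q = 1, simplified])
  have "S i i = T i i" if "i < n" for i
    using *[OF that that] by simp
  moreover have "S i j + S j i = T i j + T j i" if "i < n" "j < n" for i j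
    using *[OF that] calculation[OF that(1)] by (cases "i = j") auto
  ultimately show "(\<forall>i<n. \<forall>j<n. S i j + S j i = T i j + T j i) \<and> (\<forall>i<n. S i i = T i i)"
    by blast
next
  assume *: "(\<forall>i<n. \<forall>j<n. S i j + S j i = T i j + T j i) \<and> (\<forall>i<n. S i i = T i i)"
  have "mform n 1 (\<lambda>i j. S i j - T i j) = 0"
    using * by (intro mform_1_alternating) (auto simp: algebra_simps)
  then show "mform n 1 S = mform n 1 T"
    unfolding mform_1_diff[symmetric] by simp
qed

lemma transform_mat:
  fixes Y N :: "'a::field mat"
  assumes "Y \<in> carrier_mat n n" "N \<in> carrier_mat n n" "a < n" "b < n"
  shows "(transpose_mat N * Y * bar q N) $$ (a, b) = transform n q (\<lambda>i j. Y $$ (i, j)) N a b"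
proof -
  have "(transpose_mat N * Y * bar q N) $$ (a, b) = (\<Sum>i<n. N $$ (i, a) * (\<Sum>j<n. Y $$ (i, j) * N $$ (j, b) ^ q))"
    using assms by (auto simp: bar_def scalar_prod_def atLeast0LessThan)
  then show ?thesis
    by (simp add: transform_def sum_distrib_left mult.assoc)
qed

lemma preserves_mat_iff:
  fixes Y N :: "'a::field mat"
  assumes "Y \<in> carrier_mat n n" "N \<in> carrier_mat n n"
  shows "transpose_mat N * Y * bar q N = Y \<longleftrightarrow> (\<forall>a<n. \<forall>b<n. transform n q (\<lambda>i j. Y $$ (i, j)) N a b = Y $$ (a, b))"
proof
  assume eq: "transpose_mat N * Y * bar q N = Y"
  then show "\<forall>a<n. \<forall>b<n. transform n q (\<lambda>i j. Y $$ (i, j)) N a b = Y $$ (a, b)"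
    using transform_mat[OF assms, of _ _ q] by simp
next
  assume *: "\<forall>a<n. \<forall>b<n. transform n q (\<lambda>i j. Y $$ (i, j)) N a b = Y $$ (a, b)"
  show "transpose_mat N * Y * bar q N = Y"
  proof (rule eq_matI)
    fix i j assume "i < dim_row Y" "j < dim_col Y"
    then show "(transpose_mat N * Y * bar q N) $$ (i, j) = Y $$ (i, j)"
      using * assms transform_mat[OF assms, of i j q] by auto
  qed (use assms in \<open>auto simp: bar_def\<close>)
qed

lemma transform_cong:
  "(\<And>i j. i < n \<Longrightarrow> j < n \<Longrightarrow> S i j = T i j) \<Longrightarrow> transform n q S N a b = transform n q T N a b"
  unfolding transform_def by (intro sum.cong refl) simp

lemma transform_add: "transform n q (\<lambda>i j. S i j + T i j) N a b = transform n q S N a b + transform n q T N a b"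
  by (simp add: transform_def distrib_left distrib_right sum.distrib)

lemma transform_flip: "transform n 1 (\<lambda>i j. T j i) N a b = transform n 1 T N b a"
  unfolding transform_def by (subst sum.swap) (simp add: mult_ac)

text \<open>Coefficient matrix of h. With \<epsilon> = 0 only one of the two antidiagonal corners is
  filled, which is the non-symmetric matrix of a quadratic form in which each x_i y_i occurs
  once.\<close>

definition block_form :: "nat \<Rightarrow> nat \<Rightarrow> nat \<Rightarrow> 'a \<Rightarrow> (nat \<Rightarrow> nat \<Rightarrow> 'a) \<Rightarrow> nat \<Rightarrow> nat \<Rightarrow> 'a::comm_ring_1" where
  "block_form n k l \<epsilon> P i j = (if i < k then if j = n - 1 - i then 1 else 0
     else if i < k + l then if k \<le> j \<and> j < k + l then P (i - k) (j - k) else 0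
     else if j = n - 1 - i then \<epsilon> else 0)"

text \<open>Stated for any summand that vanishes on zero entries, so that one computation serves
  both the polynomial (\<open>mform\<close>) and the transformed matrix
  (\<open>transform\<close>).\<close>

lemma sum_block_form:
  assumes n: "n = 2 * k + l" and F: "\<And>i j. F 0 i j = (0 :: 'b::comm_monoid_add)"
  shows "(\<Sum>i<n. \<Sum>j<n. F (block_form n k l \<epsilon> P i j) i j) =
    (\<Sum>i<k. F 1 i (n - 1 - i) + F \<epsilon> (n - 1 - i) i) + (\<Sum>s<l. \<Sum>t<l. F (P s t) (k + s) (k + t))"
proof -
  have single: "(\<Sum>j<n. F (if j = c then x else 0) i j) = F x i c" if "c < n" for c x i
  proof -
    have "(\<Sum>j<n. F (if j = c then x else 0) i j) = (\<Sum>j<n. if j = c then F x i c else 0)"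
      by (intro sum.cong) (auto simp: F)
    then show ?thesis
      using that by simp
  qed
  have 1: "(\<Sum>j<n. F (block_form n k l \<epsilon> P i j) i j) = F 1 i (n - 1 - i)" if "i < k" for i
    using that n single[of "n - 1 - i" 1 i] by (simp add: block_form_def)
  have 3: "(\<Sum>j<n. F (block_form n k l \<epsilon> P (n - 1 - i) j) (n - 1 - i) j) = F \<epsilon> (n - 1 - i) i" if "i < k" for i
  proof -
    have "\<not> n - 1 - i < k" "\<not> n - 1 - i < k + l" "n - 1 - (n - 1 - i) = i" "i < n"
      using that n by auto
    then show ?thesis
      using single[of i \<epsilon> "n - 1 - i"] by (simp add: block_form_def)
  qed
  have 2: "(\<Sum>j<n. F (block_form n k l \<epsilon> P (k + s) j) (k + s) j) = (\<Sum>t<l. F (P s t) (k + s) (k + t))" if s: "s < l" for s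
  proof -
    have kn: "k \<le> n" using n by simp
    have "(\<Sum>j<k. F (block_form n k l \<epsilon> P (k + s) j) (k + s) j) = 0"
      using s by (intro sum.neutral) (auto simp: block_form_def F)
    moreover have "(\<Sum>b<k. F (block_form n k l \<epsilon> P (k + s) (n - 1 - b)) (k + s) (n - 1 - b)) = 0"
      using s n by (intro sum.neutral) (auto simp: block_form_def F)
    moreover have "(\<Sum>t<l. F (block_form n k l \<epsilon> P (k + s) (k + t)) (k + s) (k + t)) = (\<Sum>t<l. F (P s t) (k + s) (k + t))"
      using s by (intro sum.cong refl) (auto simp: block_form_def)
    ultimately show ?thesis
      unfolding sum_split_blocks[OF n] by simp
  qed
  show ?thesis
    unfolding sum_split_blocks[OF n, of "\<lambda>i. \<Sum>j<n. F (block_form n k l \<epsilon> P i j) i j"]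
    using 1 2 3 by (simp add: sum.distrib add_ac)
qed

lemma mform_block_form:
  assumes n: "n = 2 * k + l"
  shows "mform n q (block_form n k l \<epsilon> P) = bilin n k q \<epsilon>
    + (\<Sum>s<l. \<Sum>t<l. mconst (P s t) * (mvar (k + s) * mvar (k + t) ^ q))"
  unfolding mform_def bilin_def
  by (subst sum_block_form[OF n, of "\<lambda>x i j. mconst x * (mvar i * mvar j ^ q)"]) simp_all

section \<open>Verification of the \<open>isometries\<close> conditions family by family\<close>

section \<open>The six families of forms\<close>

text \<open>A matrix with a Hermitian-type symmetry is free below the diagonal, constrained on it,
  and determined above it by \<open>g\<close> applied to the mirrored entry.\<close>

definition completion :: "nat \<Rightarrow> ('a \<Rightarrow> 'a) \<Rightarrow> (nat \<Rightarrow> nat \<Rightarrow> 'a) \<Rightarrow> nat \<Rightarrow> nat \<Rightarrow> 'a" where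
  "completion k g z = (\<lambda>i\<in>{..<k}. \<lambda>j\<in>{..<k}. if j \<le> i then z i j else g (z j i))"

definition lower_entries :: "nat \<Rightarrow> 'a set \<Rightarrow> (nat \<Rightarrow> nat \<Rightarrow> 'a) set" where
  "lower_entries k D = (\<Pi>\<^sub>E i\<in>{..<k}. \<Pi>\<^sub>E j\<in>{..<Suc i}. if j < i then UNIV else D)"

lemma completion_in: "completion k g z \<in> (\<Pi>\<^sub>E i\<in>{..<k}. \<Pi>\<^sub>E j\<in>{..<k}. UNIV)"
  by (auto simp: completion_def)

lemma card_completion:
  fixes D :: "'a::finite set"
  shows "card (completion k g ` lower_entries k D) = (\<Prod>i<k. card D * CARD('a) ^ i)"
proof -
  have "inj_on (completion k g) (lower_entries k D)"
  proof (rule inj_onI)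
    fix y z assume yz: "y \<in> lower_entries k D" "z \<in> lower_entries k D"
      and eq: "completion k g y = completion k g z"
    show "y = z"
    proof (rule PiE_ext[OF yz[unfolded lower_entries_def]])
      fix i assume i: "i \<in> {..<k}"
      show "y i = z i"
      proof (rule PiE_ext)
        show "y i \<in> (\<Pi>\<^sub>E j\<in>{..<Suc i}. if j < i then UNIV else D)"
          "z i \<in> (\<Pi>\<^sub>E j\<in>{..<Suc i}. if j < i then UNIV else D)"
          using PiE_mem[OF yz(1)[unfolded lower_entries_def] i] PiE_mem[OF yz(2)[unfolded lower_entries_def] i] .
        fix j assume "j \<in> {..<Suc i}"
        with i fun_cong[OF fun_cong[OF eq, of i], of j] show "y i j = z i j"
          by (simp add: completion_def)
      qed
    qed
  qed
  moreover have "card (lower_entries k D) = (\<Prod>i<k. card D * CARD('a) ^ i)"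
    unfolding lower_entries_def
  proof (subst card_PiE, simp, rule prod.cong[OF refl])
    fix i
    have "(\<Prod>j<i. card (if j < i then UNIV else D)) = CARD('a) ^ i"
      by simp
    then show "card (\<Pi>\<^sub>E j\<in>{..<Suc i}. if j < i then UNIV else D) = card D * CARD('a) ^ i"
      by (simp add: card_PiE)
  qed
  ultimately show ?thesis
    by (simp add: card_image)
qed

text \<open>Hermitian-type matrices: the solutions of \<open>Z i j ^ \<delta> + \<epsilon> * Z j i = 0\<close>.\<close>

lemma bottom_sesquilinear:
  fixes \<epsilon> :: "'a::finite_field"
  assumes \<delta>: "\<delta> = CHAR('a) ^ d" and \<delta>\<delta>: "\<And>c :: 'a. c ^ (\<delta> * \<delta>) = c"
    and \<epsilon>: "\<epsilon> = 1 \<or> \<epsilon> = - 1" and ker: "\<delta> \<le> card {s. s ^ \<delta> + \<epsilon> * s = 0}"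
  shows "\<exists>\<Z>. (\<Prod>j<k. \<delta> * CARD('a) ^ j) \<le> card \<Z> \<and> \<Z> \<subseteq> (\<Pi>\<^sub>E i\<in>{..<k}. \<Pi>\<^sub>E j\<in>{..<k}. UNIV)
      \<and> (\<forall>Z\<in>\<Z>. (\<Sum>i<k. mvar i * (\<Sum>j<k. mconst (Z i j) * mvar j) ^ \<delta>
          + mconst \<epsilon> * ((\<Sum>j<k. mconst (Z i j) * mvar j) * mvar i ^ \<delta>)) = (0 :: (nat, 'a) mvpoly))"
proof (intro exI conjI ballI)
  let ?D = "{s. s ^ \<delta> + \<epsilon> * s = 0}" and ?g = "\<lambda>s. - \<epsilon> * s ^ \<delta>"
  let ?\<Z> = "completion k ?g ` lower_entries k ?D"
  have \<delta>0: "\<delta> > 0"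
    by (subst \<delta>) simp
  have frob: "(f + g :: (nat, 'a) mvpoly) ^ \<delta> = f ^ \<delta> + g ^ \<delta>" for f g
    by (rule freshmans_dream'[where n = d]) (simp_all add: \<delta>)
  have frob': "(f + g :: 'a) ^ \<delta> = f ^ \<delta> + g ^ \<delta>" for f g
    by (rule freshmans_dream'[where n = d]) (simp_all add: \<delta>)
  \<comment> \<open>Additivity of the \<delta>-th power gives (-1)^\<delta> = -1, uniformly in all
    characteristics.\<close>
  have \<epsilon>\<delta>: "(- \<epsilon>) ^ \<delta> = - \<epsilon>"
  proof -
    have "1 + (- 1 :: 'a) ^ \<delta> = (1 + - 1) ^ \<delta>"
      unfolding frob' by (simp only: power_one)
    also have "\<dots> = 0"
      using \<delta>0 by (simp only: add.right_inverse zero_power)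
    finally have "1 + (- 1 :: 'a) ^ \<delta> = 0" .
    then have "(- 1 :: 'a) ^ \<delta> = - 1"
      by (simp only: add_eq_0_iff)
    with \<epsilon> show ?thesis by auto
  qed
  show "(\<Prod>j<k. \<delta> * CARD('a) ^ j) \<le> card ?\<Z>"
    unfolding card_completion by (intro prod_mono conjI mult_le_mono1 ker le0)
  show "?\<Z> \<subseteq> (\<Pi>\<^sub>E i\<in>{..<k}. \<Pi>\<^sub>E j\<in>{..<k}. UNIV)"
    by (intro image_subsetI completion_in)
  fix Z assume "Z \<in> ?\<Z>"
  then obtain z where z: "z \<in> lower_entries k ?D" "Z = completion k ?g z" by blast
  have diag: "z i i ^ \<delta> + \<epsilon> * z i i = 0" if "i < k" for i
  proof -
    have "z i \<in> (\<Pi>\<^sub>E j\<in>{..<Suc i}. if j < i then UNIV else ?D)"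
      using z(1) that unfolding lower_entries_def by (intro PiE_mem[of z "{..<k}"]) auto
    from PiE_mem[OF this, of i] show ?thesis by simp
  qed
  have rel: "Z i j ^ \<delta> + \<epsilon> * Z j i = 0" if ij: "i < k" "j < k" for i j
  proof -
    consider "j < i" | "i = j" | "i < j" by linarith
    then show ?thesis
    proof cases
      case 1
      then have "Z i j = z i j" "Z j i = - \<epsilon> * z i j ^ \<delta>"
        using ij by (simp_all add: z(2) completion_def)
      then show ?thesis
        using \<epsilon> by auto
    next
      case 2
      then show ?thesis
        using diag[OF ij(1)] ij by (simp add: z(2) completion_def)
    next
      case 3
      then have "Z i j = - \<epsilon> * z j i ^ \<delta>" "Z j i = z j i"
        using ij by (simp_all add: z(2) completion_def)
      moreover have "(- \<epsilon> * z j i ^ \<delta>) ^ \<delta> = - \<epsilon> * z j i"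
        unfolding power_mult_distrib \<epsilon>\<delta> by (simp add: \<delta>\<delta> flip: power_mult)
      ultimately show ?thesis by simp
    qed
  qed
  have "(\<Sum>i<k. mvar i * (\<Sum>j<k. mconst (Z i j) * mvar j) ^ \<delta>)
      = (\<Sum>i<k. \<Sum>j<k. mconst (Z i j ^ \<delta>) * (mvar i * mvar j ^ \<delta>))"
    by (simp add: frob_sum[OF \<delta>0 frob] power_mult_distrib sum_distrib_left mconst.hom_power mult_ac)
  moreover have "(\<Sum>i<k. mconst \<epsilon> * ((\<Sum>j<k. mconst (Z i j) * mvar j) * mvar i ^ \<delta>))
      = (\<Sum>i<k. \<Sum>j<k. mconst (\<epsilon> * Z j i) * (mvar i * mvar j ^ \<delta>))"
    by (subst sum.swap) (simp add: sum_distrib_left sum_distrib_right mconst.hom_mult mult_ac)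
  ultimately have "(\<Sum>i<k. mvar i * (\<Sum>j<k. mconst (Z i j) * mvar j) ^ \<delta>
          + mconst \<epsilon> * ((\<Sum>j<k. mconst (Z i j) * mvar j) * mvar i ^ \<delta>))
      = (\<Sum>i<k. \<Sum>j<k. mconst (Z i j ^ \<delta> + \<epsilon> * Z j i) * (mvar i * mvar j ^ \<delta>))"
    by (simp add: sum.distrib mconst.hom_add distrib_right)
  also have "\<dots> = 0"
    by (simp add: rel)
  finally show "(\<Sum>i<k. mvar i * (\<Sum>j<k. mconst (Z i j) * mvar j) ^ \<delta>
          + mconst \<epsilon> * ((\<Sum>j<k. mconst (Z i j) * mvar j) * mvar i ^ \<delta>)) = (0 :: (nat, 'a) mvpoly)" .
qed

text \<open>For a quadratic form the corner shears are the alternating matrices; a zero diagonal has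
  to be imposed separately for the sake of characteristic 2.\<close>

lemma bottom_alternating:
  "\<exists>\<Z>. (\<Prod>j<k. 1 * CARD('a) ^ j) \<le> card \<Z> \<and> \<Z> \<subseteq> (\<Pi>\<^sub>E i\<in>{..<k}. \<Pi>\<^sub>E j\<in>{..<k}. UNIV)
      \<and> (\<forall>Z\<in>\<Z>. (\<Sum>i<k. mvar i * (\<Sum>j<k. mconst (Z i j) * mvar j) ^ 1
          + mconst 0 * ((\<Sum>j<k. mconst (Z i j) * mvar j) * mvar i ^ 1)) = (0 :: (nat, 'a::finite_field) mvpoly))"
proof (intro exI conjI ballI)
  let ?\<Z> = "completion k uminus ` lower_entries k {0 :: 'a}"
  show "(\<Prod>j<k. 1 * CARD('a) ^ j) \<le> card ?\<Z>"
    unfolding card_completion by simp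
  show "?\<Z> \<subseteq> (\<Pi>\<^sub>E i\<in>{..<k}. \<Pi>\<^sub>E j\<in>{..<k}. UNIV)"
    by (intro image_subsetI completion_in)
  fix Z assume "Z \<in> ?\<Z>"
  then obtain z where z: "z \<in> lower_entries k {0}" "Z = completion k uminus z" by blast
  have "z i i = 0" if "i < k" for i
  proof -
    have "z i \<in> (\<Pi>\<^sub>E j\<in>{..<Suc i}. if j < i then UNIV else {0})"
      using z(1) that unfolding lower_entries_def by (intro PiE_mem[of z "{..<k}"]) auto
    from PiE_mem[OF this, of i] show ?thesis by simp
  qed
  then have "mform k 1 Z = 0"
    by (intro mform_1_alternating) (auto simp: z(2) completion_def)
  then show "(\<Sum>i<k. mvar i * (\<Sum>j<k. mconst (Z i j) * mvar j) ^ 1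
          + mconst 0 * ((\<Sum>j<k. mconst (Z i j) * mvar j) * mvar i ^ 1)) = 0"
    by (simp add: mform_def sum_distrib_left mult_ac)
qed

text \<open>The trace s -> s^q + s takes values in the fixed points of s -> s^q, of which there are
  at most q, and its fibres are no larger than its kernel; so q^2 <= q |ker|. It is nonzero
  somewhere because its degree q is below q^2, and dividing s by its nonzero trace, which is fixed,
  normalises the trace to 1.\<close>

lemma trace_kernel_and_image:
  fixes q :: nat
  assumes card: "CARD('a::finite_field) = q ^ 2" and q: "q = CHAR('a) ^ d" "q \<ge> 2"
  shows "q \<le> card {s :: 'a. s ^ q + 1 * s = 0}" and "\<exists>\<tau> :: 'a. \<tau> ^ q + \<tau> = 1"
proof -
  have frob: "(x + y :: 'a) ^ q = x ^ q + y ^ q" for x y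
    by (rule freshmans_dream'[where n = d]) (simp_all add: q)
  have qq: "(x ^ q) ^ q = x" for x :: 'a
    using finite_field_power_card_eq_same[of x] by (simp add: card power2_eq_square flip: power_mult)
  let ?t = "\<lambda>s :: 'a. s ^ q + s"
  let ?F = "{x :: 'a. x ^ q = x}" and ?K = "{s :: 'a. ?t s = 0}"
  have "card ?F \<le> q"
  proof -
    let ?p = "Polynomial.monom 1 q - [:0, 1 :: 'a:]"
    have lead: "Polynomial.coeff ?p q = 1"
      using q(2) by (cases q) (auto simp: coeff_pCons split: nat.splits)
    have "?p \<noteq> 0"
    proof
      assume "?p = 0"
      with lead have "Polynomial.coeff 0 q = (1 :: 'a)"
        by (simp only:)
      then show False by simp
    qed
    have F: "?F = {x. poly ?p x = 0}"
      by (simp add: poly_monom)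
    have "card {x. poly ?p x = 0} \<le> Polynomial.degree ?p"
      by (rule card_poly_roots_bound) fact
    also have "\<dots> \<le> q"
      using q(2) by (intro degree_diff_le) (auto intro: degree_monom_le)
    finally show ?thesis
      unfolding F .
  qed
  have fibre: "card {s. ?t s = x} \<le> card ?K" for x
  proof (cases "\<exists>s0. ?t s0 = x")
    case True
    then obtain s0 where s0: "?t s0 = x" by blast
    have "?t (s - s0) = ?t s - ?t s0" for s
      using frob[of "s - s0" s0] by simp
    then have "(\<lambda>s. s - s0) ` {s. ?t s = x} \<subseteq> ?K"
      by (intro image_subsetI) (simp only: mem_Collect_eq s0 diff_self)
    then show ?thesis
      by (intro card_inj_on_le[where f = "\<lambda>s. s - s0"]) (auto simp: inj_on_def)
  qed simp
  have "(UNIV :: 'a set) = (\<Union>x\<in>?F. {s. ?t s = x})"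
    by (auto simp: frob qq add.commute)
  then have "CARD('a) \<le> (\<Sum>x\<in>?F. card {s. ?t s = x})"
    using card_UN_le[of ?F "\<lambda>x. {s. ?t s = x}"] by simp
  also have "\<dots> \<le> card ?F * card ?K"
    using sum_bounded_above[of ?F "\<lambda>x. card {s. ?t s = x}" "card ?K"] fibre by simp
  also have "\<dots> \<le> q * card ?K"
    using \<open>card ?F \<le> q\<close> by simp
  finally have "q * q \<le> q * card ?K"
    by (simp add: card power2_eq_square)
  then show K: "q \<le> card {s :: 'a. s ^ q + 1 * s = 0}"
    using q(2) by simp
  have "\<exists>s. ?t s \<noteq> 0"
  proof (rule ccontr)
    let ?p = "Polynomial.monom 1 q + [:0, 1 :: 'a:]"
    assume "\<nexists>s. ?t s \<noteq> 0"
    then have "{x. poly ?p x = 0} = UNIV"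
      by (simp add: poly_monom)
    moreover have lead: "Polynomial.coeff ?p q = 1"
      using q(2) by (cases q) (auto simp: coeff_pCons split: nat.splits)
    have "?p \<noteq> 0"
    proof
      assume "?p = 0"
      with lead have "Polynomial.coeff 0 q = (1 :: 'a)"
        by (simp only:)
      then show False by simp
    qed
    then have "card {x. poly ?p x = 0} \<le> Polynomial.degree ?p"
      by (rule card_poly_roots_bound)
    moreover have "Polynomial.degree ?p \<le> q"
      using q(2) by (intro degree_add_le) (auto intro: degree_monom_le)
    ultimately have "q ^ 2 \<le> q"
      using card by simp
    then show False
      using q(2) by (simp add: power2_eq_square)
  qed
  then obtain s where s: "?t s \<noteq> 0" by blast
  have "?t s ^ q = ?t s"
    by (simp add: frob qq add.commute)
  then have "(s / ?t s) ^ q + s / ?t s = 1"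
    using s by (simp add: power_divide flip: add_divide_distrib)
  then show "\<exists>\<tau> :: 'a. \<tau> ^ q + \<tau> = 1" by blast
qed

definition shear :: "nat \<Rightarrow> nat \<Rightarrow> (nat \<Rightarrow> nat \<Rightarrow> 'a::comm_ring_1) \<Rightarrow> (nat \<Rightarrow> nat \<Rightarrow> 'a) \<Rightarrow> nat \<Rightarrow> (nat, 'a) mvpoly" where
  "shear k l Z D i = (\<Sum>j<k. mconst (Z i j) * mvar j) + (\<Sum>t<l. mconst (D i t) * mvar (k + t))"

definition translate :: "nat \<Rightarrow> (nat \<Rightarrow> nat \<Rightarrow> 'a::comm_ring_1) \<Rightarrow> nat \<Rightarrow> (nat, 'a) mvpoly" where
  "translate k B i = (\<Sum>j<k. mconst (B (i - k) j) * mvar j) + mvar i"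

lemma middle_trivial:
  assumes "\<delta> > 0"
  shows "\<exists>Z D. (\<Sum>i<k. mvar i * shear k 0 Z D i ^ \<delta> + mconst \<epsilon> * (shear k 0 Z D i * mvar i ^ \<delta>))
    + meval mconst (translate k B) 0 = (0 :: (nat, 'a::finite_field) mvpoly)"
proof -
  have "shear k 0 (\<lambda>_ _. 0) D i = (0 :: (nat, 'a) mvpoly)" for D i
    by (simp add: shear_def)
  then show ?thesis
    using assms by (intro exI[of _ "\<lambda>_ _. 0"]) (simp add: meval_0[OF mconst_hom] power_0_left)
qed

lemma isometries_sesquilinear:
  fixes \<epsilon> :: "'a::finite_field"
  assumes card: "CARD('a) = CHAR('a) ^ e" and \<delta>: "\<delta> = CHAR('a) ^ d" "\<delta> \<ge> 2" and \<delta>\<delta>: "\<And>c :: 'a. c ^ (\<delta> * \<delta>) = c"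
    and \<epsilon>: "\<epsilon> = 1 \<or> \<epsilon> = - 1" and ker: "\<delta> \<le> card {s. s ^ \<delta> + \<epsilon> * s = 0}"
  shows "isometries (2 * k) k 0 e d \<delta> \<epsilon> (bilin (2 * k) k \<delta> \<epsilon>) 0 (shear k 0) (translate k)"
proof (rule isometries.intro)
  show "\<exists>Z D. (\<Sum>i<k. mvar i * shear k 0 Z D i ^ \<delta> + mconst \<epsilon> * (shear k 0 Z D i * mvar i ^ \<delta>))
    + meval mconst (translate k B) 0 = 0" for B
    using \<delta>(2) by (intro middle_trivial) simp
qed (use assms bottom_sesquilinear[OF \<delta>(1) \<delta>\<delta> \<epsilon> ker] in \<open>auto simp: shear_def translate_def\<close>)

lemma sum_linear_mult: "(\<Sum>i<k. mvar i * (mconst (b i) * f)) = (\<Sum>i<k. mconst (b i) * mvar i) * (f :: (nat, 'a::comm_ring_1) mvpoly)"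
  unfolding sum_distrib_right by (intro sum.cong refl) (simp only: mult_ac)

text \<open>If z is translated by \<beta> = sum of b_i x_i, take W_i = -b_i^q (\<tau> \<beta> + z).
  The W-terms add up to -\<beta> (\<tau>^q \<beta>^q + z^q) - \<beta>^q (\<tau> \<beta> + z), and
  \<tau>^q + \<tau> = 1 makes this the negative of (\<beta> + z)^(q+1) - z^(q+1).\<close>

lemma isometries_GU_odd:
  assumes card: "CARD('a::finite_field) = q ^ 2" "CARD('a) = CHAR('a) ^ e" and q: "q = CHAR('a) ^ d" "q \<ge> 2"
  shows "isometries (2 * k + 1) k 1 e d q (1 :: 'a) (bilin (2 * k + 1) k q 1 + mvar k ^ (q + 1)) (mvar k ^ (q + 1))
    (shear k 1) (translate k)"
proof (rule isometries.intro)
  have qq: "c ^ (q * q) = c" for c :: 'a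
    using finite_field_power_card_eq_same[of c] by (simp add: card(1) power2_eq_square)
  show "c ^ (q * q) = c" for c :: 'a by (rule qq)
  show "\<exists>\<Z>. (\<Prod>j<k. q * CARD('a) ^ j) \<le> card \<Z> \<and> \<Z> \<subseteq> (\<Pi>\<^sub>E i\<in>{..<k}. \<Pi>\<^sub>E j\<in>{..<k}. UNIV)
      \<and> (\<forall>Z\<in>\<Z>. (\<Sum>i<k. mvar i * (\<Sum>j<k. mconst (Z i j) * mvar j) ^ q
          + mconst 1 * ((\<Sum>j<k. mconst (Z i j) * mvar j) * mvar i ^ q)) = (0 :: (nat, 'a) mvpoly))"
    by (rule bottom_sesquilinear[OF q(1) qq _ trace_kernel_and_image(1)[OF card(1) q]]) simp
  have q0: "q > 0" using q(2) by simp
  have frob: "(f + g :: (nat, 'a) mvpoly) ^ q = f ^ q + g ^ q" for f g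
    by (rule freshmans_dream'[where n = d]) (simp_all add: q)
  have neg: "(- f :: (nat, 'a) mvpoly) ^ q = - (f ^ q)" for f
  proof -
    have "f ^ q + (- f) ^ q = (f + - f) ^ q"
      by (rule frob[symmetric])
    also have "\<dots> = 0"
      using q0 by (simp only: add.right_inverse zero_power)
    finally show ?thesis
      by (simp only: add_eq_0_iff)
  qed
  obtain \<tau> :: 'a where \<tau>: "\<tau> ^ q + \<tau> = 1"
    using trace_kernel_and_image(2)[OF card(1) q] by blast
  fix B :: "nat \<Rightarrow> nat \<Rightarrow> 'a"
  define b where "b = B 0"
  let ?z = "mvar k :: (nat, 'a) mvpoly" and ?\<beta> = "\<Sum>j<k. mconst (b j) * mvar j :: (nat, 'a) mvpoly"
  let ?Z = "\<lambda>i j. - (\<tau> * b i ^ q * b j)" and ?D = "\<lambda>i t. - (b i ^ q)"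
  have \<beta>q: "?\<beta> ^ q = (\<Sum>j<k. mconst (b j ^ q) * mvar j ^ q)"
    by (simp add: frob_sum[OF q0 frob] power_mult_distrib mconst.hom_power)
  have W: "shear k 1 ?Z ?D i = - (mconst (b i ^ q) * (mconst \<tau> * ?\<beta> + ?z))" for i
    by (simp add: shear_def mconst_ring.hom_uminus mconst.hom_mult sum_distrib_left sum_negf algebra_simps)
  have Wq: "shear k 1 ?Z ?D i ^ q = - (mconst (b i) * (mconst (\<tau> ^ q) * ?\<beta> ^ q + ?z ^ q))" for i
    unfolding W neg power_mult_distrib frob by (simp add: qq flip: mconst.hom_power power_mult)
  have 1: "(\<Sum>i<k. mvar i * shear k 1 ?Z ?D i ^ q) = - (?\<beta> * (mconst (\<tau> ^ q) * ?\<beta> ^ q + ?z ^ q))"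
    unfolding Wq mult_minus_right sum_negf sum_linear_mult ..
  have "(\<Sum>i<k. shear k 1 ?Z ?D i * mvar i ^ q) = - (\<Sum>i<k. (mconst (b i ^ q) * mvar i ^ q) * (mconst \<tau> * ?\<beta> + ?z))"
    unfolding W by (simp add: sum_negf mult_ac)
  then have 2: "(\<Sum>i<k. shear k 1 ?Z ?D i * mvar i ^ q) = - (?\<beta> ^ q * (mconst \<tau> * ?\<beta> + ?z))"
    unfolding \<beta>q sum_distrib_right[symmetric] .
  have 3: "meval mconst (translate k B) (?z ^ (q + 1)) = (?\<beta> + ?z) * (?\<beta> ^ q + ?z ^ q)"
  proof -
    interpret ev: comm_semiring_hom "meval mconst (translate k B)"
      by (rule meval_hom[OF mconst_hom])
    have "meval mconst (translate k B) ?z = ?\<beta> + ?z"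
      by (simp add: meval_mvar[OF mconst_hom] translate_def b_def)
    then show ?thesis
      by (simp add: ev.hom_mult ev.hom_power frob)
  qed
  have tau: "mconst (\<tau> ^ q) + mconst \<tau> = (1 :: (nat, 'a) mvpoly)"
    using \<tau> by (simp flip: mconst.hom_add)
  have alg: "- (\<beta> * (t1 * \<beta>q + zq)) + - (\<beta>q * (t2 * \<beta> + z)) + (\<beta> + z) * (\<beta>q + zq)
      = z * zq + (1 - (t1 + t2)) * (\<beta> * \<beta>q)" for \<beta> \<beta>q z zq t1 t2 :: "(nat, 'a) mvpoly"
    by (simp add: algebra_simps)
  have "(\<Sum>i<k. mvar i * shear k 1 ?Z ?D i ^ q + mconst 1 * (shear k 1 ?Z ?D i * mvar i ^ q))
      + meval mconst (translate k B) (?z ^ (q + 1)) = ?z ^ (q + 1)"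
    unfolding sum.distrib mconst_1 mult_1_left 1 2 3 alg tau by simp
  then show "\<exists>Z D. (\<Sum>i<k. mvar i * shear k 1 Z D i ^ q + mconst 1 * (shear k 1 Z D i * mvar i ^ q))
      + meval mconst (translate k B) (?z ^ (q + 1)) = ?z ^ (q + 1)" by blast
qed (use card q in \<open>auto simp: shear_def translate_def intro!: polys_in_power polys_in_mult\<close>)

lemma isometries_O_plus:
  assumes card: "CARD('a::finite_field) = CHAR('a) ^ e"
  shows "isometries (2 * k) k 0 e 0 1 (0 :: 'a) (bilin (2 * k) k 1 0) 0 (shear k 0) (translate k)"
proof (rule isometries.intro)
  show "\<exists>Z D. (\<Sum>i<k. mvar i * shear k 0 Z D i ^ 1 + mconst (0 :: 'a) * (shear k 0 Z D i * mvar i ^ 1))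
    + meval mconst (translate k B) 0 = 0" for B
    by (rule middle_trivial) simp
qed (rule bottom_alternating card | force simp: shear_def translate_def)+

text \<open>Since (\<beta> + z)^2 - z^2 = \<beta> (\<beta> + 2z) and \<beta> is the sum of the b_i
  x_i, the choice W_i = -b_i (\<beta> + 2z) compensates the translation.\<close>

lemma isometries_O_odd:
  assumes card: "CARD('a::finite_field) = CHAR('a) ^ e"
  shows "isometries (2 * k + 1) k 1 e 0 1 (0 :: 'a) (bilin (2 * k + 1) k 1 0 + mvar k ^ 2) (mvar k ^ 2)
    (shear k 1) (translate k)"
proof (rule isometries.intro)
  fix B :: "nat \<Rightarrow> nat \<Rightarrow> 'a"
  define b where "b = B 0"
  let ?z = "mvar k :: (nat, 'a) mvpoly" and ?\<beta> = "\<Sum>j<k. mconst (b j) * mvar j :: (nat, 'a) mvpoly"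
  let ?Z = "\<lambda>i j. - (b i * b j)" and ?D = "\<lambda>i t. - (2 * b i)"
  have W: "shear k 1 ?Z ?D i = - (mconst (b i) * (?\<beta> + 2 * ?z))" for i
    by (simp add: shear_def mconst_ring.hom_uminus mconst.hom_mult mconst.hom_numeral sum_distrib_left sum_negf algebra_simps)
  have 1: "(\<Sum>i<k. mvar i * shear k 1 ?Z ?D i) = - (?\<beta> * (?\<beta> + 2 * ?z))"
    unfolding W mult_minus_right sum_negf sum_linear_mult ..
  have 2: "meval mconst (translate k B) (?z ^ 2) = (?\<beta> + ?z) ^ 2"
  proof -
    interpret ev: comm_semiring_hom "meval mconst (translate k B)"
      by (rule meval_hom[OF mconst_hom])
    show ?thesis
      by (simp add: ev.hom_power meval_mvar[OF mconst_hom] translate_def b_def)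
  qed
  have alg: "- (\<beta> * (\<beta> + 2 * z)) + (\<beta> + z) ^ 2 = z ^ 2" for \<beta> z :: "(nat, 'a) mvpoly"
    by (simp add: power2_eq_square algebra_simps)
  have "(\<Sum>i<k. mvar i * shear k 1 ?Z ?D i ^ 1 + mconst 0 * (shear k 1 ?Z ?D i * mvar i ^ 1))
      + meval mconst (translate k B) (?z ^ 2) = ?z ^ 2"
    unfolding mconst_0 mult_zero_left add_0_right power_one_right 1 2 by (rule alg)
  then show "\<exists>Z D. (\<Sum>i<k. mvar i * shear k 1 Z D i ^ 1 + mconst 0 * (shear k 1 Z D i * mvar i ^ 1))
      + meval mconst (translate k B) (?z ^ 2) = ?z ^ 2" by blast
qed (rule bottom_alternating card | force simp: shear_def translate_def intro!: polys_in_power)+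

lemma sum_two: "(\<Sum>t<2. f t) = f 0 + f (1 :: nat)"
  by (simp add: numeral_2_eq_2)

text \<open>Under z -> z + \<beta>, w -> w + \<gamma> the middle form changes by \<beta> (\<beta> +
  \<gamma> + 2z + w) + \<gamma> (a \<gamma> + z + 2a w). Distributing \<beta> and \<gamma> over the
  x_i with coefficients b_i and c_i gives the W_i.\<close>

lemma isometries_O_minus:
  fixes a :: "'a::finite_field"
  assumes card: "CARD('a) = CHAR('a) ^ e"
  defines "\<mu> \<equiv> \<lambda>k. mvar k ^ 2 + mvar k * mvar (k + 1) + mconst a * mvar (k + 1) ^ 2"
  shows "isometries (2 * k + 2) k 2 e 0 1 (0 :: 'a) (bilin (2 * k + 2) k 1 0 + \<mu> k) (\<mu> k)
    (shear k 2) (translate k)"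
proof (rule isometries.intro)
  fix B :: "nat \<Rightarrow> nat \<Rightarrow> 'a"
  define b c where "b = B 0" and "c = B 1"
  let ?z = "mvar k :: (nat, 'a) mvpoly" and ?\<beta> = "\<Sum>j<k. mconst (b j) * mvar j :: (nat, 'a) mvpoly"
  let ?w = "mvar (k + 1) :: (nat, 'a) mvpoly" and ?\<gamma> = "\<Sum>j<k. mconst (c j) * mvar j :: (nat, 'a) mvpoly"
  let ?Z = "\<lambda>i j. - (b i * b j + b i * c j + a * c i * c j)"
    and ?D = "\<lambda>i t. if t = 0 then - (2 * b i + c i) else - (b i + 2 * a * c i)"
  have W: "shear k 2 ?Z ?D i = - (mconst (b i) * (?\<beta> + ?\<gamma> + 2 * ?z + ?w))
      - mconst (c i) * (mconst a * ?\<gamma> + ?z + 2 * mconst a * ?w)" for i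
  proof -
    have s1: "(\<Sum>j<k. mconst (?Z i j) * mvar j) = - (mconst (b i) * (?\<beta> + ?\<gamma>)) - mconst (c i) * (mconst a * ?\<gamma>)"
      by (simp add: mconst_ring.hom_uminus mconst_ring.hom_minus mconst.hom_add mconst.hom_mult sum_distrib_left
          sum.distrib sum_negf sum_subtractf distrib_left distrib_right left_diff_distrib right_diff_distrib mult_ac)
    have s2: "(\<Sum>t<2. mconst (?D i t) * mvar (k + t))
        = - (mconst (b i) * (2 * ?z + ?w)) - mconst (c i) * (?z + 2 * mconst a * ?w)"
      unfolding sum_two
      by (simp add: mconst_ring.hom_uminus mconst_ring.hom_minus mconst.hom_add mconst.hom_mult
          mconst.hom_numeral algebra_simps)
    show ?thesis
      unfolding shear_def s1 s2 by (simp add: algebra_simps)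
  qed
  have 1: "(\<Sum>i<k. mvar i * shear k 2 ?Z ?D i)
      = - (?\<beta> * (?\<beta> + ?\<gamma> + 2 * ?z + ?w)) - ?\<gamma> * (mconst a * ?\<gamma> + ?z + 2 * mconst a * ?w)"
    unfolding W right_diff_distrib mult_minus_right sum_subtractf sum_negf sum_linear_mult ..
  have 2: "meval mconst (translate k B) (\<mu> k) = (?\<beta> + ?z) ^ 2 + (?\<beta> + ?z) * (?\<gamma> + ?w) + mconst a * (?\<gamma> + ?w) ^ 2"
  proof -
    interpret ev: comm_semiring_hom "meval mconst (translate k B)"
      by (rule meval_hom[OF mconst_hom])
    show ?thesis
      by (simp add: \<mu>_def ev.hom_power ev.hom_add ev.hom_mult meval_mvar[OF mconst_hom] meval_mconst[OF mconst_hom]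
          translate_def b_def c_def)
  qed
  have alg: "- (\<beta> * (\<beta> + \<gamma> + 2 * z + w)) - \<gamma> * (a' * \<gamma> + z + 2 * a' * w)
      + ((\<beta> + z) ^ 2 + (\<beta> + z) * (\<gamma> + w) + a' * (\<gamma> + w) ^ 2) = z ^ 2 + z * w + a' * w ^ 2"
    for \<beta> \<gamma> z w a' :: "(nat, 'a) mvpoly"
    by (simp add: power2_eq_square algebra_simps)
  have "(\<Sum>i<k. mvar i * shear k 2 ?Z ?D i ^ 1 + mconst 0 * (shear k 2 ?Z ?D i * mvar i ^ 1))
      + meval mconst (translate k B) (\<mu> k) = \<mu> k"
    unfolding mconst_0 mult_zero_left add_0_right power_one_right 1 2 unfolding \<mu>_def by (rule alg)
  then show "\<exists>Z D. (\<Sum>i<k. mvar i * shear k 2 Z D i ^ 1 + mconst 0 * (shear k 2 Z D i * mvar i ^ 1))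
      + meval mconst (translate k B) (\<mu> k) = \<mu> k" by blast
next
  show "\<mu> k \<in> polys_in {k..<k + 2}"
    unfolding \<mu>_def by (intro polys_in_add polys_in_mult polys_in_power polys_in_mvar polys_in_mconst) auto
qed (rule bottom_alternating card | force simp: shear_def translate_def)+

section \<open>Identification of the given matrix groups with isometry groups of h\<close>

section \<open>The classical groups\<close>

lemma form_mat_carrier: "2 * k + l = n \<Longrightarrow> form_mat k l \<epsilon> X2 \<in> carrier_mat n n"
  by (auto simp: form_mat_def)

lemma form_mat_entry:
  assumes "n = 2 * k + l" "i < n" "j < n"
  shows "form_mat k l \<epsilon> X2 $$ (i, j) = block_form n k l \<epsilon> (\<lambda>s t. X2 $$ (s, t)) i j"
  using assms by (auto simp: form_mat_def block_form_def Jmat_def)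

text \<open>A hyperbolic middle block of size 2 is one more dual pair, so the block type (m - 1, 2)
  of the group becomes the type (m, 0) on the polynomial side.\<close>

lemma form_mat_entry_hyperbolic:
  assumes "m \<ge> 1" "i < 2 * m" "j < 2 * m"
    and "X2 $$ (0, 0) = 0" "X2 $$ (0, Suc 0) = 1" "X2 $$ (Suc 0, 0) = \<epsilon>" "X2 $$ (Suc 0, Suc 0) = 0"
  shows "form_mat (m - 1) 2 \<epsilon> X2 $$ (i, j) = block_form (2 * m) m 0 \<epsilon> P i j"
proof -
  obtain k where m: "m = Suc k"
    using assms(1) by (cases m) auto
  consider "i < k" | "i = k" | "i = Suc k" | "Suc k < i" by linarith
  then show ?thesis
  proof cases
    case 1
    then show ?thesis
      using assms(2,3) unfolding m by (auto simp: form_mat_def block_form_def Jmat_def)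
  next
    case 2
    have "j = k \<or> j = Suc k \<or> j < k \<or> k + 2 \<le> j" by linarith
    then show ?thesis
      using assms(2,3,4-7) unfolding m 2 by (auto simp: form_mat_def block_form_def Jmat_def)
  next
    case 3
    have "j = k \<or> j = Suc k \<or> j < k \<or> k + 2 \<le> j" by linarith
    then show ?thesis
      using assms(2,3,4-7) unfolding m 3 by (auto simp: form_mat_def block_form_def Jmat_def)
  next
    case 4
    then show ?thesis
      using assms(2,3) unfolding m by (auto simp: form_mat_def block_form_def Jmat_def)
  qed
qed

text \<open>For q >= 2 distinct matrix entries belong to distinct monomials x_i x_j^q, so preserving
  the matrix and preserving the polynomial are the same; with \<open>l \<le> 1\<close> the middle
  condition is vacuous.\<close>

lemma form_group_sesquilinear:
  fixes X2 :: "'a::finite_field mat"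
  assumes q: "q = CHAR('a) ^ d" "q \<ge> 2" and n: "2 * k' + l' = n" "n = 2 * k + l" "l \<le> 1"
    and entries: "\<And>i j. i < n \<Longrightarrow> j < n \<Longrightarrow> form_mat k' l' \<epsilon> X2 $$ (i, j) = block_form n k l \<epsilon> P i j"
  shows "form_group q k' l' \<epsilon> X2 = isom n k l (mform n q (block_form n k l \<epsilon> P))"
proof -
  have "transpose_mat N * form_mat k' l' \<epsilon> X2 * bar q N = form_mat k' l' \<epsilon> X2
      \<longleftrightarrow> lsub n N (mform n q (block_form n k l \<epsilon> P)) = mform n q (block_form n k l \<epsilon> P)"
    if N: "N \<in> unitriangular n" for N
  proof -
    have frob: "(f + g :: (nat, 'a) mvpoly) ^ q = f ^ q + g ^ q" for f g
      by (rule freshmans_dream'[where n = d]) (simp_all add: q)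
    have q0: "q > 0" using q(2) by simp
    have "transpose_mat N * form_mat k' l' \<epsilon> X2 * bar q N = form_mat k' l' \<epsilon> X2
      \<longleftrightarrow> (\<forall>a<n. \<forall>b<n. transform n q (\<lambda>i j. form_mat k' l' \<epsilon> X2 $$ (i, j)) N a b = form_mat k' l' \<epsilon> X2 $$ (a, b))"
      by (rule preserves_mat_iff[OF form_mat_carrier[OF n(1)] unitriangular_carrier[OF N]])
    also have "\<dots> \<longleftrightarrow> (\<forall>a<n. \<forall>b<n. transform n q (block_form n k l \<epsilon> P) N a b = block_form n k l \<epsilon> P a b)"
      by (simp add: entries transform_cong[OF entries])
    also have "\<dots> \<longleftrightarrow> lsub n N (mform n q (block_form n k l \<epsilon> P)) = mform n q (block_form n k l \<epsilon> P)"
      unfolding lsub_mform[OF q0 frob] mform_eq_iff[OF q(2)] ..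
    finally show ?thesis .
  qed
  moreover have "\<not> (k \<le> j \<and> j < i \<and> i < k + l)" for i j
    using n(3) by linarith
  ultimately show ?thesis
    unfolding form_group_def isom_def n(1) by blast
qed

lemma transform_block_form:
  assumes n: "n = 2 * k + l"
  shows "transform n 1 (block_form n k l 0 P) N a b = (\<Sum>i<k. N $$ (i, a) * N $$ (n - 1 - i, b))
    + (\<Sum>s<l. \<Sum>t<l. N $$ (k + s, a) * P s t * N $$ (k + t, b))"
  unfolding transform_def
  by (subst sum_block_form[OF n, of "\<lambda>x i j. N $$ (i, a) * x * N $$ (j, b) ^ 1"]) simp_all

lemma lsub_quadratic_iff:
  fixes T :: "nat \<Rightarrow> nat \<Rightarrow> 'a::comm_ring_1"
  shows "lsub n N (mform n 1 T) = mform n 1 T \<longleftrightarrow>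
    (\<forall>a<n. \<forall>b<n. transform n 1 T N a b + transform n 1 T N b a = T a b + T b a) \<and>
    (\<forall>a<n. transform n 1 T N a a = T a a)"
  using lsub_mform[of 1 n N T] mform_1_eq_iff[of n "transform n 1 T N" T] by simp

text \<open>Over the field with q elements \<open>bar\<close> is trivial, and the given matrix is
  the polarisation of the quadratic form with coefficient matrix \<open>T\<close>, so the group sees
  exactly the polar part.\<close>

lemma form_group_quadratic_iff:
  fixes X2 :: "'a::finite_field mat"
  assumes q: "CARD('a) = q" and n: "2 * k' + l' = n"
    and entries: "\<And>i j. i < n \<Longrightarrow> j < n \<Longrightarrow> form_mat k' l' 1 X2 $$ (i, j) = T i j + T j i"
  shows "N \<in> form_group q k' l' 1 X2 \<longleftrightarrow> N \<in> unitriangular n \<and>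
    (\<forall>a<n. \<forall>b<n. transform n 1 T N a b + transform n 1 T N b a = T a b + T b a)"
proof -
  have "transpose_mat N * form_mat k' l' 1 X2 * bar q N = form_mat k' l' 1 X2
      \<longleftrightarrow> (\<forall>a<n. \<forall>b<n. transform n 1 T N a b + transform n 1 T N b a = T a b + T b a)"
    if N: "N \<in> unitriangular n"
  proof -
    have "bar q N = bar 1 N"
      using finite_field_power_card_eq_same[where 'a = 'a] by (simp add: bar_def q)
    then have "transpose_mat N * form_mat k' l' 1 X2 * bar q N = form_mat k' l' 1 X2
      \<longleftrightarrow> (\<forall>a<n. \<forall>b<n. transform n 1 (\<lambda>i j. form_mat k' l' 1 X2 $$ (i, j)) N a b = form_mat k' l' 1 X2 $$ (a, b))"
      by (simp only:) (rule preserves_mat_iff[OF form_mat_carrier[OF n] unitriangular_carrier[OF N]])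
    also have "\<dots> \<longleftrightarrow> (\<forall>a<n. \<forall>b<n. transform n 1 (\<lambda>i j. T i j + T j i) N a b = T a b + T b a)"
      by (simp add: entries transform_cong[OF entries])
    finally show ?thesis
      unfolding transform_add transform_flip[of n T] .
  qed
  then show ?thesis
    unfolding form_group_def n by blast
qed

text \<open>The value of the quadratic form on column \<open>a\<close> of \<open>N\<close>; for
  \<open>a < k\<close> the basis vector itself is singular, so an isometry must have value zero
  here.\<close>

definition quadratic_defect :: "nat \<Rightarrow> nat \<Rightarrow> nat \<Rightarrow> (nat \<Rightarrow> nat \<Rightarrow> 'a) \<Rightarrow> 'a::comm_ring_1 mat \<Rightarrow> nat \<Rightarrow> 'a" where
  "quadratic_defect n k l P N a = (\<Sum>i<k. N $$ (i, a) * N $$ (n - 1 - i, a))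
     + (\<Sum>s<l. \<Sum>t<l. N $$ (k + s, a) * P s t * N $$ (k + t, a))"

text \<open>A quadratic form is preserved iff its polarisation and its values on basis vectors are.
  For columns a >= k the value is automatic: the column vanishes above position a, and an identity
  middle block leaves only the diagonal entry. The columns a < k contribute the defects.\<close>

lemma isom_quadratic_iff:
  fixes X2 :: "'a::finite_field mat"
  assumes q: "CARD('a) = q" and n: "2 * k' + l' = n" "n = 2 * k + l"
    and entries: "\<And>i j. i < n \<Longrightarrow> j < n \<Longrightarrow>
      form_mat k' l' 1 X2 $$ (i, j) = block_form n k l 0 P i j + block_form n k l 0 P j i"
  shows "N \<in> isom n k l (mform n 1 (block_form n k l 0 P)) \<longleftrightarrow> N \<in> form_group q k' l' 1 X2 \<and>
    (\<forall>i j. k \<le> j \<longrightarrow> j < i \<longrightarrow> i < k + l \<longrightarrow> N $$ (i, j) = 0) \<and> (\<forall>a<k. quadratic_defect n k l P N a = 0)"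
proof -
  let ?T = "block_form n k l 0 P"
  have diag: "transform n 1 ?T N a a = ?T a a"
    if N: "N \<in> unitriangular n" "\<forall>i j. k \<le> j \<longrightarrow> j < i \<longrightarrow> i < k + l \<longrightarrow> N $$ (i, j) = 0" and a: "k \<le> a" "a < n" for a
  proof -
    have zero: "N $$ (i, a) = 0" if "i < a" for i
      using N(1) that a by (auto simp: unitriangular_def)
    have "(\<Sum>i<k. N $$ (i, a) * N $$ (n - 1 - i, a)) = 0"
      using a zero by (intro sum.neutral) auto
    moreover have "(\<Sum>s<l. \<Sum>t<l. N $$ (k + s, a) * P s t * N $$ (k + t, a)) = ?T a a"
    proof (cases "a < k + l")
      case True
      have col: "N $$ (k + s, a) = (if s = a - k then 1 else 0)" if s: "s < l" for s
      proof -
        consider "k + s < a" | "k + s = a" | "a < k + s" by linarith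
        then show ?thesis
        proof cases
          case 2
          then show ?thesis
            using N(1) a by (auto simp: unitriangular_def)
        next
          case 3
          then have "N $$ (k + s, a) = 0"
            using N(2) a(1) s by auto
          then show ?thesis
            using 3 a(1) by auto
        qed (use zero in auto)
      qed
      have ak: "a - k < l"
        using True a by simp
      have "(\<Sum>t<l. N $$ (k + s, a) * P s t * N $$ (k + t, a)) = (if s = a - k then P (a - k) (a - k) else 0)"
        if "s < l" for s
      proof -
        have "(\<Sum>t<l. N $$ (k + s, a) * P s t * N $$ (k + t, a))
            = (\<Sum>t<l. if t = a - k then N $$ (k + s, a) * P s (a - k) else 0)"
          by (intro sum.cong refl) (simp add: col)
        then show ?thesis
          using ak by (simp add: col that)
      qed
      then show ?thesis
        using True ak a by (simp add: block_form_def)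
    next
      case False
      then have "(\<Sum>s<l. \<Sum>t<l. N $$ (k + s, a) * P s t * N $$ (k + t, a)) = 0"
        using zero by (intro sum.neutral ballI) auto
      then show ?thesis
        using False a by (simp add: block_form_def)
    qed
    ultimately show ?thesis
      unfolding transform_block_form[OF n(2)] by simp
  qed
  have low: "transform n 1 ?T N a a = ?T a a \<longleftrightarrow> quadratic_defect n k l P N a = 0" if "a < k" for a
    unfolding transform_block_form[OF n(2)] quadratic_defect_def using that n(2) by (auto simp: block_form_def)
  have diagonal: "(\<forall>a<n. transform n 1 ?T N a a = ?T a a) \<longleftrightarrow> (\<forall>a<k. quadratic_defect n k l P N a = 0)"
    if "N \<in> unitriangular n" "\<forall>i j. k \<le> j \<longrightarrow> j < i \<longrightarrow> i < k + l \<longrightarrow> N $$ (i, j) = 0"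
  proof
    assume "\<forall>a<n. transform n 1 ?T N a a = ?T a a"
    then have "transform n 1 ?T N a a = ?T a a" if "a < k" for a
      using that n(2) by simp
    then show "\<forall>a<k. quadratic_defect n k l P N a = 0"
      by (simp only: low) simp
  next
    assume *: "\<forall>a<k. quadratic_defect n k l P N a = 0"
    show "\<forall>a<n. transform n 1 ?T N a a = ?T a a"
    proof (intro allI impI)
      fix a assume a: "a < n"
      show "transform n 1 ?T N a a = ?T a a"
      proof (cases "a < k")
        case True
        then show ?thesis
          using low[OF True] * by blast
      next
        case False
        then show ?thesis
          using diag[OF that _ a] by simp
      qed
    qed
  qed
  have logic: "(U \<and> (S \<and> D) \<and> M) \<longleftrightarrow> (U \<and> S) \<and> M \<and> D'" if "U \<Longrightarrow> M \<Longrightarrow> D = D'" for U S D D' M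
    using that by blast
  show ?thesis
    unfolding isom_def mem_Collect_eq lsub_quadratic_iff
    by (simp only: form_group_quadratic_iff[OF q n(1) entries]) (rule logic, rule diagonal)
qed

lemma S_mat_diagonal:
  assumes N: "N \<in> carrier_mat n n" and n: "n = 2 * k + l" and a: "a < k"
  shows "S_mat q k l N $$ (a, a) = (\<Sum>i<k. N $$ (i, a) * N $$ (n - 1 - i, a) ^ q)"
proof -
  have "S_mat q k l N $$ (a, a)
      = (\<Sum>i<k. N $$ (i, a) * (\<Sum>b<k. (if i + b + 1 = k then 1 else 0) * N $$ (k + l + b, a) ^ q))"
    using a by (simp add: S_mat_def block_A_def block_C_def block_def bar_def Jmat_def scalar_prod_def atLeast0LessThan
        assoc_mult_mat[of _ k k _ k _ k])
  also have "\<dots> = (\<Sum>i<k. N $$ (i, a) * N $$ (n - 1 - i, a) ^ q)"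
  proof (intro sum.cong refl)
    fix i assume "i \<in> {..<k}"
    then have i: "i < k" by simp
    have "(\<Sum>b<k. (if i + b + 1 = k then 1 else 0) * N $$ (k + l + b, a) ^ q)
        = (\<Sum>b<k. if b = k - 1 - i then N $$ (k + l + b, a) ^ q else 0)"
      using i by (intro sum.cong) auto
    also have "\<dots> = N $$ (n - 1 - i, a) ^ q"
    proof -
      have "k + l + (k - 1 - i) = n - 1 - i" "k - 1 - i < k"
        using i n by auto
      then show ?thesis by simp
    qed
    finally show "N $$ (i, a) * (\<Sum>b<k. (if i + b + 1 = k then 1 else 0) * N $$ (k + l + b, a) ^ q)
        = N $$ (i, a) * N $$ (n - 1 - i, a) ^ q" by simp
  qed
  finally show ?thesis .
qed

lemma block_form_symmetrize:
  "block_form n k l 0 P i j + block_form n k l 0 P j i = block_form n k l 1 (\<lambda>s t. P s t + P t s) i j"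
  if "n = 2 * k + l" "i < n" "j < n"
  using that by (auto simp: block_form_def)

lemma odd_card_two:
  assumes q: "CARD('a::finite_field) = q" "odd q"
  shows "(2 :: 'a) \<noteq> 0"
proof
  assume "(2 :: 'a) = 0"
  then have "of_nat 2 = (0 :: 'a)" by simp
  then have "CHAR('a) dvd 2"
    by (simp only: of_nat_eq_0_iff_char_dvd)
  then have "CHAR('a) = 2"
    using CHAR_prime[where 'a = 'a] by (simp add: primes_dvd_imp_eq)
  then show False
    using CHAR_dvd_CARD[where 'a = 'a] q by simp
qed

text \<open>The polar condition on the diagonal says that twice the defect vanishes, and 2 is
  invertible.\<close>

lemma isom_quadratic_odd:
  fixes X2 :: "'a::finite_field mat"
  assumes q: "CARD('a) = q" "odd q" and n: "2 * k' + l' = n" "n = 2 * k + l"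
    and entries: "\<And>i j. i < n \<Longrightarrow> j < n \<Longrightarrow>
      form_mat k' l' 1 X2 $$ (i, j) = block_form n k l 0 P i j + block_form n k l 0 P j i"
    and mid: "\<And>N i j. N \<in> form_group q k' l' 1 X2 \<Longrightarrow> k \<le> j \<Longrightarrow> j < i \<Longrightarrow> i < k + l \<Longrightarrow> N $$ (i, j) = 0"
  shows "form_group q k' l' 1 X2 = isom n k l (mform n 1 (block_form n k l 0 P))"
proof -
  have two: "(2 :: 'a) \<noteq> 0"
    by (rule odd_card_two[OF q])
  have "quadratic_defect n k l P N a = 0" if N: "N \<in> form_group q k' l' 1 X2" and a: "a < k" for N a
  proof -
    have "transform n 1 (block_form n k l 0 P) N a a + transform n 1 (block_form n k l 0 P) N a a = 0"
    proof -
      have "a < n" "block_form n k l 0 P a a = 0"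
        using a n(2) by (auto simp: block_form_def)
      then show ?thesis
        using N by (simp only: form_group_quadratic_iff[OF q(1) n(1) entries]) simp
    qed
    moreover have "transform n 1 (block_form n k l 0 P) N a a = quadratic_defect n k l P N a"
      unfolding transform_block_form[OF n(2)] quadratic_defect_def ..
    ultimately have "2 * quadratic_defect n k l P N a = 0"
      by (simp only: mult_2)
    with two show ?thesis by simp
  qed
  then have defect: "\<forall>a<k. quadratic_defect n k l P N a = 0" if "N \<in> form_group q k' l' 1 X2" for N
    using that by simp
  show ?thesis
  proof (rule Set.set_eqI, simp only: isom_quadratic_iff[OF q(1) n entries], intro iffI conjI)
    fix N assume N: "N \<in> form_group q k' l' 1 X2"
    show "\<forall>i j. k \<le> j \<longrightarrow> j < i \<longrightarrow> i < k + l \<longrightarrow> N $$ (i, j) = 0"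
      by (intro allI impI) (rule mid[OF N])
    show "\<forall>a<k. quadratic_defect n k l P N a = 0"
      by (rule defect[OF N])
  qed (assumption | erule conjunct1)+
qed

lemma even_card_CHAR:
  assumes "CARD('a::finite_field) = q" "even q" "q = CHAR('a) ^ d"
  shows "CHAR('a) = 2"
proof -
  have "Factorial_Ring.prime CHAR('a)" by simp
  moreover have "2 dvd CHAR('a)"
    using assms(2,3) prime_dvd_power[of 2 "CHAR('a)" d] by simp
  ultimately show ?thesis
    using primes_dvd_imp_eq[OF two_is_prime_nat] by simp
qed

lemma char_two_eq:
  fixes x y :: "'a::ring_1"
  assumes "CHAR('a) = 2"
  shows "x + y = 0 \<longleftrightarrow> x = y"
  using assms by (simp add: add_eq_0_iff2 uminus_CHAR_2)

lemma O_plus_entries: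
  assumes "m \<ge> 1" "i < 2 * m" "j < 2 * m"
  shows "form_mat (m - 1) 2 1 (Jmat 2) $$ (i, j)
    = block_form (2 * m) m 0 0 (\<lambda>_ _. 0) i j + block_form (2 * m) m 0 0 (\<lambda>_ _. 0) j i"
proof -
  have n: "2 * m = 2 * m + 0" by simp
  show ?thesis
    unfolding block_form_symmetrize[OF n assms(2,3)]
    by (rule form_mat_entry_hyperbolic[OF assms]) (simp_all add: Jmat_def)
qed

text \<open>On the \<open>isom\<close> side the innermost hyperbolic pair is an ordinary pair, so
  there are m defects. The first m - 1 are the conditions on s_ii, with signs immaterial in
  characteristic 2; the last one equals the only free entry of F, so it says that F is the
  identity.\<close>

lemma O_plus_even_group:
  assumes q: "CARD('a::finite_field) = q" "even q" "q = CHAR('a) ^ d" and m: "m \<ge> 1"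
  shows "{N \<in> form_group q (m - 1) 2 1 (Jmat 2 :: 'a mat).
          block_F (m - 1) 2 N = 1\<^sub>m 2 \<and>
          (\<forall>i<m - 1. S_mat q (m - 1) 2 N $$ (i, i)
             = block_B (m - 1) 2 N $$ (0, i) * block_B (m - 1) 2 N $$ (1, i))}
    = isom (2 * m) m 0 (mform (2 * m) 1 (block_form (2 * m) m 0 0 (\<lambda>_ _. 0)))"
proof (rule Set.set_eqI)
  fix N :: "'a mat"
  note char2 = even_card_CHAR[OF q]
  have pow: "x ^ q = x" for x :: 'a
    using finite_field_power_card_eq_same[of x] q(1) by simp
  have n: "2 * (m - 1) + 2 = 2 * m" "2 * m = 2 * m + 0" "2 * m = 2 * (m - 1) + 2"
    using m by auto
  have entries: "form_mat (m - 1) 2 1 (Jmat 2 :: 'a mat) $$ (i, j)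
      = block_form (2 * m) m 0 0 (\<lambda>_ _. 0) i j + block_form (2 * m) m 0 0 (\<lambda>_ _. 0) j i"
    if "i < 2 * m" "j < 2 * m" for i j
    by (rule O_plus_entries[OF m that])
  have "(block_F (m - 1) 2 N = 1\<^sub>m 2 \<and> (\<forall>i<m - 1. S_mat q (m - 1) 2 N $$ (i, i)
             = block_B (m - 1) 2 N $$ (0, i) * block_B (m - 1) 2 N $$ (1, i)))
      \<longleftrightarrow> (\<forall>a<m. quadratic_defect (2 * m) m 0 (\<lambda>_ _. 0) N a = 0)" if "N \<in> form_group q (m - 1) 2 1 (Jmat 2)"
  proof -
    have N: "N \<in> unitriangular (2 * m)"
      using that n(1) by (simp add: form_group_def)
    obtain k where k: "m = Suc k"
      using m by (cases m) auto
    have diag: "N $$ (i, i) = 1" if "i < 2 * m" for i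
      using N that by (auto simp: unitriangular_def)
    have upper: "N $$ (i, j) = 0" if "i < j" "j < 2 * m" for i j
      using N that by (auto simp: unitriangular_def)
    have split: "quadratic_defect (2 * m) m 0 (\<lambda>_ _. 0) N a
        = (\<Sum>i<k. N $$ (i, a) * N $$ (2 * m - 1 - i, a)) + N $$ (k, a) * N $$ (Suc k, a)" for a
      by (simp add: quadratic_defect_def k)
    have "block_F k 2 N = 1\<^sub>m 2 \<longleftrightarrow> N $$ (Suc k, k) = 0"
    proof
      assume "block_F k 2 N = 1\<^sub>m 2"
      from arg_cong[OF this, of "\<lambda>M. M $$ (1, 0)"] show "N $$ (Suc k, k) = 0"
        by (simp add: block_F_def block_def)
    next
      assume *: "N $$ (Suc k, k) = 0"
      show "block_F k 2 N = 1\<^sub>m 2"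
      proof (rule eq_matI)
        fix i j assume "i < dim_row (1\<^sub>m 2 :: 'a mat)" "j < dim_col (1\<^sub>m 2 :: 'a mat)"
        then have "i = 0 \<or> i = 1" "j = 0 \<or> j = 1" by auto
        then show "block_F k 2 N $$ (i, j) = 1\<^sub>m 2 $$ (i, j)"
          using * diag[of k] diag[of "Suc k"] upper[of k "Suc k"] k by (auto simp: block_F_def block_def)
      qed (simp_all add: block_F_def block_def)
    qed
    moreover have "quadratic_defect (2 * m) m 0 (\<lambda>_ _. 0) N k = N $$ (Suc k, k)"
    proof -
      have "(\<Sum>i<k. N $$ (i, k) * N $$ (2 * m - 1 - i, k)) = 0"
        using upper k by (intro sum.neutral) auto
      then show ?thesis
        unfolding split using diag[of k] k by simp
    qed
    moreover have "(S_mat q k 2 N $$ (i, i) = block_B k 2 N $$ (0, i) * block_B k 2 N $$ (1, i))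
        \<longleftrightarrow> quadratic_defect (2 * m) m 0 (\<lambda>_ _. 0) N i = 0" if i: "i < k" for i
    proof -
      have "S_mat q k 2 N $$ (i, i) = (\<Sum>i'<k. N $$ (i', i) * N $$ (2 * m - 1 - i', i))"
        using S_mat_diagonal[OF unitriangular_carrier[OF N], of k 2 i q] k i by (simp add: pow)
      moreover have "block_B k 2 N $$ (0, i) * block_B k 2 N $$ (1, i) = N $$ (k, i) * N $$ (Suc k, i)"
        using i by (simp add: block_B_def block_def)
      ultimately show ?thesis
        unfolding split char_two_eq[OF char2] by simp
    qed
    ultimately show ?thesis
      unfolding k by (auto simp: less_Suc_eq)
  qed
  note cond = this
  have logic: "(F \<and> C) \<longleftrightarrow> F \<and> (\<forall>i j. m \<le> j \<longrightarrow> j < i \<longrightarrow> i < m + 0 \<longrightarrow> N $$ (i, j) = 0) \<and> D"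
    if "F \<Longrightarrow> C = D" for F C D
  proof -
    have "\<not> (m \<le> j \<and> j < i \<and> i < m + 0)" for i j :: nat by linarith
    with that show ?thesis by blast
  qed
  show "N \<in> {N \<in> form_group q (m - 1) 2 1 (Jmat 2 :: 'a mat).
          block_F (m - 1) 2 N = 1\<^sub>m 2 \<and>
          (\<forall>i<m - 1. S_mat q (m - 1) 2 N $$ (i, i)
             = block_B (m - 1) 2 N $$ (0, i) * block_B (m - 1) 2 N $$ (1, i))}
    \<longleftrightarrow> N \<in> isom (2 * m) m 0 (mform (2 * m) 1 (block_form (2 * m) m 0 0 (\<lambda>_ _. 0)))"
    by (simp only: isom_quadratic_iff[OF q(1) n(1,2) entries] mem_Collect_eq) (rule logic, (erule cond)+)
qed

lemma O_odd_even_group: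
  assumes q: "CARD('a::finite_field) = q" "even q" "q = CHAR('a) ^ d"
  shows "{N \<in> form_group q m 1 1 (mat_of_rows_list 1 [[0 :: 'a]]).
          \<forall>i<m. S_mat q m 1 N $$ (i, i) = block_B m 1 N $$ (0, i) ^ 2}
    = isom (2 * m + 1) m 1 (mform (2 * m + 1) 1 (block_form (2 * m + 1) m 1 0 (\<lambda>_ _. 1)))"
proof (rule Set.set_eqI)
  fix N :: "'a mat"
  note char2 = even_card_CHAR[OF q]
  have pow: "x ^ q = x" for x :: 'a
    using finite_field_power_card_eq_same[of x] q(1) by simp
  have two: "1 + 1 = (0 :: 'a)"
    by (simp only: char_two_eq[OF char2])
  have entries: "form_mat m 1 1 (mat_of_rows_list 1 [[0 :: 'a]]) $$ (i, j)
      = block_form (2 * m + 1) m 1 0 (\<lambda>_ _. 1) i j + block_form (2 * m + 1) m 1 0 (\<lambda>_ _. 1) j i"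
    if "i < 2 * m + 1" "j < 2 * m + 1" for i j
    unfolding block_form_symmetrize[OF refl that] form_mat_entry[OF refl that]
    using two by (auto simp: block_form_def mat_of_rows_list_def)
  have "(S_mat q m 1 N $$ (i, i) = block_B m 1 N $$ (0, i) ^ 2)
      \<longleftrightarrow> quadratic_defect (2 * m + 1) m 1 (\<lambda>_ _. 1) N i = 0"
    if "N \<in> form_group q m 1 1 (mat_of_rows_list 1 [[0]])" "i < m" for i
  proof -
    have "N \<in> carrier_mat (2 * m + 1) (2 * m + 1)"
      using that(1) by (simp add: form_group_def unitriangular_def)
    from S_mat_diagonal[OF this refl that(2), of q]
    show ?thesis
      unfolding quadratic_defect_def char_two_eq[OF char2] using that(2)
      by (simp add: pow block_B_def block_def power2_eq_square)
  qed
  then have "(\<forall>i<m. S_mat q m 1 N $$ (i, i) = block_B m 1 N $$ (0, i) ^ 2)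
      \<longleftrightarrow> (\<forall>i<m. quadratic_defect (2 * m + 1) m 1 (\<lambda>_ _. 1) N i = 0)"
    if "N \<in> form_group q m 1 1 (mat_of_rows_list 1 [[0]])"
    using that by simp
  note cond = this
  have logic: "(F \<and> C) \<longleftrightarrow> F \<and> (\<forall>i j. m \<le> j \<longrightarrow> j < i \<longrightarrow> i < m + 1 \<longrightarrow> N $$ (i, j) = 0) \<and> D"
    if "F \<Longrightarrow> C = D" for F C D
  proof -
    have "\<not> (m \<le> j \<and> j < i \<and> i < m + 1)" for i j :: nat by linarith
    with that show ?thesis by blast
  qed
  show "N \<in> {N \<in> form_group q m 1 1 (mat_of_rows_list 1 [[0 :: 'a]]).
          \<forall>i<m. S_mat q m 1 N $$ (i, i) = block_B m 1 N $$ (0, i) ^ 2}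
    \<longleftrightarrow> N \<in> isom (2 * m + 1) m 1 (mform (2 * m + 1) 1 (block_form (2 * m + 1) m 1 0 (\<lambda>_ _. 1)))"
    by (simp only: isom_quadratic_iff[OF q(1) refl refl entries] mem_Collect_eq) (rule logic, (erule cond)+)
qed

text \<open>The upper triangular coefficient matrix with rows (1, 1) and (0, a), that is, z^2 + z w
  + a w^2.\<close>

definition minus_form :: "'a::comm_ring_1 \<Rightarrow> nat \<Rightarrow> nat \<Rightarrow> 'a" where
  "minus_form a s t = (if s = 0 then 1 else if t = 0 then 0 else a)"

lemma O_minus_odd_entries:
  assumes "i < 2 * m + 2" "j < 2 * m + 2"
  shows "form_mat m 2 1 (mat_of_rows_list 2 [[2, 1], [1, 2 * a]]) $$ (i, j)
    = block_form (2 * m + 2) m 2 0 (minus_form a) i j + block_form (2 * m + 2) m 2 0 (minus_form a) j i"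
proof -
  have "mat_of_rows_list 2 [[2, 1], [1, 2 * a]] $$ (s, t) = minus_form a s t + minus_form a t s" if "s < 2" "t < 2" for s t
  proof -
    have "s = 0 \<or> s = 1" "t = 0 \<or> t = 1"
      using that by auto
    then show ?thesis
      by (auto simp: mat_of_rows_list_def minus_form_def)
  qed
  then show ?thesis
    unfolding block_form_symmetrize[OF refl assms] form_mat_entry[OF refl assms] by (auto simp: block_form_def)
qed

text \<open>In characteristic 2 the polarisation of z^2 + z w + a w^2 is \<open>Jmat 2\<close>, the
  condition on F is the middle condition of \<open>isom\<close>, and the conditions on s_ii are the
  vanishing defects.\<close>

lemma O_minus_even_group:
  fixes a :: "'a::finite_field"
  assumes q: "CARD('a) = q" "even q" "q = CHAR('a) ^ d"
  shows "{N \<in> form_group q m 2 1 (Jmat 2).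
          block_F m 2 N = 1\<^sub>m 2 \<and>
          (\<forall>i<m. S_mat q m 2 N $$ (i, i)
             = block_B m 2 N $$ (0, i) ^ 2
               + block_B m 2 N $$ (0, i) * block_B m 2 N $$ (1, i)
               + a * block_B m 2 N $$ (1, i) ^ 2)}
    = isom (2 * m + 2) m 2 (mform (2 * m + 2) 1 (block_form (2 * m + 2) m 2 0 (minus_form a)))"
proof (rule Set.set_eqI)
  fix N :: "'a mat"
  note char2 = even_card_CHAR[OF q]
  have pow: "x ^ q = x" for x :: 'a
    using finite_field_power_card_eq_same[of x] q(1) by simp
  have double: "x + x = (0 :: 'a)" for x
    by (simp only: char_two_eq[OF char2])
  have entries: "form_mat m 2 1 (Jmat 2 :: 'a mat) $$ (i, j)
      = block_form (2 * m + 2) m 2 0 (minus_form a) i j + block_form (2 * m + 2) m 2 0 (minus_form a) j i"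
    if "i < 2 * m + 2" "j < 2 * m + 2" for i j
  proof -
    have "Jmat 2 $$ (s, t) = minus_form a s t + minus_form a t s" if "s < 2" "t < 2" for s t
    proof -
      have "s = 0 \<or> s = 1" "t = 0 \<or> t = 1"
        using that by auto
      then show ?thesis
        using double[of 1] double[of a] by (auto simp: Jmat_def minus_form_def)
    qed
    then show ?thesis
      unfolding block_form_symmetrize[OF refl that] form_mat_entry[OF refl that] by (auto simp: block_form_def)
  qed
  have F: "block_F m 2 N = 1\<^sub>m 2 \<longleftrightarrow> (\<forall>i j. m \<le> j \<longrightarrow> j < i \<longrightarrow> i < m + 2 \<longrightarrow> N $$ (i, j) = 0)"
    if "N \<in> form_group q m 2 1 (Jmat 2)"
  proof
    assume F: "block_F m 2 N = 1\<^sub>m 2"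
    show "\<forall>i j. m \<le> j \<longrightarrow> j < i \<longrightarrow> i < m + 2 \<longrightarrow> N $$ (i, j) = 0"
    proof (intro allI impI)
      fix i j assume "m \<le> j" "j < i" "i < m + 2"
      then have "i = Suc m" "j = m" by auto
      then show "N $$ (i, j) = 0"
        using arg_cong[OF F, of "\<lambda>M. M $$ (1, 0)"] by (simp add: block_F_def block_def)
    qed
  next
    assume *: "\<forall>i j. m \<le> j \<longrightarrow> j < i \<longrightarrow> i < m + 2 \<longrightarrow> N $$ (i, j) = 0"
    have N: "N \<in> unitriangular (2 * m + 2)"
      using that by (simp add: form_group_def)
    show "block_F m 2 N = 1\<^sub>m 2"
    proof (rule eq_matI)
      fix i j assume "i < dim_row (1\<^sub>m 2 :: 'a mat)" "j < dim_col (1\<^sub>m 2 :: 'a mat)"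
      then have "i = 0 \<or> i = 1" "j = 0 \<or> j = 1" by auto
      then show "block_F m 2 N $$ (i, j) = 1\<^sub>m 2 $$ (i, j)"
        using * N by (auto simp: block_F_def block_def unitriangular_def)
    qed (simp_all add: block_F_def block_def)
  qed
  have defect: "(S_mat q m 2 N $$ (i, i) = block_B m 2 N $$ (0, i) ^ 2
               + block_B m 2 N $$ (0, i) * block_B m 2 N $$ (1, i)
               + a * block_B m 2 N $$ (1, i) ^ 2)
      \<longleftrightarrow> quadratic_defect (2 * m + 2) m 2 (minus_form a) N i = 0"
    if "N \<in> form_group q m 2 1 (Jmat 2)" "i < m" for i
  proof -
    have "N \<in> carrier_mat (2 * m + 2) (2 * m + 2)"
      using that(1) by (simp add: form_group_def unitriangular_def)
    from S_mat_diagonal[OF this refl that(2), of q]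
    show ?thesis
      unfolding quadratic_defect_def char_two_eq[OF char2] sum_two using that(2)
      by (simp add: pow block_B_def block_def minus_form_def power2_eq_square mult_ac add.assoc)
  qed
  have "(\<forall>i<m. S_mat q m 2 N $$ (i, i) = block_B m 2 N $$ (0, i) ^ 2
               + block_B m 2 N $$ (0, i) * block_B m 2 N $$ (1, i)
               + a * block_B m 2 N $$ (1, i) ^ 2)
      \<longleftrightarrow> (\<forall>i<m. quadratic_defect (2 * m + 2) m 2 (minus_form a) N i = 0)"
    if "N \<in> form_group q m 2 1 (Jmat 2)"
    using defect[OF that] by simp
  note cond = F this
  have logic: "(F \<and> C \<and> E) \<longleftrightarrow> F \<and> M \<and> D" if "F \<Longrightarrow> C = M" "F \<Longrightarrow> E = D" for F C D E M
    using that by blast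
  show "N \<in> {N \<in> form_group q m 2 1 (Jmat 2).
          block_F m 2 N = 1\<^sub>m 2 \<and>
          (\<forall>i<m. S_mat q m 2 N $$ (i, i)
             = block_B m 2 N $$ (0, i) ^ 2
               + block_B m 2 N $$ (0, i) * block_B m 2 N $$ (1, i)
               + a * block_B m 2 N $$ (1, i) ^ 2)}
    \<longleftrightarrow> N \<in> isom (2 * m + 2) m 2 (mform (2 * m + 2) 1 (block_form (2 * m + 2) m 2 0 (minus_form a)))"
    by (simp only: isom_quadratic_iff[OF q(1) refl refl entries] mem_Collect_eq) (rule logic, (erule cond)+)
qed

lemma primepow_card_CHAR:
  assumes "primepow q" "CARD('a::finite_field) = q ^ j" "j \<ge> 1"
  shows "\<exists>d e. q = CHAR('a) ^ d \<and> CARD('a) = CHAR('a) ^ e" and "q \<ge> 2"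
proof -
  obtain p d where p: "Factorial_Ring.prime p" "d > 0" "q = p ^ d"
    using assms(1) by (auto simp: primepow_def)
  have "CHAR('a) dvd p ^ (d * j)"
    using CHAR_dvd_CARD[where 'a = 'a] unfolding assms(2) p(3) by (simp add: power_mult)
  then have "CHAR('a) dvd p"
    using CHAR_prime[where 'a = 'a] prime_dvd_power by blast
  then have "p = CHAR('a)"
    using CHAR_prime[where 'a = 'a] p(1) primes_dvd_imp_eq by metis
  then have "q = CHAR('a) ^ d \<and> CARD('a) = CHAR('a) ^ (d * j)"
    using p assms(2) by (simp add: power_mult)
  then show "\<exists>d e. q = CHAR('a) ^ d \<and> CARD('a) = CHAR('a) ^ e" by blast
  show "q \<ge> 2"
    using primepow_gt_Suc_0[OF assms(1)] by simp
qed

lemma primepow_card_CHAR_1: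
  assumes "primepow q" "CARD('a::finite_field) = q"
  shows "\<exists>d e. q = CHAR('a) ^ d \<and> CARD('a) = CHAR('a) ^ e" and "q \<ge> 2"
  using primepow_card_CHAR[where 'a = 'a, of q 1] assms by simp_all

lemmas invariant_field_generators_isom =
  form_invariants.invariant_field_generators[OF isometries.form_invariants]

lemma bilin_forms:
  "h_GU_even q m = bilin (2 * m) m q 1"
  "h_GU_odd q m = bilin (2 * m + 1) m q 1 + mvar m ^ (q + 1)"
  "h_Sp q m = bilin (2 * m) m q (- 1)"
  "h_O_plus m = bilin (2 * m) m 1 0"
  "h_O_minus a m = bilin (2 * m + 2) m 1 0 + (mvar m ^ 2 + mvar m * mvar (m + 1) + mconst a * mvar (m + 1) ^ 2)"
  "h_O_odd m = bilin (2 * m + 1) m 1 0 + mvar m ^ 2"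
proof -
  show "h_GU_even q m = bilin (2 * m) m q 1"
    unfolding h_GU_even_def bilin_def by (intro sum.cong refl) (simp add: mult.commute)
  show "h_GU_odd q m = bilin (2 * m + 1) m q 1 + mvar m ^ (q + 1)"
    unfolding h_GU_odd_def bilin_def
    by (rule arg_cong2[where f = plus, OF sum.cong[OF refl] refl]) (simp add: mult.commute)
  show "h_Sp q m = bilin (2 * m) m q (- 1)"
    unfolding h_Sp_def bilin_def by (intro sum.cong refl) (simp add: mult.commute mconst_ring.hom_uminus)
  show "h_O_plus m = bilin (2 * m) m 1 0"
    unfolding h_O_plus_def bilin_def by (intro sum.cong refl) (simp add: mult.commute)
  show "h_O_odd m = bilin (2 * m + 1) m 1 0 + mvar m ^ 2"
    unfolding h_O_odd_def bilin_def
    by (rule arg_cong2[where f = plus, OF sum.cong[OF refl] refl]) (simp add: mult.commute)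
  show "h_O_minus a m = bilin (2 * m + 2) m 1 0 + (mvar m ^ 2 + mvar m * mvar (m + 1) + mconst a * mvar (m + 1) ^ 2)"
    unfolding h_O_minus_def bilin_def add.assoc
    by (rule arg_cong2[where f = plus, OF sum.cong[OF refl] refl]) (simp add: mult.commute)
qed

lemma mform_sesquilinear_1:
  "mform (2 * m + 1) q (block_form (2 * m + 1) m 1 \<epsilon> (\<lambda>_ _. 1)) = bilin (2 * m + 1) m q \<epsilon> + mvar m ^ (q + 1)"
  by (subst mform_block_form) (simp_all)

lemma mform_quadratic_1:
  "mform (2 * m + 1) 1 (block_form (2 * m + 1) m 1 \<epsilon> (\<lambda>_ _. 1)) = bilin (2 * m + 1) m 1 \<epsilon> + mvar m ^ 2"
  by (simp only: mform_sesquilinear_1 one_add_one)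

lemma mform_0: "mform (2 * m) q (block_form (2 * m) m 0 \<epsilon> P) = bilin (2 * m) m q \<epsilon>"
  by (subst mform_block_form) simp_all

lemma mform_minus:
  "mform (2 * m + 2) 1 (block_form (2 * m + 2) m 2 0 (minus_form a))
    = bilin (2 * m + 2) m 1 0 + (mvar m ^ 2 + mvar m * mvar (m + 1) + mconst a * mvar (m + 1) ^ 2)"
  by (subst mform_block_form) (simp_all add: sum_two minus_form_def power2_eq_square)

text \<open>Let c be the entry in question. The middle parts of columns m and m + 1 are (1, c) and
  (0, 1), with polar product 1 + 2ac, which has to remain 1. Irreducibility gives a nonzero, and 2
  is nonzero in odd characteristic, so c = 0.\<close>

lemma O_minus_middle:
  fixes a :: "'a::finite_field"
  assumes q: "CARD('a) = q" "odd q" and a: "Factorial_Ring.irreducible [:a, 1, 1:]"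
    and N: "N \<in> form_group q m 2 1 (mat_of_rows_list 2 [[2, 1], [1, 2 * a]])"
  shows "N $$ (Suc m, m) = 0"
proof -
  have two: "(2 :: 'a) \<noteq> 0"
    by (rule odd_card_two[OF q])
  have "a \<noteq> 0"
  proof
    assume "a = 0"
    then have "[:a, 1, 1:] = [:0, 1:] * [:1, 1:]" by simp
    moreover have "\<not> [:0, 1 :: 'a:] dvd 1" "\<not> [:1, 1 :: 'a:] dvd 1"
      by (simp_all add: is_unit_poly_iff)
    ultimately show False
      using Factorial_Ring.irreducibleD[OF a] by blast
  qed
  have U: "N \<in> unitriangular (2 * m + 2)"
    using N by (simp add: form_group_def)
  have "transform (2 * m + 2) 1 (block_form (2 * m + 2) m 2 0 (minus_form a)) N m (Suc m)
      + transform (2 * m + 2) 1 (block_form (2 * m + 2) m 2 0 (minus_form a)) N (Suc m) m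
      = block_form (2 * m + 2) m 2 0 (minus_form a) m (Suc m) + block_form (2 * m + 2) m 2 0 (minus_form a) (Suc m) m"
    using N by (simp only: form_group_quadratic_iff[OF q(1) refl O_minus_odd_entries])
  moreover have "block_form (2 * m + 2) m 2 0 (minus_form a) m (Suc m) + block_form (2 * m + 2) m 2 0 (minus_form a) (Suc m) m = 1"
    by (simp add: block_form_def minus_form_def)
  moreover have "N $$ (i, m) = 0" "N $$ (i, Suc m) = 0" if "i < m" for i
    using U that by (auto simp: unitriangular_def)
  moreover have "N $$ (m, m) = 1" "N $$ (m, Suc m) = 0" "N $$ (Suc m, Suc m) = 1"
    using U by (auto simp: unitriangular_def)
  ultimately have "2 * (a * N $$ (Suc m, m)) = 0"
    unfolding transform_block_form[OF refl] sum_two by (simp add: minus_form_def)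
  then show ?thesis
    using two \<open>a \<noteq> 0\<close> by simp
qed

lemma O_minus_odd_group:
  fixes a :: "'a::finite_field"
  assumes q: "CARD('a) = q" "odd q" and a: "Factorial_Ring.irreducible [:a, 1, 1:]"
  shows "form_group q m 2 1 (mat_of_rows_list 2 [[2, 1], [1, 2 * a]])
    = isom (2 * m + 2) m 2 (mform (2 * m + 2) 1 (block_form (2 * m + 2) m 2 0 (minus_form a)))"
proof (rule isom_quadratic_odd[OF q refl refl O_minus_odd_entries])
  fix N i j
  assume *: "N \<in> form_group q m 2 1 (mat_of_rows_list 2 [[2, 1], [1, 2 * a]])" and "m \<le> j" "j < i" "i < m + 2"
  then have "i = Suc m" "j = m" by simp_all
  then show "N $$ (i, j) = 0"
    using O_minus_middle[OF q a *] by simp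
qed

theorem theorem1p1:
  fixes q m n :: nat
    and Cl G :: "'a::finite_field mat set"
    and h :: "(nat, 'a) mvpoly"
  assumes "primepow q" and "m \<ge> 1"
    and "classical_group q m Cl n h G"
  shows "invariant_field n G = quot_field (invariant_ring n G)
       \<and> purely_transcendental (invariant_field n G)
       \<and> invariant_field n G
           = field_adjoin (to_fract ` (orbit_product G ` {..<n} \<union> steenrod_images h))"
proof -
  have n: "2 * (m - 1) + 2 = 2 * m" "2 * m = 2 * m + 0"
    using assms(2) by auto
  from assms(3) show ?thesis
  proof cases
    case GU_even
    obtain d e where q: "q = CHAR('a) ^ d" "CARD('a) = CHAR('a) ^ e" "q \<ge> 2"
      using primepow_card_CHAR[OF assms(1) GU_even(5)] by auto
    have qq: "c ^ (q * q) = c" for c :: 'a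
      using finite_field_power_card_eq_same[of c] by (simp add: GU_even(5) power2_eq_square)
    have group: "form_group q (m - 1) 2 1 (Jmat 2) = isom (2 * m) m 0 (bilin (2 * m) m q (1 :: 'a))"
      unfolding mform_0[where P = "\<lambda>_ _. 0", symmetric]
      by (rule form_group_sesquilinear[OF q(1,3) n _ form_mat_entry_hyperbolic[OF assms(2)]]) (simp_all add: Jmat_def)
    show ?thesis
      unfolding GU_even(1-4) bilin_forms group
      by (rule invariant_field_generators_isom[OF isometries_sesquilinear[OF q(2,1,3) qq _
        trace_kernel_and_image(1)[OF GU_even(5) q(1,3)]]]) simp
  next
    case GU_odd
    obtain d e where q: "q = CHAR('a) ^ d" "CARD('a) = CHAR('a) ^ e" "q \<ge> 2"
      using primepow_card_CHAR[OF assms(1) GU_odd(5)] by auto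
    have entries: "form_mat m 1 1 (mat_of_rows_list 1 [[1 :: 'a]]) $$ (i, j)
        = block_form (2 * m + 1) m 1 1 (\<lambda>_ _. 1) i j" if "i < 2 * m + 1" "j < 2 * m + 1" for i j
      unfolding form_mat_entry[OF refl that] by (auto simp: block_form_def mat_of_rows_list_def)
    have group: "form_group q m 1 1 (mat_of_rows_list 1 [[1]])
        = isom (2 * m + 1) m 1 (bilin (2 * m + 1) m q (1 :: 'a) + mvar m ^ (q + 1))"
      unfolding mform_sesquilinear_1[symmetric]
      by (rule form_group_sesquilinear[OF q(1,3) refl refl order_refl entries])
    show ?thesis
      unfolding GU_odd(1-4) bilin_forms group
      by (rule invariant_field_generators_isom[OF isometries_GU_odd[OF GU_odd(5) q(2,1,3)]])
  next
    case Sp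
    obtain d e where q: "q = CHAR('a) ^ d" "CARD('a) = CHAR('a) ^ e" "q \<ge> 2"
      using primepow_card_CHAR_1[OF assms(1) Sp(5)] by auto
    have cq: "c ^ q = c" for c :: 'a
      using finite_field_power_card_eq_same[of c] by (simp add: Sp(5))
    then have qq: "c ^ (q * q) = c" for c :: 'a
      by (simp add: power_mult)
    \<comment> \<open>Here |F| = q, so s^q = s throughout and the kernel is the whole field; the
      corner matrices are the symmetric ones.\<close>
    have "q \<le> card {s :: 'a. s ^ q + - 1 * s = 0}"
      using Sp(5) by (simp add: cq)
    note gens = invariant_field_generators_isom[OF isometries_sesquilinear[OF q(2,1,3) qq _ this]]
    have group: "form_group q (m - 1) 2 (- 1) Sp_X2 = isom (2 * m) m 0 (bilin (2 * m) m q (- 1 :: 'a))"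
      unfolding mform_0[where P = "\<lambda>_ _. 0", symmetric]
      by (rule form_group_sesquilinear[OF q(1,3) n _ form_mat_entry_hyperbolic[OF assms(2)]])
        (simp_all add: Sp_X2_def mat_of_rows_list_def)
    show ?thesis
      unfolding Sp(1-4) bilin_forms group by (rule gens) simp
  next
    case O_plus_odd_char
    obtain d e where q: "q = CHAR('a) ^ d" "CARD('a) = CHAR('a) ^ e"
      using primepow_card_CHAR_1[OF assms(1) O_plus_odd_char(5)] by auto
    have entries: "form_mat (m - 1) 2 1 (Jmat 2 :: 'a mat) $$ (i, j)
        = block_form (2 * m) m 0 0 (\<lambda>_ _. 0) i j + block_form (2 * m) m 0 0 (\<lambda>_ _. 0) j i"
      if "i < 2 * m" "j < 2 * m" for i j
      by (rule O_plus_entries[OF assms(2) that])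
    have group: "form_group q (m - 1) 2 1 (Jmat 2 :: 'a mat) = isom (2 * m) m 0 (bilin (2 * m) m 1 0)"
      unfolding mform_0[where P = "\<lambda>_ _. 0", symmetric]
      by (rule isom_quadratic_odd[OF O_plus_odd_char(5,6) n entries]) auto
    show ?thesis
      unfolding O_plus_odd_char(1-4) bilin_forms group
      by (rule invariant_field_generators_isom[OF isometries_O_plus[OF q(2)]])
  next
    case O_plus_even_char
    obtain d e where q: "q = CHAR('a) ^ d" "CARD('a) = CHAR('a) ^ e"
      using primepow_card_CHAR_1[OF assms(1) O_plus_even_char(5)] by auto
    show ?thesis
      using invariant_field_generators_isom[OF isometries_O_plus[OF q(2)]]
      unfolding O_plus_even_char(1-4) bilin_forms O_plus_even_group[OF O_plus_even_char(5,6) q(1) assms(2)] mform_0 .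
  next
    case (O_minus_odd_char a)
    obtain d e where q: "q = CHAR('a) ^ d" "CARD('a) = CHAR('a) ^ e"
      using primepow_card_CHAR_1[OF assms(1) O_minus_odd_char(5)] by auto
    show ?thesis
      using invariant_field_generators_isom[OF isometries_O_minus[OF q(2)]]
      unfolding O_minus_odd_char(1-4) bilin_forms O_minus_odd_group[OF O_minus_odd_char(5-7)] mform_minus .
  next
    case (O_minus_even_char a)
    obtain d e where q: "q = CHAR('a) ^ d" "CARD('a) = CHAR('a) ^ e"
      using primepow_card_CHAR_1[OF assms(1) O_minus_even_char(5)] by auto
    show ?thesis
      using invariant_field_generators_isom[OF isometries_O_minus[OF q(2)]]
      unfolding O_minus_even_char(1-4) bilin_forms O_minus_even_group[OF O_minus_even_char(5,6) q(1)] mform_minus .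
  next
    case O_odd_odd_char
    obtain d e where q: "q = CHAR('a) ^ d" "CARD('a) = CHAR('a) ^ e"
      using primepow_card_CHAR_1[OF assms(1) O_odd_odd_char(5)] by auto
    have entries: "form_mat m 1 1 (mat_of_rows_list 1 [[2 :: 'a]]) $$ (i, j)
        = block_form (2 * m + 1) m 1 0 (\<lambda>_ _. 1) i j + block_form (2 * m + 1) m 1 0 (\<lambda>_ _. 1) j i"
      if "i < 2 * m + 1" "j < 2 * m + 1" for i j
      unfolding block_form_symmetrize[OF refl that] form_mat_entry[OF refl that]
      by (auto simp: block_form_def mat_of_rows_list_def)
    have group: "form_group q m 1 1 (mat_of_rows_list 1 [[2 :: 'a]])
        = isom (2 * m + 1) m 1 (mform (2 * m + 1) 1 (block_form (2 * m + 1) m 1 0 (\<lambda>_ _. 1)))"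
      by (rule isom_quadratic_odd[OF O_odd_odd_char(5,6) refl refl entries]) auto
    show ?thesis
      unfolding O_odd_odd_char(1-4) bilin_forms group mform_quadratic_1
      by (rule invariant_field_generators_isom[OF isometries_O_odd[OF q(2)]])
  next
    case O_odd_even_char
    obtain d e where q: "q = CHAR('a) ^ d" "CARD('a) = CHAR('a) ^ e"
      using primepow_card_CHAR_1[OF assms(1) O_odd_even_char(5)] by auto
    show ?thesis
      using invariant_field_generators_isom[OF isometries_O_odd[OF q(2)]]
      unfolding O_odd_even_char(1-4) bilin_forms O_odd_even_group[OF O_odd_even_char(5,6) q(1)] mform_quadratic_1 .
  qed
qed

end
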